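(* Let $n \ge 2$, let $u \in \mathbb{S}^{n-1}$ and let $K$ be a $u$-finite compact set in $\mathbb{R}^n$. Then the limit $$\mathcal{I}_0(K) := \lim_{p \to -1^+} \frac{p+1}{n} \int_{K^n} \Delta(x_1,\ldots,x_n)^p\, dx_1\cdots dx_n$$ exists and $\mathcal{I}_0(K) = \mathcal{I}_u(K)$, where $$\mathcal{I}_u(K) := \frac{2}{n}\int_{(P_{u^\perp}K)^n} \Delta(\tilde y_1,\ldots,\tilde y_{n-1})^{-1}\, |R_{\mathbf y} \cap \theta_{\mathbf y}^\perp|_{n-1}\, dy_1\cdots dy_n .$$ Here $P_{u^\perp}K$ is the orthogonal projection of $K$ onto $u^\perp$, $\mathbf y = (y_1,\ldots,y_n) \in (u^\perp)^n$, $R_{\mathbf y} = \{(s^1,\ldots,s^n) \in \mathbb{R}^n : y_i + s^i u \in K,\ i=1,\ldots,n\}$, $\theta_{\mathbf y} \in \mathbb{S}^{n-1}$ satisfies $\sum_{i=1}^n \theta_{\mathbf y}^i y_i = 0$ (this linear dependency is unique up to sign for a.e. $\mathbf y$), and $\tilde y_1,\ldots,\tilde y_{n-1} \in \mathbb{R}^n$ are the $n-1$ rows of the $(n-1)\times n$ matrix whose $n$ columns are $y_1,\ldots,y_n$ (written in an orthonormal basis of $u^\perp$).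
   Context: $\Delta(x_1,\ldots,x_m)$ denotes the $m$-dimensional volume of the parallelotope spanned by $x_1,\ldots,x_m \in \mathbb{R}^n$. $|\cdot|_k$ is $k$-dimensional Hausdorff measure. Integration in each $dy_i$ is with respect to $(n-1)$-dimensional Hausdorff measure on $u^\perp$. A compact set $K$ in $\mathbb{R}^n$ is called $u$-finite if for a.e. $y \in u^\perp$, $K \cap (y + \mathbb{R}u)$ consists of a finite (possibly empty) disjoint union of closed intervals, each of positive length. *)

theory Defs
  imports "HOL-Analysis.Analysis"
begin

section \<open>Hausdorff measure\<close>

text \<open>
  The normalising factor \<open>unit_ball_vol k / 2 ^ k\<close> is the usual one, for which \<open>k\<close>-dimensional
  Hausdorff measure agrees with Lebesgue measure on \<open>k\<close>-dimensional Euclidean space.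
  Empty covering sets contribute \<open>0\<close> also for \<open>k = 0\<close> (where \<open>0 ^ 0 = 1\<close>), so finite covers
  are included.  Boundedness is required because \<^const>\<open>diameter\<close> is only meaningful for bounded sets.
\<close>

definition hausdorff_content :: "nat \<Rightarrow> real \<Rightarrow> 'a::metric_space set \<Rightarrow> ennreal" where
  "hausdorff_content k \<delta> A =
     (INF E \<in> {E :: nat \<Rightarrow> 'a set. A \<subseteq> (\<Union>i. E i) \<and> (\<forall>i. bounded (E i) \<and> diameter (E i) \<le> \<delta>)}.
        \<Sum>i. if E i = {} then 0 else ennreal (unit_ball_vol (real k) * (diameter (E i) / 2) ^ k))"

definition hausdorff :: "nat \<Rightarrow> 'a::metric_space set \<Rightarrow> ennreal" where
  "hausdorff k A = (SUP \<delta> \<in> {0<..}. hausdorff_content k \<delta> A)"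

text \<open>
  The outer measure \<^const>\<open>hausdorff\<close> restricted to the Borel sets, where it is countably additive
  because it is a metric outer measure (so \<^const>\<open>measure_of\<close> does not fall back to the zero measure).
\<close>

definition hausdorff_measure :: "nat \<Rightarrow> 'a::metric_space measure" where
  "hausdorff_measure k = measure_of UNIV (sets borel) (hausdorff k)"

section \<open>Volumes of parallelotopes\<close>

definition parallelotope :: "'i set \<Rightarrow> ('i \<Rightarrow> 'a::real_vector) \<Rightarrow> 'a set" where
  "parallelotope I x = {\<Sum>i\<in>I. t i *\<^sub>R x i | t. \<forall>i\<in>I. 0 \<le> t i \<and> t i \<le> 1}"

definition Delta :: "'i set \<Rightarrow> ('i \<Rightarrow> 'a::euclidean_space) \<Rightarrow> real" where
  "Delta I x = enn2real (hausdorff (card I) (parallelotope I x))"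

text \<open>
  Real powers of nonnegative reals with the convention that a negative power of \<open>0\<close> is \<open>\<infinity>\<close>
  (in contrast to \<^prop>\<open>0 powr p = (0::real)\<close>).
\<close>

definition epowr :: "real \<Rightarrow> real \<Rightarrow> ennreal" where
  "epowr x p = (if x = 0 \<and> p < 0 then \<infinity> else ennreal (x powr p))"

section \<open>The hyperplane orthogonal to a unit vector\<close>

definition perp_measure :: "real^'n \<Rightarrow> (real^'n) measure" where
  "perp_measure u = restrict_space (hausdorff_measure (CARD('n) - 1)) ({u}\<^sup>\<bottom>)"

text \<open>The orthogonal projection onto \<open>{u}\<^sup>\<bottom>\<close>, for a unit vector \<open>u\<close>.\<close>

definition perp_proj :: "real^'n \<Rightarrow> real^'n \<Rightarrow> real^'n" where
  "perp_proj u x = x - (x \<bullet> u) *\<^sub>R u"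

definition orthonormal_basis :: "'a::euclidean_space set \<Rightarrow> 'a set \<Rightarrow> bool" where
  "orthonormal_basis B V \<longleftrightarrow> pairwise orthogonal B \<and> (\<forall>b\<in>B. norm b = 1) \<and> span B = V"

definition u_finite :: "real^'n \<Rightarrow> (real^'n) set \<Rightarrow> bool" where
  "u_finite u K \<longleftrightarrow>
     (AE y in perp_measure u.
        \<exists>F. finite F \<and> disjoint F \<and>
            (\<forall>J\<in>F. \<exists>a b. a < b \<and> J = closed_segment (y + a *\<^sub>R u) (y + b *\<^sub>R u)) \<and>
            K \<inter> range (\<lambda>s. y + s *\<^sub>R u) = \<Union>F)"

section \<open>The functionals\<close>

text \<open>
  An \<open>n\<close>-tuple of vectors of \<open>real^'n\<close> is a function \<open>'n \<Rightarrow> real^'n\<close>, where \<open>n = CARD('n)\<close>.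
\<close>

definition fibre :: "real^'n \<Rightarrow> (real^'n) set \<Rightarrow> ('n \<Rightarrow> real^'n) \<Rightarrow> (real^'n) set" where
  "fibre u K y = {s. \<forall>i. y i + s $ i *\<^sub>R u \<in> K}"

text \<open>
  The matrix with columns \<open>y i\<close>, written in the orthonormal basis \<open>B\<close> of \<open>{u}\<^sup>\<bottom>\<close>, has one row
  for each \<open>b \<in> B\<close>.
\<close>

definition row_of :: "('n \<Rightarrow> real^'n) \<Rightarrow> real^'n \<Rightarrow> real^'n" where
  "row_of y b = (\<chi> i. y i \<bullet> b)"

definition unit_dependency :: "('n \<Rightarrow> real^'n) \<Rightarrow> real^'n \<Rightarrow> bool" where
  "unit_dependency y t \<longleftrightarrow> norm t = 1 \<and> (\<Sum>i\<in>UNIV. t $ i *\<^sub>R y i) = 0"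

definition moment :: "(real^'n) set \<Rightarrow> real \<Rightarrow> ennreal" where
  "moment K p =
     ennreal ((p + 1) / CARD('n)) *
     (\<integral>\<^sup>+x\<in>(UNIV \<rightarrow> K). epowr (Delta (UNIV :: 'n set) x) p \<partial>(\<Pi>\<^sub>M i\<in>UNIV. lborel))"

definition I_zero :: "(real^'n) set \<Rightarrow> ennreal" where
  "I_zero K = Lim (at_right (-1)) (moment K)"

definition I_dir ::
    "(real^'n) set \<Rightarrow> (('n \<Rightarrow> real^'n) \<Rightarrow> real^'n) \<Rightarrow> real^'n \<Rightarrow> (real^'n) set \<Rightarrow> ennreal" where
  "I_dir B \<theta> u K =
     ennreal (2 / CARD('n)) *
     (\<integral>\<^sup>+y\<in>(UNIV \<rightarrow> perp_proj u ` K).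
        epowr (Delta B (row_of y)) (-1) * hausdorff (CARD('n) - 1) (fibre u K y \<inter> {\<theta> y}\<^sup>\<bottom>)
      \<partial>(\<Pi>\<^sub>M i\<in>UNIV. perp_measure u))"

end

theory Submission
  imports Defs
begin

text \<open>
  Writing \<open>x\<^sub>i = y\<^sub>i + s\<^sub>i u\<close>, the determinant factors as
  \<open>\<Delta>(x\<^sub>1, \<dots>, x\<^sub>n) = D(y) \<bar>s \<bullet> \<theta>\<bar>\<close>, where \<open>D(y)\<close> is the volume spanned by the rows of \<open>y\<close>,
  because all these rows are orthogonal to \<open>\<theta>\<close>.  By Fubini the moment is the integral over \<open>y\<close> of
  \<open>D(y)\<^sup>p\<close> times \<open>(p + 1) \<integral> \<bar>t\<bar>\<^sup>p f(t) dt\<close>, where \<open>f(t)\<close> is the volume of the section of the fibre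
  \<open>R\<^sub>y\<close> by \<open>\<theta>\<^sup>\<bottom> + t \<theta>\<close>.  The measures \<open>(p + 1) / 2 \<bar>t\<bar>\<^sup>p dt\<close> concentrate at \<open>0\<close> as \<open>p \<rightarrow> -1\<close>, and \<open>f\<close> is
  continuous at \<open>0\<close> for almost every \<open>y\<close>, since \<open>R\<^sub>y\<close> is a finite union of boxes.  Dominated convergence
  applies because \<open>1 / D\<close> is locally integrable: \<open>D\<close> vanishes only in codimension two, which is made
  quantitative by integrating out one vector at a time (the last two together), each time using two
  minors and \<open>1 / max a b \<le> 1 / sqrt (a b)\<close>.

  The normalisation of Hausdorff measure enters through its equality with Lebesgue measure on Euclidean
  space: \<open>\<ge>\<close> is the isodiametric inequality (by Steiner symmetrization) and \<open>\<le>\<close> is Vitali's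
  covering theorem.  Product decompositions with respect to a hyperplane then follow from the
  invariance of Hausdorff measure under isometries.
\<close>

section \<open>Steiner symmetrization and the isodiametric inequality\<close>

text \<open>\<open>Delta B (row_of y)\<close> is a Hausdorff measure of a set inside
  \<open>real^'n\<close>, so no determinant is attached to it at the start; adjoining the unit
  vector \<theta> as an extra edge turns it into an n-dimensional volume. Near a zero of a single
  minor \<open>a\<close> only the bound 1 / |a| is available, and it diverges logarithmically in the
  variable in which \<open>a\<close> is affine. Two minors that are affine in independent directions
  give |a|^(-1/2) |b|^(-1/2) instead. Both directions have to lie in
  \<open>{u}\<^sup>\<bottom>\<close>. While three vectors are still missing they can be found, since
  at most one of the missing places is taken by \<open>u\<close>; with two missing vectors only one
  direction is left, and this forces the joint treatment of the last two. Continuity of the sections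
  at 0 rests on the faces of the boxes lying in hyperplanes s_i = r. These meet \<theta>^\<bottom>
  in null sets unless \<theta> is a coordinate vector up to sign, and then some y_i would vanish.
  Since \<theta> is an arbitrary choice function, the integrand of \<open>I_dir\<close> may be
  non-measurable; it is handled through its almost everywhere equality with a limit of measurable
  functions.\<close>

definition section_length :: "'a::euclidean_space \<Rightarrow> 'a set \<Rightarrow> 'a \<Rightarrow> ennreal" where
  "section_length b A x = (\<integral>\<^sup>+t. indicator A (x + (t - x \<bullet> b) *\<^sub>R b) \<partial>lborel)"

text \<open>For a unit vector \<open>b\<close>, \<open>section_length\<close> parametrises the line
  through \<open>x\<close> by its \<open>b\<close>-coordinate, so its value is the same at all
  points of the line. The symmetral therefore meets the line in the centred open interval of that
  length. Because the inequality is strict, lines with a null section disappear; an infinite section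
  becomes the whole line.\<close>

definition steiner :: "'a::euclidean_space \<Rightarrow> 'a set \<Rightarrow> 'a set" where
  "steiner b A = {x. ennreal (2 * \<bar>x \<bullet> b\<bar>) < section_length b A x}"

definition reflect :: "'a::euclidean_space \<Rightarrow> 'a \<Rightarrow> 'a" where
  "reflect b x = x - (2 * (x \<bullet> b)) *\<^sub>R b"

lemma borel_measurable_section_length [measurable]:
  assumes [measurable]: "A \<in> sets borel"
  shows "section_length b A \<in> borel_measurable borel"
  unfolding section_length_def by measurable

lemma steiner_borel:
  assumes [measurable]: "A \<in> sets borel"
  shows "steiner b A \<in> sets borel"
  unfolding steiner_def by measurable

lemma emeasure_centered_interval: "(\<integral>\<^sup>+t. indicator {t. ennreal (2 * \<bar>t\<bar>) < m} t \<partial>lborel) = m"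
proof (cases m)
  case (real r)
  have "{t. ennreal (2 * \<bar>t\<bar>) < m} = {-(r/2)<..<r/2}"
    using real by (auto simp: ennreal_less_iff abs_if split: if_splits)
  then show ?thesis using real by simp
next
  case top
  have "{t::real. ennreal (2 * \<bar>t\<bar>) < m} = UNIV" using top by auto
  then show ?thesis using top by simp
qed

lemma nn_integral_lborel_coordinate:
  fixes f :: "'a::euclidean_space \<Rightarrow> ennreal"
  assumes b: "b \<in> Basis" and [measurable]: "f \<in> borel_measurable borel"
  shows "(\<integral>\<^sup>+x. f x \<partial>lborel) =
    (\<integral>\<^sup>+g. (\<integral>\<^sup>+t. f ((\<Sum>c\<in>Basis - {b}. g c *\<^sub>R c) + t *\<^sub>R b) \<partial>lborel) \<partial>(\<Pi>\<^sub>M c\<in>Basis - {b}. lborel))"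
proof -
  interpret product_sigma_finite "\<lambda>_::'a. lborel::real measure" by standard
  have ins: "Basis = insert b (Basis - {b})" using b by auto
  have "(\<integral>\<^sup>+x. f x \<partial>lborel) = (\<integral>\<^sup>+g. f (\<Sum>c\<in>Basis. g c *\<^sub>R c) \<partial>(\<Pi>\<^sub>M c\<in>Basis. lborel))"
    by (subst lborel_eq) (simp add: nn_integral_distr)
  also have "\<dots> = (\<integral>\<^sup>+g. f (\<Sum>c\<in>Basis. g c *\<^sub>R c) \<partial>(\<Pi>\<^sub>M c\<in>insert b (Basis - {b}). lborel))"
    using ins by simp
  also have "\<dots> = (\<integral>\<^sup>+g. (\<integral>\<^sup>+t. f (\<Sum>c\<in>Basis. (g(b := t)) c *\<^sub>R c) \<partial>lborel) \<partial>(\<Pi>\<^sub>M c\<in>Basis - {b}. lborel))"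
    by (rule product_nn_integral_insert) (auto simp: ins[symmetric])
  finally have *: "(\<integral>\<^sup>+x. f x \<partial>lborel) = \<dots>" .
  have eq: "(\<Sum>c\<in>Basis. (g(b := t)) c *\<^sub>R c) = (\<Sum>c\<in>Basis - {b}. g c *\<^sub>R c) + t *\<^sub>R b" for g :: "'a \<Rightarrow> real" and t
    by (subst sum.remove[of _ b]) (auto simp: b add.commute intro!: sum.cong)
  show ?thesis using * unfolding eq .
qed

text \<open>Cavalieri's principle: on every line parallel to \<open>b\<close> the section is
  replaced by an interval of the same length.\<close>

lemma emeasure_steiner:
  fixes A :: "'a::euclidean_space set"
  assumes b: "b \<in> Basis" and A: "A \<in> sets borel"
  shows "emeasure lborel (steiner b A) = emeasure lborel A"
proof -
  note [measurable] = A steiner_borel[OF A]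
  have orth: "(\<Sum>c\<in>Basis - {b}. g c *\<^sub>R c) \<bullet> b = 0" for g :: "'a \<Rightarrow> real"
    using b by (auto simp: inner_sum_left inner_Basis intro!: sum.neutral)
  have eq: "(\<integral>\<^sup>+t. indicator (steiner b A) ((\<Sum>c\<in>Basis - {b}. g c *\<^sub>R c) + t *\<^sub>R b) \<partial>lborel)
     = (\<integral>\<^sup>+t. indicator A ((\<Sum>c\<in>Basis - {b}. g c *\<^sub>R c) + t *\<^sub>R b) \<partial>lborel)" (is "?L = ?R") for g :: "'a \<Rightarrow> real"
  proof -
    let ?x = "\<Sum>c\<in>Basis - {b}. g c *\<^sub>R c"
    have in_b: "(?x + t *\<^sub>R b) \<bullet> b = t" for t using orth b by (simp add: inner_left_distrib)
    have "section_length b A (?x + t *\<^sub>R b) = ?R" for t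
      unfolding section_length_def by (simp only: in_b) (simp add: algebra_simps)
    then have "?L = (\<integral>\<^sup>+t. indicator {t. ennreal (2 * \<bar>t\<bar>) < ?R} t \<partial>lborel)"
      by (intro nn_integral_cong) (simp add: steiner_def in_b indicator_def)
    also have "\<dots> = ?R" by (rule emeasure_centered_interval)
    finally show ?thesis .
  qed
  have "emeasure lborel (steiner b A) = (\<integral>\<^sup>+x. indicator (steiner b A) x \<partial>lborel)" by simp
  also have "\<dots> = (\<integral>\<^sup>+x. indicator A x \<partial>lborel)"
    by (subst (1 2) nn_integral_lborel_coordinate[OF b]) (simp_all add: eq)
  finally show ?thesis by simp
qed

text \<open>If all distances were at most p + q, then Sup P - Inf Q and Sup Q - Inf P would be too.
  Their sum is (Sup P - Inf P) + (Sup Q - Inf Q), which exceeds 2p + 2q because the measures of P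
  and Q are bounded by these two spans.\<close>

lemma exists_far_points:
  fixes P Q :: "real set"
  assumes [measurable]: "P \<in> sets borel" "Q \<in> sets borel"
    and P: "ennreal (2 * p) < emeasure lborel P" "0 \<le> p" and Q: "ennreal (2 * q) < emeasure lborel Q" "0 \<le> q"
  shows "\<exists>s\<in>P. \<exists>t\<in>Q. p + q < \<bar>s - t\<bar>"
proof (rule ccontr)
  assume "\<not> ?thesis"
  then have le: "\<bar>s - t\<bar> \<le> p + q" if "s \<in> P" "t \<in> Q" for s t using that by force
  have ne: "P \<noteq> {}" "Q \<noteq> {}" using P Q by auto
  then obtain s0 t0 where st: "s0 \<in> P" "t0 \<in> Q" by auto
  have bP: "bdd_above P" "bdd_below P"
  proof -
    have "s \<le> t0 + (p + q) \<and> t0 - (p + q) \<le> s" if "s \<in> P" for s using le[OF that st(2)] by auto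
    then show "bdd_above P" "bdd_below P" unfolding bdd_above_def bdd_below_def by blast+
  qed
  have bQ: "bdd_above Q" "bdd_below Q"
  proof -
    have "t \<le> s0 + (p + q) \<and> s0 - (p + q) \<le> t" if "t \<in> Q" for t using le[OF st(1) that] by auto
    then show "bdd_above Q" "bdd_below Q" unfolding bdd_above_def bdd_below_def by blast+
  qed
  have meas: "emeasure lborel X \<le> ennreal (Sup X - Inf X)" if "X \<noteq> {}" "bdd_above X" "bdd_below X" "X \<in> sets borel" for X :: "real set"
  proof -
    have "X \<subseteq> {Inf X..Sup X}" using that by (auto intro: cInf_lower cSup_upper)
    then have "emeasure lborel X \<le> emeasure lborel {Inf X..Sup X}" by (intro emeasure_mono) auto
    also have "\<dots> = ennreal (Sup X - Inf X)" using cInf_le_cSup[OF that(1,2,3)] by simp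
    finally show ?thesis .
  qed
  have "2 * p < Sup P - Inf P" "2 * q < Sup Q - Inf Q"
    using P Q meas[OF ne(1) bP assms(1)] meas[OF ne(2) bQ assms(2)]
    by (auto simp: ennreal_less_iff[symmetric] dest: less_le_trans)
  moreover have "Sup P \<le> Inf Q + (p + q)"
  proof (rule cSup_least[OF ne(1)])
    fix s assume "s \<in> P"
    then have "s - (p + q) \<le> t" if "t \<in> Q" for t using le[of s t] that by auto
    then have "s - (p + q) \<le> Inf Q" by (intro cInf_greatest[OF ne(2)]) auto
    then show "s \<le> Inf Q + (p + q)" by simp
  qed
  moreover have "Sup Q \<le> Inf P + (p + q)"
  proof (rule cSup_least[OF ne(2)])
    fix s assume "s \<in> Q"
    then have "s - (p + q) \<le> t" if "t \<in> P" for t using le[of t s] that by auto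
    then have "s - (p + q) \<le> Inf P" by (intro cInf_greatest[OF ne(1)]) auto
    then show "s \<le> Inf P + (p + q)" by simp
  qed
  ultimately show False by argo
qed

lemma norm_mono_component:
  fixes z :: "'a::euclidean_space"
  assumes b: "norm b = 1" and "\<bar>z \<bullet> b\<bar> \<le> \<bar>r\<bar>"
  shows "norm z \<le> norm (z + (r - z \<bullet> b) *\<^sub>R b)"
proof -
  have bb: "b \<bullet> b = 1" using b by (simp add: norm_eq_1)
  have "(z \<bullet> b)\<^sup>2 \<le> r\<^sup>2" using assms(2) by (simp add: abs_le_square_iff)
  moreover have "(z + (r - z \<bullet> b) *\<^sub>R b) \<bullet> (z + (r - z \<bullet> b) *\<^sub>R b) = z \<bullet> z + (r\<^sup>2 - (z \<bullet> b)\<^sup>2)"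
    by (simp add: inner_left_distrib inner_right_distrib bb inner_commute algebra_simps power2_eq_square)
  ultimately show ?thesis by (simp add: norm_le)
qed

text \<open>The sections of \<open>A\<close> on the lines of \<open>x\<close> and \<open>y\<close>
  are longer than twice |x \<bullet> b| and |y \<bullet> b|. Hence they contain points of
  \<open>A\<close> whose \<open>b\<close>-coordinates are further apart than those of
  \<open>x\<close> and \<open>y\<close>, while the components orthogonal to \<open>b\<close> are
  unchanged.\<close>

lemma steiner_dist:
  fixes A :: "'a::euclidean_space set"
  assumes b: "b \<in> Basis" and [measurable]: "A \<in> sets borel" and d: "\<And>x y. x \<in> A \<Longrightarrow> y \<in> A \<Longrightarrow> dist x y \<le> d"
    and xy: "x \<in> steiner b A" "y \<in> steiner b A"
  shows "dist x y \<le> d"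
proof -
  define sec where "sec z = {t. z + (t - z \<bullet> b) *\<^sub>R b \<in> A}" for z
  have [measurable]: "sec z \<in> sets borel" for z unfolding sec_def by (measurable; simp)
  have len: "section_length b A z = emeasure lborel (sec z)" for z
  proof -
    have "section_length b A z = (\<integral>\<^sup>+t. indicator (sec z) t \<partial>lborel)"
      unfolding section_length_def by (intro nn_integral_cong) (simp add: sec_def indicator_def)
    then show ?thesis by simp
  qed
  obtain s t where st: "s \<in> sec x" "t \<in> sec y" "\<bar>x \<bullet> b\<bar> + \<bar>y \<bullet> b\<bar> < \<bar>s - t\<bar>"
    using exists_far_points[of "sec x" "sec y" "\<bar>x \<bullet> b\<bar>" "\<bar>y \<bullet> b\<bar>"] xy by (auto simp: steiner_def len)
  have "norm (x - y) \<le> norm ((x - y) + ((s - t) - (x - y) \<bullet> b) *\<^sub>R b)"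
    using b st by (intro norm_mono_component) (auto simp: inner_diff_left)
  also have "\<dots> = dist (x + (s - x \<bullet> b) *\<^sub>R b) (y + (t - y \<bullet> b) *\<^sub>R b)"
    by (simp add: dist_norm algebra_simps inner_diff_left)
  also have "\<dots> \<le> d" using st by (intro d) (auto simp: sec_def)
  finally show ?thesis by (simp add: dist_norm)
qed

lemma reflect_reflect [simp]: "b \<in> Basis \<Longrightarrow> reflect b (reflect b x) = x"
  by (simp add: reflect_def inner_diff_left algebra_simps)

lemma steiner_reflect_self:
  assumes b: "b \<in> Basis" and x: "x \<in> steiner b A"
  shows "reflect b x \<in> steiner b A"
proof -
  have xb: "reflect b x \<bullet> b = - (x \<bullet> b)" using b by (simp add: reflect_def inner_diff_left)
  have "reflect b x + (t - reflect b x \<bullet> b) *\<^sub>R b = x + (t - x \<bullet> b) *\<^sub>R b" for t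
    unfolding xb by (simp add: reflect_def algebra_simps flip: scaleR_left_distrib)
  then show ?thesis using x by (simp add: steiner_def section_length_def xb)
qed

text \<open>Reflection in \<open>c\<close> permutes the lines parallel to \<open>b\<close> and keeps
  the \<open>b\<close>-coordinate. This is why the symmetries gained earlier survive later
  symmetrizations.\<close>

lemma steiner_reflect_other:
  assumes bc: "b \<in> Basis" "c \<in> Basis" "b \<noteq> c" and A: "\<And>x. x \<in> A \<Longrightarrow> reflect c x \<in> A" and x: "x \<in> steiner b A"
  shows "reflect c x \<in> steiner b A"
proof -
  have cb: "reflect c x \<bullet> b = x \<bullet> b" using bc by (simp add: reflect_def inner_diff_left inner_Basis)
  have "reflect c x + (t - x \<bullet> b) *\<^sub>R b = reflect c (x + (t - x \<bullet> b) *\<^sub>R b)" for t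
    using bc by (simp add: reflect_def inner_left_distrib inner_Basis algebra_simps)
  moreover have "reflect c z \<in> A \<longleftrightarrow> z \<in> A" for z using A bc(2) by (metis reflect_reflect)
  ultimately have "section_length b A (reflect c x) = section_length b A x"
    by (simp add: section_length_def cb indicator_def)
  then show ?thesis using x cb by (simp add: steiner_def)
qed

lemma steiner_iterate:
  fixes A C :: "'a::euclidean_space set"
  assumes "C \<subseteq> Basis" "A \<in> sets borel" "\<And>x y. x \<in> A \<Longrightarrow> y \<in> A \<Longrightarrow> dist x y \<le> d"
  shows "\<exists>A'. A' \<in> sets borel \<and> emeasure lborel A' = emeasure lborel A \<and>
     (\<forall>x\<in>A'. \<forall>y\<in>A'. dist x y \<le> d) \<and> (\<forall>c\<in>C. \<forall>x\<in>A'. reflect c x \<in> A')"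
proof -
  have "finite C" using assms(1) finite_subset finite_Basis by blast
  then show ?thesis using assms(1)
  proof (induction C)
    case empty
    have "\<forall>x\<in>A. \<forall>y\<in>A. dist x y \<le> d" using assms(3) by blast
    then show ?case using assms(2) by - (rule exI[of _ A], simp)
  next
    case (insert b C)
    then obtain A' where A': "A' \<in> sets borel" "emeasure lborel A' = emeasure lborel A"
      "\<forall>x\<in>A'. \<forall>y\<in>A'. dist x y \<le> d" "\<forall>c\<in>C. \<forall>x\<in>A'. reflect c x \<in> A'" by auto
    have b: "b \<in> Basis" using insert by auto
    have dd: "dist x y \<le> d" if "x \<in> steiner b A'" "y \<in> steiner b A'" for x y
      by (rule steiner_dist[OF b A'(1) _ that]) (use A'(3) in blast)
    have r1: "reflect c x \<in> steiner b A'" if c: "c \<in> C" and x: "x \<in> steiner b A'" for c x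
    proof -
      have "c \<in> Basis" "b \<noteq> c" using c insert by auto
      then show ?thesis using A'(4) c by (intro steiner_reflect_other[OF b _ _ _ x]) auto
    qed
    have r2: "reflect b x \<in> steiner b A'" if "x \<in> steiner b A'" for x
      using steiner_reflect_self[OF b that] .
    show ?case
      using steiner_borel[OF A'(1), of b] emeasure_steiner[OF b A'(1)] A'(2) dd r1 r2
      by (intro exI[of _ "steiner b A'"]) auto
  qed
qed

text \<open>A set of diameter \<open>d\<close> need not fit into a ball of radius
  \<open>d / 2\<close>, but a centrally symmetric one does, since it contains \<open>- x\<close>
  together with \<open>x\<close>. Symmetrizing along every basis vector makes the set invariant
  under all coordinate reflections, whose composition is negation; the volume and the bound
  \<open>d\<close> are kept.\<close>

theorem isodiametric_inequality:
  fixes A :: "'a::euclidean_space set"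
  assumes A: "A \<in> sets borel" and d: "\<And>x y. x \<in> A \<Longrightarrow> y \<in> A \<Longrightarrow> dist x y \<le> d" and "0 \<le> d"
  shows "emeasure lborel A \<le> ennreal (unit_ball_vol (DIM('a)) * (d / 2) ^ DIM('a))"
proof -
  obtain A' :: "'a set" where A': "A' \<in> sets borel" "emeasure lborel A' = emeasure lborel A"
      "\<forall>x\<in>A'. \<forall>y\<in>A'. dist x y \<le> d" "\<forall>c\<in>Basis. \<forall>x\<in>A'. reflect c x \<in> A'"
    using steiner_iterate[OF subset_refl A, of d] d by metis
  have sym: "x - (\<Sum>c\<in>C. (2 * (x \<bullet> c)) *\<^sub>R c) \<in> A'" if "C \<subseteq> Basis" "x \<in> A'" for C x
  proof -
    have "finite C" using that(1) finite_subset finite_Basis by blast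
    then show ?thesis using that(1)
    proof (induction C)
      case empty then show ?case using that by simp
    next
      case (insert b C)
      let ?z = "x - (\<Sum>c\<in>C. (2 * (x \<bullet> c)) *\<^sub>R c)"
      have "(\<Sum>c\<in>C. (2 * (x \<bullet> c)) *\<^sub>R c) \<bullet> b = 0"
        unfolding inner_sum_left
      proof (intro sum.neutral ballI)
        fix c assume "c \<in> C"
        then have "c \<in> Basis" "b \<in> Basis" "c \<noteq> b" using insert by auto
        then show "((2 * (x \<bullet> c)) *\<^sub>R c) \<bullet> b = 0" by (simp add: inner_not_same_Basis)
      qed
      then have "?z \<bullet> b = x \<bullet> b" by (simp add: inner_diff_left)
      then have "reflect b ?z = x - (\<Sum>c\<in>insert b C. (2 * (x \<bullet> c)) *\<^sub>R c)"
        using insert by (simp add: reflect_def algebra_simps)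
      moreover have "reflect b ?z \<in> A'" using A'(4) insert by auto
      ultimately show ?case by simp
    qed
  qed
  have "- x \<in> A'" if "x \<in> A'" for x
  proof -
    have "(\<Sum>c\<in>Basis. (2 * (x \<bullet> c)) *\<^sub>R c) = 2 *\<^sub>R x"
      by (subst (2) euclidean_representation[of x, symmetric]) (simp only: scaleR_scaleR[symmetric] scaleR_sum_right)
    then show ?thesis using sym[OF subset_refl that] by (simp add: scaleR_2)
  qed
  then have "dist x (- x) \<le> d" if "x \<in> A'" for x using A'(3) that by blast
  then have "2 * norm x \<le> d" if "x \<in> A'" for x
    using that by (simp add: dist_norm flip: scaleR_2)
  then have "A' \<subseteq> cball 0 (d / 2)" by (fastforce simp: dist_norm)
  then have "emeasure lborel A' \<le> emeasure lborel (cball 0 (d / 2) :: 'a set)" by (rule emeasure_mono) simp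
  also have "\<dots> = ennreal (unit_ball_vol (DIM('a)) * (d / 2) ^ DIM('a))"
    using \<open>0 \<le> d\<close> by (intro emeasure_cball) auto
  finally show ?thesis using A' by simp
qed

section \<open>Hausdorff measure as a metric outer measure\<close>

definition cover_weight :: "nat \<Rightarrow> 'a::metric_space set \<Rightarrow> ennreal" where
  "cover_weight k E = (if E = {} then 0 else ennreal (unit_ball_vol (real k) * (diameter E / 2) ^ k))"

lemma cover_weight_empty [simp]: "cover_weight k {} = 0"
  by (simp add: cover_weight_def)

lemma hausdorff_content_le:
  assumes "A \<subseteq> (\<Union>i. E i)" "\<And>i. bounded (E i)" "\<And>i. diameter (E i) \<le> \<delta>"
  shows "hausdorff_content k \<delta> A \<le> (\<Sum>i. cover_weight k (E i))"
  unfolding hausdorff_content_def cover_weight_def by (rule INF_lower2[of E]) (use assms in auto)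

lemma hausdorff_content_greatest:
  assumes "\<And>E. A \<subseteq> (\<Union>i. E i) \<Longrightarrow> (\<And>i. bounded (E i)) \<Longrightarrow> (\<And>i. diameter (E i) \<le> \<delta>) \<Longrightarrow>
     x \<le> (\<Sum>i. cover_weight k (E i))"
  shows "x \<le> hausdorff_content k \<delta> A"
  unfolding hausdorff_content_def
  by (rule INF_greatest) (use assms in \<open>auto simp: cover_weight_def\<close>)

lemma hausdorff_content_less_cover:
  assumes "hausdorff_content k \<delta> A < x"
  obtains E where "A \<subseteq> (\<Union>i. E i)" "\<And>i. bounded (E i)" "\<And>i. diameter (E i) \<le> \<delta>"
    "(\<Sum>i. cover_weight k (E i)) < x"
  using assms unfolding hausdorff_content_def INF_less_iff cover_weight_def by blast

lemma hausdorff_content_mono: "A \<subseteq> B \<Longrightarrow> hausdorff_content k \<delta> A \<le> hausdorff_content k \<delta> B"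
  by (rule hausdorff_content_greatest, rule hausdorff_content_le) auto

lemma hausdorff_content_antimono: "\<delta> \<le> \<delta>' \<Longrightarrow> hausdorff_content k \<delta>' A \<le> hausdorff_content k \<delta> A"
  by (rule hausdorff_content_greatest, rule hausdorff_content_le) (auto intro: order_trans)

lemma hausdorff_content_le_hausdorff: "0 < \<delta> \<Longrightarrow> hausdorff_content k \<delta> A \<le> hausdorff k A"
  unfolding hausdorff_def by (rule SUP_upper) auto

lemma hausdorff_leI: "(\<And>\<delta>. 0 < \<delta> \<Longrightarrow> hausdorff_content k \<delta> A \<le> x) \<Longrightarrow> hausdorff k A \<le> x"
  unfolding hausdorff_def by (rule SUP_least) auto

lemma hausdorff_mono: "A \<subseteq> B \<Longrightarrow> hausdorff k A \<le> hausdorff k B"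
  by (rule hausdorff_leI) (meson hausdorff_content_mono hausdorff_content_le_hausdorff order_trans)

lemma hausdorff_content_empty: "0 \<le> \<delta> \<Longrightarrow> hausdorff_content k \<delta> {} = 0"
  using hausdorff_content_le[of "{}" "\<lambda>_. {}" \<delta> k] by (simp add: diameter_def)

lemma hausdorff_empty [simp]: "hausdorff k {} = 0"
  using hausdorff_leI[of k "{}" 0] by (simp add: hausdorff_content_empty)

lemma hausdorff_content_UN:
  fixes A :: "nat \<Rightarrow> 'a::metric_space set"
  shows "hausdorff_content k \<delta> (\<Union>n. A n) \<le> (\<Sum>n. hausdorff_content k \<delta> (A n))"
proof (cases "(\<Sum>n. hausdorff_content k \<delta> (A n)) = top")
  case False
  show ?thesis
  proof (rule ennreal_le_epsilon)
    fix e :: real assume e: "0 < e"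
    have ex: "\<exists>E. A n \<subseteq> (\<Union>i. E i) \<and> (\<forall>i. bounded (E i) \<and> diameter (E i) \<le> \<delta>) \<and>
      (\<Sum>i. cover_weight k (E i)) \<le> hausdorff_content k \<delta> (A n) + ennreal (e * (1/2) ^ Suc n)" for n
    proof -
      have "hausdorff_content k \<delta> (A n) \<noteq> top"
        using False ennreal_suminf_lessD[of "\<lambda>n. hausdorff_content k \<delta> (A n)" top n] by (auto simp: top.not_eq_extremum)
      then have "hausdorff_content k \<delta> (A n) < hausdorff_content k \<delta> (A n) + ennreal (e * (1/2) ^ Suc n)"
        using e by (cases "hausdorff_content k \<delta> (A n)") (auto simp: ennreal_less_iff simp flip: ennreal_plus)
      then show ?thesis by (rule hausdorff_content_less_cover) (auto intro: less_imp_le)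
    qed
    obtain E where E: "\<And>n. A n \<subseteq> (\<Union>i. E n i)" "\<And>n i. bounded (E n i)" "\<And>n i. diameter (E n i) \<le> \<delta>"
      "\<And>n. (\<Sum>i. cover_weight k (E n i)) \<le> hausdorff_content k \<delta> (A n) + ennreal (e * (1/2) ^ Suc n)"
      using ex by metis
    define F where "F m = (case prod_decode m of (n, i) \<Rightarrow> E n i)" for m
    have "hausdorff_content k \<delta> (\<Union>n. A n) \<le> (\<Sum>m. cover_weight k (F m))"
    proof (rule hausdorff_content_le)
      show "(\<Union>n. A n) \<subseteq> (\<Union>m. F m)"
      proof
        fix x assume "x \<in> (\<Union>n. A n)"
        then obtain n i where "x \<in> E n i" using E(1) by blast
        then have "x \<in> F (prod_encode (n, i))" by (simp add: F_def)
        then show "x \<in> (\<Union>m. F m)" by blast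
      qed
    qed (auto simp: F_def E split: prod.split)
    also have "\<dots> = (\<Sum>n. \<Sum>i. cover_weight k (E n i))"
    proof -
      have "(\<Sum>m. (\<lambda>(n, i). cover_weight k (E n i)) (prod_decode m)) = (\<Sum>n. \<Sum>i. cover_weight k (E n i))"
        by (rule suminf_ennreal_2dimen) simp
      moreover have "(\<lambda>(n, i). cover_weight k (E n i)) (prod_decode m) = cover_weight k (F m)" for m
        by (simp add: F_def split: prod.split)
      ultimately show ?thesis by simp
    qed
    also have "\<dots> \<le> (\<Sum>n. hausdorff_content k \<delta> (A n) + ennreal (e * (1/2) ^ Suc n))"
      by (intro suminf_le E) auto
    also have "\<dots> = (\<Sum>n. hausdorff_content k \<delta> (A n)) + (\<Sum>n. ennreal (e * (1/2) ^ Suc n))"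
      by (rule suminf_add[symmetric]) auto
    also have "(\<Sum>n. ennreal (e * (1/2) ^ Suc n)) = ennreal e"
    proof -
      have "(\<lambda>n. e * (1/2) ^ Suc n) sums (e * 1)" by (intro sums_mult power_half_series)
      then show ?thesis using e by (subst suminf_ennreal_eq[of _ e]) auto
    qed
    finally show "hausdorff_content k \<delta> (\<Union>n. A n) \<le> (\<Sum>n. hausdorff_content k \<delta> (A n)) + ennreal e" .
  qed
qed auto

lemma hausdorff_UN:
  fixes A :: "nat \<Rightarrow> 'a::metric_space set"
  shows "hausdorff k (\<Union>n. A n) \<le> (\<Sum>n. hausdorff k (A n))"
proof (rule hausdorff_leI)
  fix \<delta> :: real assume "0 < \<delta>"
  then have "(\<Sum>n. hausdorff_content k \<delta> (A n)) \<le> (\<Sum>n. hausdorff k (A n))"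
    by (intro suminf_le hausdorff_content_le_hausdorff) auto
  then show "hausdorff_content k \<delta> (\<Union>n. A n) \<le> (\<Sum>n. hausdorff k (A n))"
    using hausdorff_content_UN order_trans by blast
qed

lemma hausdorff_content_Un:
  assumes "0 \<le> \<delta>"
  shows "hausdorff_content k \<delta> (A \<union> B) \<le> hausdorff_content k \<delta> A + hausdorff_content k \<delta> B"
proof -
  let ?C = "\<lambda>n::nat. if n = 0 then A else if n = 1 then B else {}"
  have "A \<union> B \<subseteq> (\<Union>n. ?C n)"
  proof
    fix x assume "x \<in> A \<union> B"
    then have "x \<in> ?C 0 \<or> x \<in> ?C 1" by auto
    then show "x \<in> (\<Union>n. ?C n)" by blast
  qed
  then have "hausdorff_content k \<delta> (A \<union> B) \<le> (\<Sum>n. hausdorff_content k \<delta> (?C n))"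
    using hausdorff_content_mono hausdorff_content_UN order_trans by blast
  also have "\<dots> = (\<Sum>n<2. hausdorff_content k \<delta> (?C n))"
    using assms by (intro suminf_finite) (auto simp: hausdorff_content_empty)
  also have "\<dots> = hausdorff_content k \<delta> A + hausdorff_content k \<delta> B" by (simp add: numeral_2_eq_2)
  finally show ?thesis .
qed

lemma hausdorff_Un: "hausdorff k (A \<union> B) \<le> hausdorff k A + hausdorff k B"
proof (rule hausdorff_leI)
  fix \<delta> :: real assume d: "0 < \<delta>"
  have "hausdorff_content k \<delta> (A \<union> B) \<le> hausdorff_content k \<delta> A + hausdorff_content k \<delta> B"
    using d by (simp add: hausdorff_content_Un)
  also have "\<dots> \<le> hausdorff k A + hausdorff k B" by (intro add_mono hausdorff_content_le_hausdorff d)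
  finally show "hausdorff_content k \<delta> (A \<union> B) \<le> hausdorff k A + hausdorff k B" .
qed

text \<open>Once \<delta> < e, no covering set meets both \<open>A\<close> and \<open>B\<close>, so
  each cover splits into a cover of \<open>A\<close> and one of \<open>B\<close>. The content
  increases as \<delta> decreases, hence the supremum is a limit at 0 and the inequality for small
  \<delta> passes to it.\<close>

lemma hausdorff_separated:
  fixes A B :: "'a::metric_space set"
  assumes e: "0 < e" and sep: "\<And>x y. x \<in> A \<Longrightarrow> y \<in> B \<Longrightarrow> e \<le> dist x y"
  shows "hausdorff k A + hausdorff k B \<le> hausdorff k (A \<union> B)"
proof -
  have content: "hausdorff_content k \<delta> A + hausdorff_content k \<delta> B \<le> hausdorff_content k \<delta> (A \<union> B)" if \<delta>: "0 < \<delta>" "\<delta> < e" for \<delta>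
  proof (rule hausdorff_content_greatest)
    fix E :: "nat \<Rightarrow> 'a set" assume E: "A \<union> B \<subseteq> (\<Union>i. E i)" "\<And>i. bounded (E i)" "\<And>i. diameter (E i) \<le> \<delta>"
    define F where "F X i = (if E i \<inter> X = {} then {} else E i)" for X and i :: nat
    have 1: "hausdorff_content k \<delta> X \<le> (\<Sum>i. cover_weight k (F X i))" if "X \<subseteq> A \<union> B" for X
    proof (rule hausdorff_content_le)
      show "X \<subseteq> (\<Union>i. F X i)" using E(1) that by (fastforce simp: F_def)
      show "bounded (F X i)" for i using E(2) by (simp add: F_def)
      show "diameter (F X i) \<le> \<delta>" for i using E(3)[of i] \<delta> by (simp add: F_def diameter_empty)
    qed
    have "cover_weight k (F A i) + cover_weight k (F B i) \<le> cover_weight k (E i)" for i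
    proof -
      have "F A i = {} \<or> F B i = {}"
      proof (rule ccontr)
        assume "\<not> ?thesis"
        then obtain x y where "x \<in> A" "y \<in> B" "x \<in> E i" "y \<in> E i" by (auto simp: F_def split: if_splits)
        then have "e \<le> dist x y" "dist x y \<le> diameter (E i)" using sep diameter_bounded_bound[OF E(2)] by auto
        then show False using \<delta> E(3)[of i] by linarith
      qed
      then show ?thesis
      proof
        assume "F A i = {}"
        then show ?thesis by (simp add: F_def)
      next
        assume "F B i = {}"
        then show ?thesis by (simp add: F_def)
      qed
    qed
    then have "(\<Sum>i. cover_weight k (F A i) + cover_weight k (F B i)) \<le> (\<Sum>i. cover_weight k (E i))"
      by (intro suminf_le) auto
    then have "(\<Sum>i. cover_weight k (F A i)) + (\<Sum>i. cover_weight k (F B i)) \<le> (\<Sum>i. cover_weight k (E i))"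
      by (subst suminf_add) auto
    then show "hausdorff_content k \<delta> A + hausdorff_content k \<delta> B \<le> (\<Sum>i. cover_weight k (E i))"
      using add_mono[OF 1[of A] 1[of B]] by (auto intro: order_trans)
  qed
  have lim: "((\<lambda>\<delta>. hausdorff_content k \<delta> X) \<longlongrightarrow> hausdorff k X) (at_right 0)" for X :: "'a set"
  proof (rule increasing_tendsto)
    show "\<forall>\<^sub>F \<delta> in at_right 0. hausdorff_content k \<delta> X \<le> hausdorff k X"
      using eventually_at_right_less[of 0] by eventually_elim (rule hausdorff_content_le_hausdorff)
    fix x assume "x < hausdorff k X"
    then obtain \<delta> where d: "0 < \<delta>" "x < hausdorff_content k \<delta> X" unfolding hausdorff_def less_SUP_iff by auto
    have "\<forall>\<^sub>F \<epsilon> in at_right 0. \<epsilon> < \<delta>" using d(1) by (auto simp: eventually_at_right)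
    then show "\<forall>\<^sub>F \<epsilon> in at_right 0. x < hausdorff_content k \<epsilon> X"
      by eventually_elim (meson d(2) hausdorff_content_antimono less_imp_le less_le_trans)
  qed
  show ?thesis
  proof (rule tendsto_le[OF _ lim tendsto_add[OF lim lim]])
    have "\<forall>\<^sub>F \<delta> in at_right 0. 0 < \<delta> \<and> \<delta> < e" using e by (auto simp: eventually_at_right)
    then show "\<forall>\<^sub>F \<delta> in at_right 0. hausdorff_content k \<delta> A + hausdorff_content k \<delta> B \<le> hausdorff_content k \<delta> (A \<union> B)"
      by eventually_elim (auto intro: content)
  qed simp
qed

lemma hausdorff_separated_sum:
  fixes R :: "nat \<Rightarrow> 'a::metric_space set"
  assumes "\<And>i j. i < j \<Longrightarrow> \<exists>e>0. \<forall>x\<in>R i. \<forall>y\<in>R j. e \<le> dist x y"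
  shows "(\<Sum>i<n. hausdorff k (R i)) \<le> hausdorff k (\<Union>i<n. R i)"
proof (induction n)
  case (Suc n)
  have "\<forall>i. \<exists>e. i < n \<longrightarrow> 0 < e \<and> (\<forall>x\<in>R i. \<forall>y\<in>R n. e \<le> dist x y)" using assms(1) by blast
  then have "\<exists>e. \<forall>i. i < n \<longrightarrow> 0 < e i \<and> (\<forall>x\<in>R i. \<forall>y\<in>R n. e i \<le> dist x y)" by (rule choice)
  then obtain e where e: "\<And>i. i < n \<Longrightarrow> 0 < e i" "\<And>i x y. i < n \<Longrightarrow> x \<in> R i \<Longrightarrow> y \<in> R n \<Longrightarrow> e i \<le> dist x y"
    by blast
  define m where "m = Min (insert 1 (e ` {..<n}))"
  have "0 < m" unfolding m_def using e(1) by (subst Min_gr_iff) auto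
  moreover have "m \<le> e i" if "i < n" for i unfolding m_def using that by (intro Min_le) auto
  ultimately have "hausdorff k (\<Union>i<n. R i) + hausdorff k (R n) \<le> hausdorff k ((\<Union>i<n. R i) \<union> R n)"
    by (intro hausdorff_separated[of m]) (use e(2) in \<open>blast intro: order_trans\<close>)+
  moreover have "(\<Union>i<n. R i) \<union> R n = (\<Union>i<Suc n. R i)" by (auto simp: less_Suc_eq)
  ultimately have "hausdorff k (\<Union>i<n. R i) + hausdorff k (R n) \<le> hausdorff k (\<Union>i<Suc n. R i)" by simp
  then have "(\<Sum>i<n. hausdorff k (R i)) + hausdorff k (R n) \<le> hausdorff k (\<Union>i<Suc n. R i)"
    using add_right_mono[OF Suc.IH] order_trans by blast
  then show ?case by (simp add: add.commute)
qed simp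

text \<open>Caratheodory's argument: \<open>D n\<close> keeps a positive distance from
  \<open>F\<close>, and the rest of \<open>T - F\<close> is made of the shells \<open>R i\<close>
  with i \<ge> n. Shells whose indices differ by at least 2 are separated, so the even and the odd
  shells each have total measure at most that of \<open>T\<close>. The series of all shells
  converges and its tail, the error of replacing \<open>T - F\<close> by \<open>D n\<close>, tends
  to 0.\<close>

lemma closed_caratheodory_hausdorff:
  fixes F T :: "'a::metric_space set"
  assumes "closed F"
  shows "hausdorff k (T \<inter> F) + hausdorff k (T - F) = hausdorff k T"
\<comment> \<open>The empty set is set aside because \<open>infdist\<close> to it is 0 by
  convention; infinite measure is set aside because the convergence of the series of shells needs a
  finite bound.\<close>
proof (cases "F = {} \<or> hausdorff k T = top")
  case True
  then show ?thesis
  proof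
    assume "hausdorff k T = top"
    moreover have "hausdorff k T \<le> hausdorff k (T \<inter> F) + hausdorff k (T - F)"
      using hausdorff_Un[of k "T \<inter> F" "T - F"] by (simp add: Int_Diff_Un)
    ultimately show ?thesis by (simp add: top_unique)
  qed simp
next
  case False
  then have F: "F \<noteq> {}" and fin: "hausdorff k T < top" by (auto simp: top.not_eq_extremum)
  define D where "D n = {x\<in>T. 1 / real (Suc n) \<le> infdist x F}" for n
  define R where "R n = {x\<in>T. 1 / real (Suc (Suc n)) \<le> infdist x F \<and> infdist x F < 1 / real (Suc n)}" for n
  have un: "T - F = D n \<union> (\<Union>i. R (n + i))" for n
  proof
    show "D n \<union> (\<Union>i. R (n + i)) \<subseteq> T - F"
    proof -
      have "infdist x F = 0" if "x \<in> F" for x using that by simp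
      then show ?thesis by (auto simp: D_def R_def)
    qed
    show "T - F \<subseteq> D n \<union> (\<Union>i. R (n + i))"
    proof
      fix x assume x: "x \<in> T - F"
      then have "0 < infdist x F" using assms F in_closed_iff_infdist_zero[of F x] infdist_nonneg[of x F] by force
      then obtain m0 where "1 / real (Suc m0) < infdist x F" using nat_approx_posE by auto
      then have ex: "\<exists>m. 1 / real (Suc m) \<le> infdist x F" by (intro exI[of _ m0]) simp
      define m where "m = (LEAST m. 1 / real (Suc m) \<le> infdist x F)"
      have m: "1 / real (Suc m) \<le> infdist x F" unfolding m_def by (rule LeastI_ex[OF ex])
      show "x \<in> D n \<union> (\<Union>i. R (n + i))"
      proof (cases "m \<le> n")
        case True
        then have "1 / real (Suc n) \<le> 1 / real (Suc m)" by (simp add: frac_le)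
        then show ?thesis using m x by (auto simp: D_def)
      next
        case False
        then obtain i where i: "m = Suc (n + i)" by (metis add_Suc_right less_imp_Suc_add not_le)
        have "\<not> 1 / real (Suc (n + i)) \<le> infdist x F"
          using not_less_Least[of "n + i" "\<lambda>m. 1 / real (Suc m) \<le> infdist x F"] i m_def by simp
        then have "x \<in> R (n + i)" using m x i by (auto simp: R_def)
        then show ?thesis by blast
      qed
    qed
  qed
  have sepR: "\<exists>e>0. \<forall>x\<in>R i. \<forall>y\<in>R j. e \<le> dist x y" if "Suc i < j" for i j
  proof (intro exI[of _ "1 / real (Suc (Suc i)) - 1 / real (Suc j)"] conjI ballI)
    show "0 < 1 / real (Suc (Suc i)) - 1 / real (Suc j)" using that by (simp add: frac_less2)
    fix x y assume "x \<in> R i" "y \<in> R j"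
    then have "1 / real (Suc (Suc i)) \<le> infdist x F" "infdist y F < 1 / real (Suc j)" by (auto simp: R_def)
    then show "1 / real (Suc (Suc i)) - 1 / real (Suc j) \<le> dist x y" using infdist_triangle[of x F y] by linarith
  qed
  have half: "(\<Sum>i. hausdorff k (R (2 * i + c))) \<le> hausdorff k T" for c
  proof (rule suminf_le_const)
    fix n
    have "(\<Sum>i<n. hausdorff k (R (2 * i + c))) \<le> hausdorff k (\<Union>i<n. R (2 * i + c))"
      by (rule hausdorff_separated_sum) (auto intro!: sepR)
    also have "\<dots> \<le> hausdorff k T" by (rule hausdorff_mono) (auto simp: R_def)
    finally show "(\<Sum>i<n. hausdorff k (R (2 * i + c))) \<le> hausdorff k T" .
  qed simp
  have sumR: "(\<Sum>i. hausdorff k (R i)) < top"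
  proof -
    have "(\<Sum>i. hausdorff k (R i)) \<le> hausdorff k T + hausdorff k T"
    proof (rule suminf_le_const)
      fix n
      have "(\<Sum>i<n. hausdorff k (R i)) \<le> (\<Sum>i<2 * n. hausdorff k (R i))"
        by (rule sum_mono2) auto
      also have "\<dots> = (\<Sum>i<n. hausdorff k (R (2 * i + 0))) + (\<Sum>i<n. hausdorff k (R (2 * i + 1)))"
        by (induction n) (simp_all add: algebra_simps)
      also have "\<dots> \<le> (\<Sum>i. hausdorff k (R (2 * i + 0))) + (\<Sum>i. hausdorff k (R (2 * i + 1)))"
        by (intro add_mono sum_le_suminf) auto
      also have "\<dots> \<le> hausdorff k T + hausdorff k T" by (intro add_mono half)
      finally show "(\<Sum>i<n. hausdorff k (R i)) \<le> hausdorff k T + hausdorff k T" .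
    qed simp
    also have "\<dots> < top" using fin by simp
    finally show ?thesis .
  qed
  have sepD: "hausdorff k (T \<inter> F) + hausdorff k (D n) \<le> hausdorff k T" for n
  proof -
    have "hausdorff k (T \<inter> F) + hausdorff k (D n) \<le> hausdorff k (T \<inter> F \<union> D n)"
    proof (rule hausdorff_separated[of "1 / real (Suc n)"])
      fix x y assume "x \<in> T \<inter> F" "y \<in> D n"
      then have "infdist y F \<le> dist y x" "1 / real (Suc n) \<le> infdist y F" by (auto simp: D_def intro: infdist_le)
      then show "1 / real (Suc n) \<le> dist x y" by (simp add: dist_commute)
    qed simp
    also have "\<dots> \<le> hausdorff k T" by (rule hausdorff_mono) (auto simp: D_def)
    finally show ?thesis .
  qed
  have bound: "hausdorff k (T \<inter> F) + hausdorff k (T - F) \<le> hausdorff k T + (\<Sum>i. hausdorff k (R (i + n)))" for n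
  proof -
    have "hausdorff k (T - F) \<le> hausdorff k (D n) + hausdorff k (\<Union>i. R (n + i))"
      unfolding un[of n] by (rule hausdorff_Un)
    also have "\<dots> \<le> hausdorff k (D n) + (\<Sum>i. hausdorff k (R (n + i)))"
      by (intro add_left_mono hausdorff_UN)
    finally have "hausdorff k (T \<inter> F) + hausdorff k (T - F)
       \<le> (hausdorff k (T \<inter> F) + hausdorff k (D n)) + (\<Sum>i. hausdorff k (R (n + i)))"
      by (simp add: add_left_mono add.assoc)
    also have "\<dots> \<le> hausdorff k T + (\<Sum>i. hausdorff k (R (n + i)))" by (intro add_right_mono sepD)
    finally show ?thesis by (simp add: add.commute)
  qed
  have "(\<lambda>n. \<Sum>i. hausdorff k (R (i + n))) \<longlonglongrightarrow> 0"
  proof -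
    define r where "r i = enn2real (hausdorff k (R i))" for i
    have fR: "hausdorff k (R i) < top" for i using ennreal_suminf_lessD[OF sumR] .
    then have r: "hausdorff k (R i) = ennreal (r i)" for i by (simp add: r_def)
    have r0: "0 \<le> r i" for i by (simp add: r_def)
    have "summable r" using sumR r0 unfolding r by (intro summable_suminf_not_top) auto
    then have "(\<lambda>n. \<Sum>i. r (i + n)) \<longlonglongrightarrow> 0" by (rule suminf_exist_split2)
    then have "(\<lambda>n. ennreal (\<Sum>i. r (i + n))) \<longlonglongrightarrow> ennreal 0" by (rule tendsto_ennrealI)
    moreover have "(\<Sum>i. hausdorff k (R (i + n))) = ennreal (\<Sum>i. r (i + n))" for n
      unfolding r using r0 \<open>summable r\<close> by (intro suminf_ennreal2) (auto simp: summable_iff_shift)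
    ultimately show ?thesis by simp
  qed
  then have "(\<lambda>n. hausdorff k T + (\<Sum>i. hausdorff k (R (i + n)))) \<longlonglongrightarrow> hausdorff k T + 0"
    by (intro tendsto_add tendsto_const)
  then have "hausdorff k (T \<inter> F) + hausdorff k (T - F) \<le> hausdorff k T"
    using bound by (intro LIMSEQ_le_const[of _ "hausdorff k T"]) auto
  moreover have "hausdorff k T \<le> hausdorff k (T \<inter> F) + hausdorff k (T - F)"
    using hausdorff_Un[of k "T \<inter> F" "T - F"] by (simp add: Int_Diff_Un)
  ultimately show ?thesis by simp
qed

text \<open>An outer measure is countably additive on the sets that split every set additively.
  These form a sigma-algebra, which contains the closed sets and hence all Borel sets.\<close>

lemma measure_space_hausdorff: "measure_space UNIV (sets borel) (hausdorff k :: 'a::metric_space set \<Rightarrow> ennreal)"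
proof -
  interpret sigma_algebra UNIV "Pow UNIV :: 'a set set" by (rule sigma_algebra_Pow)
  have oms: "outer_measure_space (Pow UNIV) (hausdorff k :: 'a set \<Rightarrow> ennreal)"
    unfolding outer_measure_space_def positive_def increasing_def countably_subadditive_def
    by (auto intro: hausdorff_mono hausdorff_UN)
  have ms: "measure_space UNIV (lambda_system UNIV (Pow UNIV) (hausdorff k)) (hausdorff k :: 'a set \<Rightarrow> ennreal)"
    by (rule caratheodory_lemma[OF oms])
  have "closed F \<Longrightarrow> F \<in> lambda_system UNIV (Pow UNIV) (hausdorff k)" for F :: "'a set"
    using closed_caratheodory_hausdorff[of F k]
    by (auto simp: lambda_system_def Int_commute Diff_eq)
  then have "sigma_sets UNIV (Collect closed) \<subseteq> lambda_system UNIV (Pow UNIV) (hausdorff k :: 'a set \<Rightarrow> ennreal)"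
    using ms by (intro sigma_algebra.sigma_sets_subset) (auto simp: measure_space_def)
  then have sub: "sets (borel :: 'a measure) \<subseteq> lambda_system UNIV (Pow UNIV) (hausdorff k)"
    by (simp add: borel_eq_closed)
  show ?thesis
    using measure_down[OF ms _ sub] sets.sigma_algebra_axioms[of "borel :: 'a measure"] by simp
qed

lemma sets_hausdorff_measure [simp, measurable_cong]: "sets (hausdorff_measure k) = sets borel"
  unfolding hausdorff_measure_def using sets.sigma_sets_eq[of borel] by (simp add: sets_measure_of)

lemma space_hausdorff_measure [simp]: "space (hausdorff_measure k) = UNIV"
  unfolding hausdorff_measure_def by (simp add: space_measure_of_conv)

lemma emeasure_hausdorff_measure:
  assumes "A \<in> sets borel"
  shows "emeasure (hausdorff_measure k) A = hausdorff k A"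
proof -
  have "hausdorff_measure k = measure_of UNIV (sets borel) (hausdorff k :: 'a set \<Rightarrow> ennreal)"
    by (simp add: hausdorff_measure_def)
  moreover have "sigma_sets UNIV (sets (borel :: 'a measure)) = sets borel"
    using sets.sigma_sets_eq[of "borel :: 'a measure"] by simp
  ultimately show ?thesis
    using measure_space_hausdorff[of k, where 'a = 'a] assms
    by (intro emeasure_measure_of[where \<Omega> = UNIV and A = "sets borel"]) (auto simp: measure_space_def)
qed

section \<open>Hausdorff measure and Lebesgue measure\<close>

lemma hausdorff_content_countable_cover:
  fixes E :: "'i \<Rightarrow> 'a::metric_space set"
  assumes I: "countable I" and A: "A \<subseteq> (\<Union>i\<in>I. E i)"
    and E: "\<And>i. i \<in> I \<Longrightarrow> bounded (E i)" "\<And>i. i \<in> I \<Longrightarrow> diameter (E i) \<le> \<delta>" and "0 \<le> \<delta>"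
  shows "hausdorff_content k \<delta> A \<le> (\<integral>\<^sup>+i. cover_weight k (E i) \<partial>count_space I)"
proof -
  define F where "F n = (if n \<in> to_nat_on I ` I then E (from_nat_into I n) else {})" for n
  have Fi: "F (to_nat_on I i) = E i" if "i \<in> I" for i using that I by (simp add: F_def)
  have "hausdorff_content k \<delta> A \<le> (\<Sum>n. cover_weight k (F n))"
  proof (rule hausdorff_content_le)
    show "A \<subseteq> (\<Union>n. F n)"
    proof
      fix x assume "x \<in> A"
      then obtain i where "i \<in> I" "x \<in> E i" using A by blast
      then have "x \<in> F (to_nat_on I i)" using Fi by simp
      then show "x \<in> (\<Union>n. F n)" by blast
    qed
    show "bounded (F n)" for n using E(1) Fi by (cases "n \<in> to_nat_on I ` I") (auto simp: F_def)
    show "diameter (F n) \<le> \<delta>" for n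
    proof (cases "n \<in> to_nat_on I ` I")
      case True
      then show ?thesis using E(2) Fi by force
    qed (use \<open>0 \<le> \<delta>\<close> in \<open>simp add: F_def diameter_empty\<close>)
  qed
  also have "\<dots> = (\<integral>\<^sup>+n. cover_weight k (F n) \<partial>count_space UNIV)"
    by (simp add: nn_integral_count_space_nat)
  also have "\<dots> = (\<integral>\<^sup>+n. cover_weight k (F n) \<partial>count_space (to_nat_on I ` I))"
    by (rule nn_integral_count_space_eq) (auto simp: F_def)
  also have "\<dots> = (\<integral>\<^sup>+i. cover_weight k (F (to_nat_on I i)) \<partial>count_space I)"
    using I by (intro nn_integral_bij_count_space[symmetric] inj_on_imp_bij_betw inj_on_to_nat_on)
  also have "\<dots> = (\<integral>\<^sup>+i. cover_weight k (E i) \<partial>count_space I)"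
    by (rule nn_integral_cong) (simp add: Fi)
  finally show ?thesis .
qed

text \<open>The covering sets are intersected with \<open>A\<close> before they are mapped, because
  \<open>f\<close> is controlled only there; the images have no larger diameter.\<close>

lemma hausdorff_lipschitz_le:
  assumes "\<And>x y. x \<in> A \<Longrightarrow> y \<in> A \<Longrightarrow> dist (f x) (f y) \<le> dist x y"
  shows "hausdorff k (f ` A) \<le> hausdorff k A"
proof (rule hausdorff_leI)
  fix \<delta> :: real assume d: "0 < \<delta>"
  have "hausdorff_content k \<delta> (f ` A) \<le> hausdorff_content k \<delta> A"
  proof (rule hausdorff_content_greatest)
    fix E :: "nat \<Rightarrow> 'a set"
    assume E: "A \<subseteq> (\<Union>i. E i)" "\<And>i. bounded (E i)" "\<And>i. diameter (E i) \<le> \<delta>"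
    let ?F = "\<lambda>i. f ` (E i \<inter> A)"
    have fd: "dist x y \<le> diameter (E i)" if xy: "x \<in> ?F i" "y \<in> ?F i" for x y i
    proof -
      obtain a b where ab: "x = f a" "y = f b" "a \<in> A" "b \<in> A" "a \<in> E i" "b \<in> E i" using xy by blast
      show ?thesis using assms[OF ab(3,4)] diameter_bounded_bound[OF E(2) ab(5,6)] ab(1,2) by simp
    qed
    have diam: "diameter (?F i) \<le> diameter (E i)" for i
    proof (cases "?F i = {}")
      case True
      then show ?thesis using diameter_ge_0[OF E(2)] by (simp only: diameter_empty)
    next
      case False
      then have "(SUP (x, y)\<in>?F i \<times> ?F i. dist x y) \<le> diameter (E i)"
        by (intro cSUP_least) (use fd[of _ i] in auto)
      then show ?thesis using False by (simp only: diameter_def if_False)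
    qed
    have bdd: "bounded (?F i)" for i unfolding bounded_two_points using fd by blast
    have "cover_weight k (?F i) \<le> cover_weight k (E i)" for i
      using diam[of i] diameter_ge_0[OF bdd]
      by (auto simp: cover_weight_def intro!: ennreal_leI mult_left_mono power_mono)
    then have "(\<Sum>i. cover_weight k (?F i)) \<le> (\<Sum>i. cover_weight k (E i))" by (intro suminf_le) auto
    moreover have "hausdorff_content k \<delta> (f ` A) \<le> (\<Sum>i. cover_weight k (?F i))"
    proof (rule hausdorff_content_le)
      show "f ` A \<subseteq> (\<Union>i. ?F i)" using E(1) by blast
      show "diameter (?F i) \<le> \<delta>" for i using diam E(3) order_trans by blast
    qed (rule bdd)
    ultimately show "hausdorff_content k \<delta> (f ` A) \<le> (\<Sum>i. cover_weight k (E i))" by simp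
  qed
  then show "hausdorff_content k \<delta> (f ` A) \<le> hausdorff k A"
    using hausdorff_content_le_hausdorff[OF d] order_trans by blast
qed

lemma hausdorff_isometric_image:
  assumes iso: "\<And>x y. x \<in> A \<Longrightarrow> y \<in> A \<Longrightarrow> dist (f x) (f y) = dist x y"
  shows "hausdorff k (f ` A) = hausdorff k A"
proof (rule antisym)
  show "hausdorff k (f ` A) \<le> hausdorff k A" by (rule hausdorff_lipschitz_le) (simp add: iso)
  have inj: "inj_on f A" by (intro inj_onI) (metis iso dist_eq_0_iff)
  have "hausdorff k (the_inv_into A f ` f ` A) \<le> hausdorff k (f ` A)"
    by (rule hausdorff_lipschitz_le) (auto simp: the_inv_into_f_f[OF inj] iso)
  moreover have "the_inv_into A f ` f ` A = A" using the_inv_into_f_f[OF inj] by (force simp: image_image)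
  ultimately show "hausdorff k A \<le> hausdorff k (f ` A)" by simp
qed

text \<open>Covering sets may be non-measurable, so they are replaced by their closures, which have
  the same diameter. The isodiametric inequality then compares volume and weight piece by piece, and
  the scale \<delta> = 1 is as good as any.\<close>

lemma lborel_le_hausdorff:
  fixes A :: "'a::euclidean_space set"
  assumes A: "A \<in> sets borel"
  shows "emeasure lborel A \<le> hausdorff (DIM('a)) A"
proof -
  have "emeasure lborel A \<le> hausdorff_content (DIM('a)) 1 A"
  proof (rule hausdorff_content_greatest)
    fix E :: "nat \<Rightarrow> 'a set"
    assume E: "A \<subseteq> (\<Union>i. E i)" "\<And>i. bounded (E i)" "\<And>i. diameter (E i) \<le> 1"
    have "A \<subseteq> (\<Union>i. closure (E i))" using E(1) closure_subset by blast
    then have "emeasure lborel A \<le> emeasure lborel (\<Union>i. closure (E i))"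
      using A by (intro emeasure_mono) auto
    also have "\<dots> \<le> (\<Sum>i. emeasure lborel (closure (E i)))"
      by (rule emeasure_subadditive_countably) auto
    also have "\<dots> \<le> (\<Sum>i. cover_weight (DIM('a)) (E i))"
    proof (rule suminf_le)
      fix i
      show "emeasure lborel (closure (E i)) \<le> cover_weight (DIM('a)) (E i)"
      proof (cases "E i = {}")
        case False
        have "dist x y \<le> diameter (E i)" if "x \<in> closure (E i)" "y \<in> closure (E i)" for x y
          using diameter_bounded_bound[OF _ that] E(2)[of i] by (simp add: diameter_closure bounded_closure)
        then show ?thesis
          using False E(2) isodiametric_inequality[of "closure (E i)" "diameter (E i)"]
          by (simp add: cover_weight_def diameter_ge_0)
      qed simp
    qed auto
    finally show "emeasure lborel A \<le> (\<Sum>i. cover_weight (DIM('a)) (E i))" .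
  qed
  also have "\<dots> \<le> hausdorff (DIM('a)) A" by (rule hausdorff_content_le_hausdorff) simp
  finally show ?thesis .
qed

lemma cover_weight_cball:
  "0 < r \<Longrightarrow> cover_weight (DIM('a)) (cball (a :: 'a::euclidean_space) r) = emeasure lborel (cball a r)"
  by (simp add: cover_weight_def emeasure_cball)

lemma disjoint_cballs_le:
  fixes U :: "'a::euclidean_space set" and C :: "('a \<times> real) set"
  assumes "countable C" "pairwise (\<lambda>i j. disjnt (cball (fst i) (snd i)) (cball (fst j) (snd j))) C"
    and "\<And>i. i \<in> C \<Longrightarrow> cball (fst i) (snd i) \<subseteq> U" "open U"
  shows "(\<integral>\<^sup>+i. emeasure lborel (cball (fst i) (snd i)) \<partial>count_space C) \<le> emeasure lborel U"
proof -
  have "disjoint_family_on (\<lambda>i. cball (fst i) (snd i)) C"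
    using assms(2) by (auto simp: disjoint_family_on_def pairwise_def disjnt_def)
  then have "(\<integral>\<^sup>+i. emeasure lborel (cball (fst i) (snd i)) \<partial>count_space C) = emeasure lborel (\<Union>i\<in>C. cball (fst i) (snd i))"
    using assms(1) by (intro emeasure_UN_countable[symmetric]) auto
  also have "\<dots> \<le> emeasure lborel U" using assms(3,4) by (intro emeasure_mono) auto
  finally show ?thesis .
qed

text \<open>Vitali's covering lemma with fivefold enlargement; the radius bound
  \<open>\<delta> / 10\<close> keeps the diameters of the enlarged balls below \<delta>. The
  constant is harmless, since the estimate serves to show that negligible sets have Hausdorff
  measure 0.\<close>

lemma hausdorff_content_open_le_5:
  fixes U :: "'a::euclidean_space set"
  assumes "open U" "0 < \<delta>"
  shows "hausdorff_content (DIM('a)) \<delta> U \<le> 5 ^ DIM('a) * emeasure lborel U"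
proof -
  define K where "K = {(x, r). 0 < r \<and> r \<le> \<delta> / 10 \<and> cball x r \<subseteq> U}"
  have 1: "U \<subseteq> (\<Union>i\<in>K. cball (fst i) (snd i))"
  proof
    fix x assume "x \<in> U"
    then obtain r where "0 < r" "cball x r \<subseteq> U" using assms open_contains_cball by blast
    then have "(x, min r (\<delta> / 10)) \<in> K" using assms by (auto simp: K_def)
    then show "x \<in> (\<Union>i\<in>K. cball (fst i) (snd i))" using \<open>0 < r\<close> assms by (intro UN_I) auto
  qed
  have 2: "0 < snd i \<and> snd i \<le> \<delta> / 10" if "i \<in> K" for i using that by (auto simp: K_def)
  obtain C where C: "countable C" "C \<subseteq> K"
     "pairwise (\<lambda>i j. disjnt (cball (fst i) (snd i)) (cball (fst j) (snd j))) C"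
     "U \<subseteq> (\<Union>i\<in>C. cball (fst i) (5 * snd i))"
    by (rule Vitali_covering_lemma_cballs[where S=U and K=K and a=fst and r=snd and B="\<delta> / 10", OF 1 2])
  have r: "0 < snd i" "snd i \<le> \<delta> / 10" "cball (fst i) (snd i) \<subseteq> U" if "i \<in> C" for i
    using subsetD[OF C(2) that] by (cases i; simp add: K_def)+
  have five: "ennreal (5 ^ DIM('a)) = 5 ^ DIM('a)"
    using ennreal_power[of 5 "DIM('a)"] by simp
  have "hausdorff_content (DIM('a)) \<delta> U \<le> (\<integral>\<^sup>+i. cover_weight (DIM('a)) (cball (fst i) (5 * snd i)) \<partial>count_space C)"
  proof (intro hausdorff_content_countable_cover C)
    fix i assume "i \<in> C"
    then show "diameter (cball (fst i) (5 * snd i)) \<le> \<delta>" using r[of i] by simp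
  qed (use assms in auto)
  also have "\<dots> = (\<integral>\<^sup>+i. 5 ^ DIM('a) * emeasure lborel (cball (fst i) (snd i)) \<partial>count_space C)"
  proof (rule nn_integral_cong)
    fix i assume "i \<in> space (count_space C)"
    then have r: "0 < snd i" using r by simp
    show "cover_weight (DIM('a)) (cball (fst i) (5 * snd i)) = 5 ^ DIM('a) * emeasure lborel (cball (fst i) (snd i))"
    proof -
      have "emeasure lborel (cball (fst i) (5 * snd i)) = ennreal (5 ^ DIM('a) * (unit_ball_vol (DIM('a)) * snd i ^ DIM('a)))"
        using r by (simp add: emeasure_cball power_mult_distrib algebra_simps)
      also have "\<dots> = ennreal (5 ^ DIM('a)) * emeasure lborel (cball (fst i) (snd i))"
        using r by (subst ennreal_mult) (simp_all add: emeasure_cball)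
      finally show ?thesis using r by (simp add: cover_weight_cball five)
    qed
  qed
  also have "\<dots> = 5 ^ DIM('a) * (\<integral>\<^sup>+i. emeasure lborel (cball (fst i) (snd i)) \<partial>count_space C)"
    by (rule nn_integral_cmult) simp
  also have "\<dots> \<le> 5 ^ DIM('a) * emeasure lborel U"
    using C r assms by (intro mult_left_mono disjoint_cballs_le) auto
  finally show ?thesis .
qed

lemma hausdorff_negligible:
  fixes N :: "'a::euclidean_space set"
  assumes N: "negligible N"
  shows "hausdorff (DIM('a)) N = 0"
proof -
  have "hausdorff (DIM('a)) N \<le> 0 + ennreal e" if e: "0 < e" for e
  proof (rule hausdorff_leI)
    fix \<delta> :: real assume \<delta>: "0 < \<delta>"
    have N': "N \<in> null_sets lebesgue" using N by (simp add: negligible_iff_null_sets)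
    obtain U where U: "open U" "N \<subseteq> U" "emeasure lebesgue (U - N) < ennreal (e / 5 ^ DIM('a))"
    proof (rule sets_lebesgue_outer_open)
      show "N \<in> sets lebesgue" using N' by (rule null_setsD2)
      show "0 < e / 5 ^ DIM('a)" using e by simp
    qed
    have "emeasure lborel U = emeasure lebesgue (U - N)"
      using emeasure_Diff_null_set[OF N', of U] U(1) by simp
    then have "5 ^ DIM('a) * emeasure lborel U \<le> 5 ^ DIM('a) * ennreal (e / 5 ^ DIM('a))"
      using U(3) by (intro mult_left_mono) auto
    also have "5 ^ DIM('a) * ennreal (e / 5 ^ DIM('a)) = ennreal (5 ^ DIM('a)) * ennreal (e / 5 ^ DIM('a))"
      using ennreal_power[of 5 "DIM('a)"] by simp
    also have "\<dots> = ennreal e"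
      using e by (subst ennreal_mult[symmetric]) auto
    finally have "hausdorff_content (DIM('a)) \<delta> U \<le> ennreal e"
      by (rule order_trans[OF hausdorff_content_open_le_5[OF U(1) \<delta>]])
    then show "hausdorff_content (DIM('a)) \<delta> N \<le> 0 + ennreal e"
      using order_trans[OF hausdorff_content_mono[OF U(2)], of "DIM('a)" \<delta>] by simp
  qed
  then have "hausdorff (DIM('a)) N \<le> 0" by (rule ennreal_le_epsilon)
  then show ?thesis by simp
qed

text \<open>Disjoint small balls fill \<open>U\<close> up to a negligible set. The weight of a ball
  is exactly its volume, so no constant is lost, and the remainder contributes nothing.\<close>

lemma hausdorff_open_le:
  fixes U :: "'a::euclidean_space set"
  assumes U: "open U"
  shows "hausdorff (DIM('a)) U \<le> emeasure lborel U"
proof (rule hausdorff_leI)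
  fix \<delta> :: real assume \<delta>: "0 < \<delta>"
  define K where "K = {(x, r). 0 < r \<and> r \<le> \<delta> / 2 \<and> cball x r \<subseteq> U}"
  have 1: "\<exists>i. i \<in> K \<and> x \<in> cball (fst i) (snd i) \<and> snd i < d" if x: "x \<in> U" and "0 < d" for x d
  proof -
    obtain r where "0 < r" "cball x r \<subseteq> U" using x U open_contains_cball by blast
    define s where "s = min r (min (\<delta> / 2) (d / 2))"
    have s: "0 < s" "s \<le> r" "s \<le> \<delta> / 2" "s < d" using \<open>0 < r\<close> \<delta> that by (auto simp: s_def)
    then have "cball x s \<subseteq> U" using \<open>cball x r \<subseteq> U\<close> by (meson order_trans subset_cball)
    then show ?thesis using s by (intro exI[of _ "(x, s)"]) (simp add: K_def)
  qed
  have 2: "0 < snd i" if "i \<in> K" for i using that by (auto simp: K_def)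
  obtain C where C: "countable C" "C \<subseteq> K"
     "pairwise (\<lambda>i j. disjnt (cball (fst i) (snd i)) (cball (fst j) (snd j))) C"
     "negligible (U - (\<Union>i\<in>C. cball (fst i) (snd i)))"
    by (rule Vitali_covering_theorem_cballs[where K=K and a=fst and r=snd and S=U, OF 2 1])
  have r: "0 < snd i" "snd i \<le> \<delta> / 2" "cball (fst i) (snd i) \<subseteq> U" if "i \<in> C" for i
    using subsetD[OF C(2) that] by (cases i; simp add: K_def)+
  let ?V = "\<Union>i\<in>C. cball (fst i) (snd i)"
  have "hausdorff_content (DIM('a)) \<delta> U \<le> hausdorff_content (DIM('a)) \<delta> (?V \<union> (U - ?V))"
    by (rule hausdorff_content_mono) auto
  also have "\<dots> \<le> hausdorff_content (DIM('a)) \<delta> ?V + hausdorff_content (DIM('a)) \<delta> (U - ?V)"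
    using \<delta> by (intro hausdorff_content_Un) auto
  also have "\<dots> = hausdorff_content (DIM('a)) \<delta> ?V"
    using hausdorff_content_le_hausdorff[OF \<delta>, of "DIM('a)" "U - ?V"]
    unfolding hausdorff_negligible[OF C(4)] by (simp only: le_zero_eq add_0_right)
  also have "\<dots> \<le> (\<integral>\<^sup>+i. cover_weight (DIM('a)) (cball (fst i) (snd i)) \<partial>count_space C)"
  proof (intro hausdorff_content_countable_cover C)
    fix i assume "i \<in> C"
    then show "diameter (cball (fst i) (snd i)) \<le> \<delta>" using r[of i] by simp
  qed (use \<delta> in auto)
  also have "\<dots> = (\<integral>\<^sup>+i. emeasure lborel (cball (fst i) (snd i)) \<partial>count_space C)"
    using r by (intro nn_integral_cong cover_weight_cball) auto
  also have "\<dots> \<le> emeasure lborel U" by (rule disjoint_cballs_le[OF C(1,3) r(3) U])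
  finally show "hausdorff_content (DIM('a)) \<delta> U \<le> emeasure lborel U" .
qed

theorem hausdorff_eq_lborel:
  fixes A :: "'a::euclidean_space set"
  assumes A: "A \<in> sets borel"
  shows "hausdorff (DIM('a)) A = emeasure lborel A"
proof (rule antisym[OF ennreal_le_epsilon lborel_le_hausdorff[OF A]])
  fix e :: real assume "0 < e"
  then obtain U where U: "open U" "A \<subseteq> U" "emeasure lborel (U - A) \<le> e"
    using outer_regular_lborel_le[OF A] by blast
  have "hausdorff (DIM('a)) A \<le> emeasure lborel U"
    by (rule order_trans[OF hausdorff_mono[OF U(2)] hausdorff_open_le[OF U(1)]])
  also have "emeasure lborel U = emeasure lborel A + emeasure lborel (U - A)"
    using A U by (subst plus_emeasure) (auto intro!: arg_cong[where f="emeasure lborel"])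
  also have "\<dots> \<le> emeasure lborel A + ennreal e" using U by (intro add_left_mono)
  finally show "hausdorff (DIM('a)) A \<le> emeasure lborel A + ennreal e" .
qed

section \<open>Integration over hyperplanes\<close>

text \<open>
  An index type with one element fewer than \<open>'n\<close>: the hyperplanes of \<open>real^'n\<close> are isometric to
  \<open>real^'n codim1\<close>.  Types are nonempty, hence the exceptional case \<open>CARD('n) = 1\<close>.
\<close>

typedef (overloaded) ('n::finite) codim1 =
  "{i :: 'n. CARD('n) = 1 \<or> i \<noteq> undefined}"
proof (cases "CARD('n) = 1")
  case False
  have "\<not> (UNIV :: 'n set) \<subseteq> {undefined}"
  proof
    assume "(UNIV :: 'n set) \<subseteq> {undefined}"
    then have "(UNIV :: 'n set) = {undefined}" by auto
    then have "CARD('n) = card {undefined :: 'n}" by simp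
    then show False using False by simp
  qed
  then show ?thesis by auto
qed auto

lemma card_codim1:
  assumes "CARD('n::finite) \<ge> 2"
  shows "CARD('n codim1) = CARD('n) - 1"
proof -
  have "CARD('n codim1) = card {i :: 'n. CARD('n) = 1 \<or> i \<noteq> undefined}"
    by (rule type_definition.card[OF type_definition_codim1])
  also have "{i :: 'n. CARD('n) = 1 \<or> i \<noteq> undefined} = UNIV - {undefined}" using assms by auto
  finally show ?thesis by simp
qed

instance codim1 :: (finite) finite
proof
  have "(UNIV :: 'a codim1 set) = Abs_codim1 ` {i. CARD('a) = 1 \<or> i \<noteq> undefined}"
    using type_definition.Abs_image[OF type_definition_codim1] by blast
  then show "finite (UNIV :: 'a codim1 set)" by (rule ssubst) (rule finite_imageI, rule finite)
qed

lemma mem_orthogonal_comp_singleton: "x \<in> {v}\<^sup>\<bottom> \<longleftrightarrow> x \<bullet> v = 0"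
  by (auto simp: orthogonal_comp_def orthogonal_def inner_commute)

text \<open>The chart is a linear isometry of the (n-1)-dimensional space onto the hyperplane. It is
  used with \<open>v = u\<close> to integrate over the y_i, and with \<open>v\<close> a unit
  dependency of \<open>y\<close> to slice the fibre and to measure the parallelotope of the
  rows.\<close>

locale hyperplane_chart =
  fixes v :: "real^'n" and L :: "real^'n codim1 \<Rightarrow> real^'n"
  assumes n: "CARD('n) \<ge> 2" and v: "norm v = 1"
    and linear_chart: "linear L" and range_chart: "range L = {v}\<^sup>\<bottom>" and norm_chart [simp]: "norm (L w) = norm w"

begin

lemma dist_chart [simp]: "dist (L x) (L y) = dist x y"
  by (simp add: dist_norm flip: linear_diff[OF linear_chart])

lemma chart_orth [simp]: "L w \<bullet> v = 0"
proof -
  have "L w \<in> {v}\<^sup>\<bottom>" using range_chart by (metis rangeI)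
  then show ?thesis by (simp add: mem_orthogonal_comp_singleton)
qed

lemma continuous_chart [continuous_intros]: "continuous_on A f \<Longrightarrow> continuous_on A (\<lambda>x. L (f x))"
  using bounded_linear.continuous_on[of L] linear_chart by (simp add: linear_conv_bounded_linear)

lemma measurable_chart [measurable]: "L \<in> borel_measurable borel"
  by (intro borel_measurable_continuous_onI continuous_chart continuous_on_id)

lemma hausdorff_chart_image: "A \<in> sets borel \<Longrightarrow> hausdorff (CARD('n) - 1) (L ` A) = emeasure lborel A"
  using hausdorff_eq_lborel[of A] card_codim1[OF n] by (simp add: hausdorff_isometric_image)

lemma hausdorff_Int_hyperplane:
  assumes A: "A \<in> sets borel"
  shows "hausdorff (CARD('n) - 1) (A \<inter> {v}\<^sup>\<bottom>) = emeasure lborel (L -` A)"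
proof -
  have "A \<inter> {v}\<^sup>\<bottom> = L ` (L -` A)" using range_chart by (auto simp: image_vimage_eq)
  moreover have "L -` A \<in> sets borel" using measurable_sets[OF measurable_chart A] by simp
  ultimately show ?thesis using hausdorff_chart_image[of "L -` A"] by (simp only:)
qed

text \<open>The map is an isometry of the Euclidean product space onto \<open>real^'n\<close>.
  Hausdorff measure is invariant under isometries and agrees with Lebesgue measure on both sides, so
  no Jacobian has to be computed.\<close>

lemma lborel_eq_distr_chart:
  "lborel = distr (lborel \<Otimes>\<^sub>M lborel) borel (\<lambda>(w, t). L w + t *\<^sub>R v)" (is "_ = distr _ _ ?\<Phi>")
proof (rule measure_eqI)
  have \<Phi> [measurable]: "?\<Phi> \<in> borel_measurable (lborel \<Otimes>\<^sub>M lborel)" by measurable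
  fix A :: "(real^'n) set" assume "A \<in> sets lborel"
  then have A [measurable]: "A \<in> sets borel" by simp
  have iso: "dist (?\<Phi> x) (?\<Phi> y) = dist x y" for x y
  proof -
    have "?\<Phi> x - ?\<Phi> y = L (fst x - fst y) + (snd x - snd y) *\<^sub>R v"
      by (simp add: case_prod_beta linear_diff[OF linear_chart] algebra_simps)
    moreover have "(norm (L a + b *\<^sub>R v))\<^sup>2 = (norm a)\<^sup>2 + b\<^sup>2" for a b
    proof -
      have "orthogonal (L a) (b *\<^sub>R v)" by (simp add: orthogonal_def)
      then show ?thesis using v by (simp add: norm_add_Pythagorean)
    qed
    ultimately have "(dist (?\<Phi> x) (?\<Phi> y))\<^sup>2 = (norm (fst x - fst y))\<^sup>2 + (snd x - snd y)\<^sup>2"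
      by (simp only: dist_norm)
    also have "\<dots> = (dist x y)\<^sup>2" by (simp add: dist_prod_def dist_norm)
    finally show ?thesis by (simp add: power2_eq_iff_nonneg)
  qed
  have "x \<in> range ?\<Phi>" for x
  proof -
    have "x - (x \<bullet> v) *\<^sub>R v \<in> {v}\<^sup>\<bottom>"
      using v by (simp add: mem_orthogonal_comp_singleton inner_diff_left norm_eq_1)
    then obtain w where "L w = x - (x \<bullet> v) *\<^sub>R v" using range_chart by (metis rangeE)
    then have "x = ?\<Phi> (w, x \<bullet> v)" by simp
    then show ?thesis by blast
  qed
  then have AA: "A = ?\<Phi> ` (?\<Phi> -` A)" by (auto simp: image_vimage_eq)
  have m: "?\<Phi> -` A \<in> sets (borel :: ((real^'n codim1) \<times> real) measure)"
    using measurable_sets[OF \<Phi> A] unfolding borel_prod[symmetric] by (simp add: space_pair_measure)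
  have "emeasure lborel A = hausdorff (CARD('n)) (?\<Phi> ` (?\<Phi> -` A))"
    using hausdorff_eq_lborel[OF A] AA by simp
  also have "\<dots> = hausdorff (DIM((real^'n codim1) \<times> real)) (?\<Phi> -` A)"
    using card_codim1[OF n] n iso by (subst hausdorff_isometric_image) auto
  also have "\<dots> = emeasure (lborel \<Otimes>\<^sub>M lborel) (?\<Phi> -` A)"
    using hausdorff_eq_lborel[OF m] by (simp add: lborel_prod)
  also have "\<dots> = emeasure (distr (lborel \<Otimes>\<^sub>M lborel) borel ?\<Phi>) A"
    by (subst emeasure_distr) (auto simp: space_pair_measure)
  finally show "emeasure lborel A = emeasure (distr (lborel \<Otimes>\<^sub>M lborel) borel ?\<Phi>) A" .
qed simp

lemma nn_integral_lborel_chart: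
  fixes f :: "real^'n \<Rightarrow> ennreal"
  assumes [measurable]: "f \<in> borel_measurable borel"
  shows "(\<integral>\<^sup>+x. f x \<partial>lborel) = (\<integral>\<^sup>+w. \<integral>\<^sup>+t. f (L w + t *\<^sub>R v) \<partial>lborel \<partial>lborel)"
    and "(\<integral>\<^sup>+x. f x \<partial>lborel) = (\<integral>\<^sup>+t. \<integral>\<^sup>+w. f (L w + t *\<^sub>R v) \<partial>lborel \<partial>lborel)"
proof -
  have 1: "(\<integral>\<^sup>+x. f x \<partial>lborel) = (\<integral>\<^sup>+p. f (L (fst p) + snd p *\<^sub>R v) \<partial>(lborel \<Otimes>\<^sub>M lborel))"
    by (subst lborel_eq_distr_chart) (simp add: nn_integral_distr case_prod_beta)
  show "(\<integral>\<^sup>+x. f x \<partial>lborel) = (\<integral>\<^sup>+w. \<integral>\<^sup>+t. f (L w + t *\<^sub>R v) \<partial>lborel \<partial>lborel)"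
    unfolding 1 by (subst lborel.nn_integral_fst[symmetric]) auto
  show "(\<integral>\<^sup>+x. f x \<partial>lborel) = (\<integral>\<^sup>+t. \<integral>\<^sup>+w. f (L w + t *\<^sub>R v) \<partial>lborel \<partial>lborel)"
    unfolding 1 by (subst lborel_pair.nn_integral_snd[symmetric]) auto
qed

lemma sets_perp_measure [measurable_cong]: "sets (perp_measure v) = sets (restrict_space borel ({v}\<^sup>\<bottom>))"
  unfolding perp_measure_def by (rule sets_restrict_space_cong) simp

lemma space_perp_measure: "space (perp_measure v) = {v}\<^sup>\<bottom>"
  by (simp add: perp_measure_def space_restrict_space)

lemma closed_hyperplane_perp: "closed ({v}\<^sup>\<bottom>)"
  by (simp add: closed_subspace subspace_orthogonal_comp)

lemma measurable_perp: "f \<in> measurable borel N \<Longrightarrow> f \<in> measurable (perp_measure v) N"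
  by (subst measurable_cong_sets[OF sets_perp_measure refl]) (rule measurable_restrict_space1)

lemma measurable_chart_perp [measurable]: "L \<in> measurable borel (perp_measure v)"
proof -
  have "L \<in> measurable borel (restrict_space borel ({v}\<^sup>\<bottom>))"
    by (rule measurable_restrict_space2) (use range_chart in auto)
  then show ?thesis by (subst measurable_cong_sets[OF refl sets_perp_measure])
qed

text \<open>Through this identity sigma-finiteness, translation invariance and Fubini arguments for
  \<open>perp_measure\<close> are inherited from Lebesgue measure.\<close>

lemma perp_measure_eq_distr: "perp_measure v = distr lborel (perp_measure v) L"
proof (rule measure_eqI)
  fix A assume A: "A \<in> sets (perp_measure v)"
  then have A': "A \<in> sets borel" "A \<subseteq> {v}\<^sup>\<bottom>"
    using closed_hyperplane_perp by (auto simp: sets_perp_measure sets_restrict_space_iff)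
  have "emeasure (perp_measure v) A = hausdorff (CARD('n) - 1) A"
    unfolding perp_measure_def using A' closed_hyperplane_perp
    by (subst emeasure_restrict_space) (auto simp: emeasure_hausdorff_measure)
  also have "\<dots> = emeasure lborel (L -` A)"
    using hausdorff_Int_hyperplane[OF A'(1)] A'(2) by (simp add: Int_absorb2)
  finally show "emeasure (perp_measure v) A = emeasure (distr lborel (perp_measure v) L) A"
    using A by (simp add: emeasure_distr)
qed simp

lemma nn_integral_perp:
  "f \<in> borel_measurable (perp_measure v) \<Longrightarrow> (\<integral>\<^sup>+y. f y \<partial>perp_measure v) = (\<integral>\<^sup>+w. f (L w) \<partial>lborel)"
  by (subst perp_measure_eq_distr) (simp add: nn_integral_distr)

lemma emeasure_perp:
  "A \<in> sets (perp_measure v) \<Longrightarrow> emeasure (perp_measure v) A = emeasure lborel (L -` A)"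
  by (subst perp_measure_eq_distr) (simp add: emeasure_distr)

lemma vimage_chart_bounded:
  assumes "bounded A" shows "bounded (L -` A)"
proof -
  obtain a where a: "\<And>x. x \<in> A \<Longrightarrow> norm x \<le> a" using assms unfolding bounded_iff by auto
  show ?thesis unfolding bounded_iff using a by (intro exI[of _ a]) (metis norm_chart vimageE)
qed

lemma sigma_finite_perp: "sigma_finite_measure (perp_measure v)"
proof
  let ?C = "\<lambda>i::nat. {v}\<^sup>\<bottom> \<inter> cball 0 (real i)"
  have m: "?C i \<in> sets (perp_measure v)" for i
    using closed_hyperplane_perp by (auto simp: sets_perp_measure sets_restrict_space_iff)
  have "emeasure (perp_measure v) (?C i) \<noteq> \<infinity>" for i
  proof -
    have "bounded (L -` ?C i)" by (rule vimage_chart_bounded) (auto intro: bounded_subset)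
    then have "emeasure lborel (L -` ?C i) < \<infinity>" by (rule emeasure_bounded_finite)
    then show ?thesis using emeasure_perp[OF m] by simp
  qed
  moreover have "(\<Union>i. ?C i) = {v}\<^sup>\<bottom>"
    using real_arch_simple by (auto simp: dist_norm)
  ultimately show "\<exists>A. countable A \<and> A \<subseteq> sets (perp_measure v) \<and> \<Union> A = space (perp_measure v) \<and>
      (\<forall>a\<in>A. emeasure (perp_measure v) a \<noteq> \<infinity>)"
    by (intro exI[of _ "range ?C"]) (use m space_perp_measure in auto)
qed

lemma nn_integral_perp_translate:
  assumes b: "b \<in> {v}\<^sup>\<bottom>" and f: "f \<in> borel_measurable borel"
  shows "(\<integral>\<^sup>+y. f (y + b) \<partial>perp_measure v) = (\<integral>\<^sup>+y. f y \<partial>perp_measure v)"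
proof -
  obtain c where c: "b = L c" using b range_chart by blast
  note [measurable] = f
  have "(\<integral>\<^sup>+w. f (L w) \<partial>lborel) = (\<integral>\<^sup>+w. f (L w) \<partial>distr lborel borel ((+) c))"
    by (simp add: lborel_distr_plus)
  also have "\<dots> = (\<integral>\<^sup>+w. f (L (c + w)) \<partial>lborel)" by (subst nn_integral_distr) auto
  finally show ?thesis
    by (simp add: nn_integral_perp measurable_perp c linear_add[OF linear_chart] add.commute)
qed

end

sublocale hyperplane_chart \<subseteq> perp: sigma_finite_measure "perp_measure v"
  by (rule sigma_finite_perp)

sublocale hyperplane_chart \<subseteq> perps: product_sigma_finite "\<lambda>_. perp_measure v"
  by standard

lemma hyperplane_chart_exists:
  fixes v :: "real^'n"
  assumes n: "CARD('n) \<ge> 2" and v: "norm v = 1"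
  shows "\<exists>L. hyperplane_chart v L"
proof -
  have "dim {y \<in> UNIV. \<forall>x \<in> span {v}. orthogonal x y} + dim (span {v}) = dim (UNIV :: (real^'n) set)"
    by (rule dim_subspace_orthogonal_to_vectors) auto
  moreover have "{y \<in> UNIV. \<forall>x \<in> span {v}. orthogonal x y} = {v}\<^sup>\<bottom>"
    by (auto simp: span_singleton orthogonal_def mem_orthogonal_comp_singleton inner_commute)
  moreover have "dim (span {v}) = 1"
  proof -
    have "v \<noteq> 0" using v by auto
    then show ?thesis by (simp add: dim_singleton)
  qed
  ultimately have "dim ({v}\<^sup>\<bottom>) = CARD('n) - 1" by simp
  then have "dim (UNIV :: (real^'n codim1) set) = dim ({v}\<^sup>\<bottom>)" using card_codim1[OF n] by simp
  then obtain L :: "real^'n codim1 \<Rightarrow> real^'n" where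
    "linear L" "L ` UNIV = {v}\<^sup>\<bottom>" "\<And>x. x \<in> UNIV \<Longrightarrow> norm (L x) = norm x"
    using isometry_subspaces[OF subspace_UNIV subspace_orthogonal_comp] by blast
  then show ?thesis using assms by (intro exI[of _ L]) (simp add: hyperplane_chart_def)
qed

section \<open>Splitting tuples of vectors into hyperplane components and a vector of
  heights\<close>

lemma nn_integral_lborel_vec_prod:
  fixes f :: "'n::finite \<Rightarrow> real \<Rightarrow> ennreal"
  assumes [measurable]: "\<And>i. f i \<in> borel_measurable borel"
  shows "(\<integral>\<^sup>+s. (\<Prod>i\<in>UNIV. f i (s $ i)) \<partial>(lborel :: (real^'n) measure)) = (\<Prod>i\<in>UNIV. \<integral>\<^sup>+t. f i t \<partial>lborel)"
proof -
  let ?b = "\<lambda>i::'n. axis i (1::real)"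
  have inj: "inj ?b" by (auto intro!: injI simp: axis_eq_axis)
  have B: "(Basis :: (real^'n) set) = range ?b" by (auto simp: Basis_vec_def)
  define g where "g b = f (inv ?b b)" for b
  have gi: "g (?b i) = f i" for i using inv_f_f[OF inj, of i] by (simp only: g_def)
  have "(\<integral>\<^sup>+s. (\<Prod>b\<in>Basis. g b (s \<bullet> b)) \<partial>(lborel :: (real^'n) measure)) = (\<Prod>b\<in>Basis. \<integral>\<^sup>+t. g b t \<partial>lborel)"
    by (rule nn_integral_lborel_prod) (auto simp: g_def)
  then show ?thesis unfolding B by (simp add: prod.reindex[OF inj] gi inner_axis)
qed

context hyperplane_chart
begin

lemma measurable_PiM_perp_component [measurable]:
  "(\<lambda>y. y i) \<in> borel_measurable (\<Pi>\<^sub>M i\<in>UNIV. perp_measure v)"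
proof (rule measurable_compose)
  show "(\<lambda>y. y i) \<in> measurable (\<Pi>\<^sub>M i\<in>UNIV. perp_measure v) (perp_measure v)"
    using measurable_component_singleton[of i UNIV "\<lambda>_. perp_measure v"] by simp
  show "(\<lambda>x. x) \<in> borel_measurable (perp_measure v)" by (rule measurable_perp) simp
qed

lemma measurable_shift [measurable]:
  "(\<lambda>(y, s) i. y i + s $ i *\<^sub>R v) \<in>
    measurable ((\<Pi>\<^sub>M i\<in>(UNIV :: 'n set). perp_measure v) \<Otimes>\<^sub>M (lborel :: (real^'n) measure)) (\<Pi>\<^sub>M i\<in>UNIV. lborel)"
proof (rule measurable_PiM_single')
  fix i :: 'n
  have nth [measurable]: "(\<lambda>s :: real^'n. s $ i) \<in> borel_measurable borel"
    by (intro borel_measurable_continuous_onI continuous_intros)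
  have [measurable]: "(\<lambda>p. fst p i) \<in> borel_measurable ((\<Pi>\<^sub>M i\<in>(UNIV :: 'n set). perp_measure v) \<Otimes>\<^sub>M (lborel :: (real^'n) measure))"
    by (rule measurable_compose[OF measurable_fst measurable_PiM_perp_component])
  have "(\<lambda>p. fst p i + snd p $ i *\<^sub>R v) \<in> borel_measurable ((\<Pi>\<^sub>M i\<in>(UNIV :: 'n set). perp_measure v) \<Otimes>\<^sub>M (lborel :: (real^'n) measure))"
    by measurable
  then show "(\<lambda>p. (case p of (y, s) \<Rightarrow> \<lambda>i. y i + s $ i *\<^sub>R v) i) \<in> measurable ((\<Pi>\<^sub>M i\<in>(UNIV :: 'n set). perp_measure v) \<Otimes>\<^sub>M (lborel :: (real^'n) measure)) lborel"
    by (simp add: case_prod_beta)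
qed simp

text \<open>By uniqueness of product measures it suffices to test boxes. On a box the integral over
  the height vector \<open>s\<close> factors into one line integral for each index, and each of them
  combines with the integration over y_i to the volume of \<open>A i\<close>.\<close>

lemma PiM_lborel_eq_distr:
  "(\<Pi>\<^sub>M i\<in>(UNIV :: 'n set). lborel) =
    distr ((\<Pi>\<^sub>M i\<in>(UNIV :: 'n set). perp_measure v) \<Otimes>\<^sub>M (lborel :: (real^'n) measure)) (\<Pi>\<^sub>M i\<in>UNIV. lborel)
      (\<lambda>(y, s) i. y i + s $ i *\<^sub>R v)" (is "_ = distr (?M \<Otimes>\<^sub>M _) _ ?\<Phi>")
proof -
  interpret L: product_sigma_finite "\<lambda>_::'n. lborel :: (real^'n) measure" by standard
  interpret M: sigma_finite_measure ?M by (rule perps.sigma_finite) simp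
  have "distr (?M \<Otimes>\<^sub>M lborel) (\<Pi>\<^sub>M i\<in>UNIV. lborel) ?\<Phi> = (\<Pi>\<^sub>M i\<in>UNIV. lborel)"
  proof (rule L.PiM_eqI)
    fix A :: "'n \<Rightarrow> (real^'n) set"
    assume "\<And>i. i \<in> UNIV \<Longrightarrow> A i \<in> sets lborel"
    then have A [measurable]: "A i \<in> sets borel" for i by simp
    define h where "h i y = (\<integral>\<^sup>+t. indicator (A i) (y + t *\<^sub>R v) \<partial>lborel)" for i y
    have h [measurable]: "h i \<in> borel_measurable borel" for i unfolding h_def by measurable
    have P: "Pi\<^sub>E UNIV A \<in> sets (\<Pi>\<^sub>M i\<in>UNIV. lborel)" by (rule sets_PiM_I_finite) auto
    have "emeasure (distr (?M \<Otimes>\<^sub>M lborel) (\<Pi>\<^sub>M i\<in>UNIV. lborel) ?\<Phi>) (Pi\<^sub>E UNIV A) =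
      (\<integral>\<^sup>+p. indicator (Pi\<^sub>E UNIV A) (?\<Phi> p) \<partial>(?M \<Otimes>\<^sub>M lborel))"
      using P by (subst nn_integral_indicator[symmetric], simp) (subst nn_integral_distr, auto)
    also have "\<dots> = (\<integral>\<^sup>+y. \<integral>\<^sup>+s. indicator (Pi\<^sub>E UNIV A) (?\<Phi> (y, s)) \<partial>lborel \<partial>?M)"
      using P by (subst lborel.nn_integral_fst[symmetric]) auto
    also have "\<dots> = (\<integral>\<^sup>+y. \<integral>\<^sup>+s. (\<Prod>i\<in>UNIV. indicator (A i) (y i + s $ i *\<^sub>R v)) \<partial>lborel \<partial>?M)"
      by (intro nn_integral_cong) (auto simp: indicator_def prod_zero_iff PiE_iff)
    also have "\<dots> = (\<integral>\<^sup>+y. (\<Prod>i\<in>UNIV. h i (y i)) \<partial>?M)"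
    proof (rule nn_integral_cong)
      fix y :: "'n \<Rightarrow> real^'n"
      show "(\<integral>\<^sup>+s. (\<Prod>i\<in>UNIV. indicator (A i) (y i + s $ i *\<^sub>R v)) \<partial>lborel) = (\<Prod>i\<in>UNIV. h i (y i))"
        using nn_integral_lborel_vec_prod[of "\<lambda>i t. indicator (A i) (y i + t *\<^sub>R v)"] unfolding h_def by simp
    qed
    also have "\<dots> = (\<Prod>i\<in>UNIV. \<integral>\<^sup>+y. h i y \<partial>perp_measure v)"
      by (rule perps.product_nn_integral_prod) (auto intro!: measurable_perp)
    also have "\<dots> = (\<Prod>i\<in>UNIV. emeasure lborel (A i))"
    proof (rule prod.cong)
      fix i
      have "(\<integral>\<^sup>+y. h i y \<partial>perp_measure v) = (\<integral>\<^sup>+w. h i (L w) \<partial>lborel)"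
        by (rule nn_integral_perp[OF measurable_perp[OF h]])
      also have "\<dots> = (\<integral>\<^sup>+x. indicator (A i) x \<partial>lborel)"
        unfolding h_def by (rule nn_integral_lborel_chart(1)[symmetric]) simp
      finally show "(\<integral>\<^sup>+y. h i y \<partial>perp_measure v) = emeasure lborel (A i)" by simp
    qed simp
    finally show "emeasure (distr (?M \<Otimes>\<^sub>M lborel) (\<Pi>\<^sub>M i\<in>UNIV. lborel) ?\<Phi>) (Pi\<^sub>E UNIV A) = (\<Prod>i\<in>UNIV. emeasure lborel (A i))" .
  qed simp_all
  then show ?thesis by simp
qed

lemma nn_integral_PiM_lborel:
  assumes [measurable]: "f \<in> borel_measurable (\<Pi>\<^sub>M i\<in>(UNIV :: 'n set). lborel)"
  shows "(\<integral>\<^sup>+x. f x \<partial>(\<Pi>\<^sub>M i\<in>(UNIV :: 'n set). lborel)) =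
    (\<integral>\<^sup>+y. \<integral>\<^sup>+s. f (\<lambda>i. y i + s $ i *\<^sub>R v) \<partial>(lborel :: (real^'n) measure) \<partial>(\<Pi>\<^sub>M i\<in>(UNIV :: 'n set). perp_measure v))"
    (is "?L = (\<integral>\<^sup>+y. _ \<partial>?M)")
    and "(\<lambda>y. \<integral>\<^sup>+s. f (\<lambda>i. y i + s $ i *\<^sub>R v) \<partial>(lborel :: (real^'n) measure)) \<in>
      borel_measurable (\<Pi>\<^sub>M i\<in>(UNIV :: 'n set). perp_measure v)"
proof -
  have \<Phi> [measurable]: "(\<lambda>(y, s) i. y i + s $ i *\<^sub>R v) \<in> measurable (?M \<Otimes>\<^sub>M (lborel :: (real^'n) measure)) (\<Pi>\<^sub>M i\<in>UNIV. lborel)"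
    by (rule measurable_shift)
  have m: "(\<lambda>p. f (\<lambda>i. fst p i + snd p $ i *\<^sub>R v)) \<in> borel_measurable (?M \<Otimes>\<^sub>M (lborel :: (real^'n) measure))"
    using measurable_compose[OF \<Phi> assms] by (simp add: case_prod_beta)
  show "?L = (\<integral>\<^sup>+y. \<integral>\<^sup>+s. f (\<lambda>i. y i + s $ i *\<^sub>R v) \<partial>(lborel :: (real^'n) measure) \<partial>?M)"
    using lborel.nn_integral_fst[OF m]
    by (subst PiM_lborel_eq_distr) (simp add: nn_integral_distr case_prod_beta)
  show "(\<lambda>y. \<integral>\<^sup>+s. f (\<lambda>i. y i + s $ i *\<^sub>R v) \<partial>(lborel :: (real^'n) measure)) \<in> borel_measurable ?M"
    using lborel.borel_measurable_nn_integral_fst[OF m] by simp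
qed

lemma AE_PiM_perp_component:
  assumes "AE y in perp_measure v. P y"
  shows "AE y in (\<Pi>\<^sub>M i\<in>(UNIV :: 'n set). perp_measure v). \<forall>i. P (y i)"
proof -
  obtain N where "{y \<in> space (perp_measure v). \<not> P y} \<subseteq> N" "emeasure (perp_measure v) N = 0" "N \<in> sets (perp_measure v)"
    using AE_E[OF assms] .
  note N = this
  have "AE y in (\<Pi>\<^sub>M i\<in>(UNIV :: 'n set). perp_measure v). P (y i)" for i
  proof (rule AE_I)
    let ?A = "\<lambda>j. if j = i then N else space (perp_measure v)"
    show "{y \<in> space (\<Pi>\<^sub>M i\<in>UNIV. perp_measure v). \<not> P (y i)} \<subseteq> Pi\<^sub>E UNIV ?A"
      using N(1) by (auto simp: space_PiM PiE_iff)
    have m: "?A j \<in> sets (perp_measure v)" for j using N(3) by simp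
    \<comment> \<open>The other factors are measures of the whole hyperplane; one null factor still
      wins because 0 times \<infinity> is 0.\<close>
    have "(\<Prod>j\<in>UNIV. emeasure (perp_measure v) (?A j)) = 0"
      using N(2) by (intro prod_zero bexI[of _ i]) auto
    then show "emeasure (\<Pi>\<^sub>M i\<in>UNIV. perp_measure v) (Pi\<^sub>E UNIV ?A) = 0"
      using perps.emeasure_PiM[of UNIV ?A] m by simp
    show "Pi\<^sub>E UNIV ?A \<in> sets (\<Pi>\<^sub>M i\<in>UNIV. perp_measure v)"
      by (rule sets_PiM_I_finite) (use m in auto)
  qed
  then show ?thesis by (simp add: AE_all_countable)
qed

lemma AE_perp_nonzero: "AE y in perp_measure v. y \<noteq> 0"
proof (rule AE_I[where N = "{0}"])
  show m: "{0} \<in> sets (perp_measure v)"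
    using closed_hyperplane_perp by (simp add: sets_perp_measure sets_restrict_space_iff mem_orthogonal_comp_singleton)
  have "L w = 0 \<longleftrightarrow> w = 0" for w using norm_chart[of w] by (metis norm_eq_zero)
  then have "L -` {0} = {0}" by auto
  then show "emeasure (perp_measure v) {0} = 0" by (simp add: emeasure_perp[OF m])
qed blast

end

section \<open>Volumes of parallelotopes and determinants\<close>

lemma parallelotope_reindex:
  assumes "bij_betw e I J"
  shows "parallelotope I (\<lambda>i. h (e i)) = parallelotope J h"
proof
  show "parallelotope I (\<lambda>i. h (e i)) \<subseteq> parallelotope J h"
  proof
    fix x assume "x \<in> parallelotope I (\<lambda>i. h (e i))"
    then obtain t where t: "x = (\<Sum>i\<in>I. t i *\<^sub>R h (e i))" "\<forall>i\<in>I. 0 \<le> t i \<and> t i \<le> 1"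
      by (auto simp: parallelotope_def)
    define t' where "t' j = t (inv_into I e j)" for j
    have t': "t' (e i) = t i" if "i \<in> I" for i
      using inv_into_f_f[OF bij_betw_imp_inj_on[OF assms] that] by (simp add: t'_def)
    have "x = (\<Sum>i\<in>I. t' (e i) *\<^sub>R h (e i))" using t(1) t' by simp
    also have "\<dots> = (\<Sum>j\<in>J. t' j *\<^sub>R h j)" by (rule sum.reindex_bij_betw[OF assms])
    finally have "x = (\<Sum>j\<in>J. t' j *\<^sub>R h j)" .
    moreover have "\<forall>j\<in>J. 0 \<le> t' j \<and> t' j \<le> 1"
      using t(2) t' bij_betw_imp_surj_on[OF assms] by force
    ultimately show "x \<in> parallelotope J h" unfolding parallelotope_def by blast
  qed
  show "parallelotope J h \<subseteq> parallelotope I (\<lambda>i. h (e i))"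
  proof
    fix x assume "x \<in> parallelotope J h"
    then obtain t where t: "x = (\<Sum>j\<in>J. t j *\<^sub>R h j)" "\<forall>j\<in>J. 0 \<le> t j \<and> t j \<le> 1"
      by (auto simp: parallelotope_def)
    have "x = (\<Sum>i\<in>I. t (e i) *\<^sub>R h (e i))" unfolding t(1) by (rule sum.reindex_bij_betw[OF assms, symmetric])
    moreover have "\<forall>i\<in>I. 0 \<le> t (e i) \<and> t (e i) \<le> 1"
      using t(2) bij_betw_imp_surj_on[OF assms] by blast
    ultimately show "x \<in> parallelotope I (\<lambda>i. h (e i))"
      unfolding parallelotope_def by (intro CollectI exI[of _ "\<lambda>i. t (e i)"] conjI)
  qed
qed

lemma parallelotope_insert:
  assumes "finite B" "u \<notin> B"
  shows "x \<in> parallelotope (insert u B) h \<longleftrightarrow> (\<exists>c p. 0 \<le> c \<and> c \<le> 1 \<and> p \<in> parallelotope B h \<and> x = p + c *\<^sub>R h u)"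
proof
  assume "x \<in> parallelotope (insert u B) h"
  then obtain t where t: "x = (\<Sum>i\<in>insert u B. t i *\<^sub>R h i)" "\<forall>i\<in>insert u B. 0 \<le> t i \<and> t i \<le> 1"
    by (auto simp: parallelotope_def)
  have "x = (\<Sum>i\<in>B. t i *\<^sub>R h i) + t u *\<^sub>R h u" using t(1) assms by (simp add: add.commute)
  moreover have "(\<Sum>i\<in>B. t i *\<^sub>R h i) \<in> parallelotope B h" using t(2) unfolding parallelotope_def by blast
  ultimately show "\<exists>c p. 0 \<le> c \<and> c \<le> 1 \<and> p \<in> parallelotope B h \<and> x = p + c *\<^sub>R h u" using t(2) by blast
next
  assume "\<exists>c p. 0 \<le> c \<and> c \<le> 1 \<and> p \<in> parallelotope B h \<and> x = p + c *\<^sub>R h u"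
  then obtain c t where c: "0 \<le> c" "c \<le> 1" "x = (\<Sum>i\<in>B. t i *\<^sub>R h i) + c *\<^sub>R h u" "\<forall>i\<in>B. 0 \<le> t i \<and> t i \<le> 1"
    by (auto simp: parallelotope_def)
  let ?t = "t(u := c)"
  have "(\<Sum>i\<in>B. ?t i *\<^sub>R h i) = (\<Sum>i\<in>B. t i *\<^sub>R h i)" using assms by (intro sum.cong) auto
  then have "x = (\<Sum>i\<in>insert u B. ?t i *\<^sub>R h i)" using assms c(3) by (simp add: add.commute)
  moreover have "\<forall>i\<in>insert u B. 0 \<le> ?t i \<and> ?t i \<le> 1" using c by simp
  ultimately show "x \<in> parallelotope (insert u B) h" unfolding parallelotope_def by blast
qed

lemma parallelotope_eq_image:
  fixes x :: "'n::finite \<Rightarrow> real^'m"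
  shows "parallelotope UNIV x = (\<lambda>w :: real^'n. \<Sum>i\<in>UNIV. w $ i *\<^sub>R x i) ` cbox 0 1"
proof
  show "parallelotope UNIV x \<subseteq> (\<lambda>w :: real^'n. \<Sum>i\<in>UNIV. w $ i *\<^sub>R x i) ` cbox 0 1"
  proof
    fix z assume "z \<in> parallelotope UNIV x"
    then obtain t where "z = (\<Sum>i\<in>UNIV. t i *\<^sub>R x i)" "\<forall>i. 0 \<le> t i \<and> t i \<le> 1"
      by (auto simp: parallelotope_def)
    then show "z \<in> (\<lambda>w :: real^'n. \<Sum>i\<in>UNIV. w $ i *\<^sub>R x i) ` cbox 0 1"
      by (intro image_eqI[of _ _ "\<chi> i. t i"]) (auto simp: mem_box_cart)
  qed
  show "(\<lambda>w :: real^'n. \<Sum>i\<in>UNIV. w $ i *\<^sub>R x i) ` cbox 0 1 \<subseteq> parallelotope UNIV x"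
    by (auto simp: parallelotope_def mem_box_cart)
qed

lemma compact_parallelotope:
  fixes h :: "'i \<Rightarrow> 'a::euclidean_space"
  assumes "finite I" shows "compact (parallelotope I h)"
  using assms
proof (induction I)
  case empty
  have "parallelotope {} h = {0}" by (auto simp: parallelotope_def)
  then show ?case by simp
next
  case (insert u B)
  have "parallelotope (insert u B) h = (\<lambda>(p, c). p + c *\<^sub>R h u) ` (parallelotope B h \<times> {0..1})"
  proof (rule set_eqI)
    fix x
    show "x \<in> parallelotope (insert u B) h \<longleftrightarrow> x \<in> (\<lambda>(p, c). p + c *\<^sub>R h u) ` (parallelotope B h \<times> {0..1})"
      unfolding parallelotope_insert[OF insert.hyps] by force
  qed
  also have "compact \<dots>"
    unfolding case_prod_beta
    by (intro compact_continuous_image compact_Times insert.IH compact_Icc continuous_intros)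
  finally show ?case .
qed

section \<open>Linear change of variables and the volume of a full-dimensional parallelotope\<close>

lemma distr_lborel_isometry:
  fixes f :: "'a::euclidean_space \<Rightarrow> 'a"
  assumes iso: "\<And>x y. dist (f x) (f y) = dist x y" and "surj f"
  shows "distr lborel borel f = lborel"
proof (rule measure_eqI)
  have [measurable]: "f \<in> borel_measurable borel"
    by (intro borel_measurable_continuous_onI continuous_onI) (auto simp: iso)
  fix A assume "A \<in> sets (distr lborel borel f)"
  then have A [measurable]: "A \<in> sets borel" by simp
  have "f -` A \<in> sets borel" using measurable_sets[of f borel borel A] A by simp
  then have "emeasure (distr lborel borel f) A = hausdorff (DIM('a)) (f -` A)"
    by (simp add: emeasure_distr hausdorff_eq_lborel)
  also have "\<dots> = hausdorff (DIM('a)) (f ` (f -` A))" by (rule hausdorff_isometric_image[symmetric, OF iso])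
  also have "f ` (f -` A) = A" using \<open>surj f\<close> by (rule surj_image_vimage_eq)
  also have "hausdorff (DIM('a)) A = emeasure lborel A" by (rule hausdorff_eq_lborel[OF A])
  finally show "emeasure (distr lborel borel f) A = emeasure lborel A" .
qed simp

lemma measurable_matrix_vector [measurable]: "(*v) (A :: real^'n^'m) \<in> borel_measurable borel"
  by (intro borel_measurable_continuous_onI linear_continuous_on)
     (simp add: linear_conv_bounded_linear[symmetric] matrix_vector_mul_linear)

text \<open>On each line in direction \<open>axis m 1\<close> the shear is a translation, by the
  n-th coordinate, which is constant along that line because m and n differ.\<close>

lemma nn_integral_shear:
  fixes g :: "real^'n \<Rightarrow> ennreal"
  assumes mn: "m \<noteq> n" and [measurable]: "g \<in> borel_measurable borel"
  shows "(\<integral>\<^sup>+x. g (x + (x $ n) *\<^sub>R axis m 1) \<partial>lborel) = (\<integral>\<^sup>+x. g x \<partial>lborel)"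
proof -
  let ?b = "axis m (1::real)"
  have b: "?b \<in> Basis" by (simp add: axis_in_Basis_iff)
  have n [measurable]: "(\<lambda>x :: real^'n. x $ n) \<in> borel_measurable borel"
    by (intro borel_measurable_continuous_onI continuous_intros)
  have "(\<integral>\<^sup>+t. g ((z + t *\<^sub>R ?b) + ((z + t *\<^sub>R ?b) $ n) *\<^sub>R ?b) \<partial>lborel) = (\<integral>\<^sup>+t. g (z + t *\<^sub>R ?b) \<partial>lborel)" for z
  proof -
    have "(\<integral>\<^sup>+t. g (z + t *\<^sub>R ?b) \<partial>lborel) = (\<integral>\<^sup>+t. g (z + t *\<^sub>R ?b) \<partial>distr lborel borel ((+) (z $ n)))"
      by (simp add: lborel_distr_plus)
    also have "\<dots> = (\<integral>\<^sup>+t. g (z + (z $ n + t) *\<^sub>R ?b) \<partial>lborel)"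
      by (subst nn_integral_distr) auto
    finally show ?thesis using mn by (simp add: axis_def algebra_simps)
  qed
  then show ?thesis by (subst (1 2) nn_integral_lborel_coordinate[OF b]) (measurable, simp only:)
qed

text \<open>The change of variables formula of the library is restricted to well-ordered index types.\<close>

lemma nn_integral_matrix:
  fixes A :: "real^'n^'n" and g :: "real^'n \<Rightarrow> ennreal"
  assumes "det A \<noteq> 0" and "g \<in> borel_measurable borel"
  shows "ennreal \<bar>det A\<bar> * (\<integral>\<^sup>+x. g (A *v x) \<partial>lborel) = (\<integral>\<^sup>+x. g x \<partial>lborel)"
proof -
  let ?P = "\<lambda>A :: real^'n^'n. det A \<noteq> 0 \<longrightarrow> (\<forall>g \<in> borel_measurable borel.
    ennreal \<bar>det A\<bar> * (\<integral>\<^sup>+x. g (A *v x) \<partial>lborel) = (\<integral>\<^sup>+x. g x \<partial>lborel))"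
  have "?P A"
  \<comment> \<open>Keeping the premise on the determinant inside the predicate makes the case of a
    zero row vacuous, and for a product it passes to both factors.\<close>
  proof (rule induct_matrix_elementary_alt)
    fix A B :: "real^'n^'n" assume A: "?P A" and B: "?P B"
    show "?P (A ** B)"
    proof (intro impI ballI)
      assume d: "det (A ** B) \<noteq> 0"
      fix g :: "real^'n \<Rightarrow> ennreal" assume g [measurable]: "g \<in> borel_measurable borel"
      have gA: "(\<lambda>x. g (A *v x)) \<in> borel_measurable borel" by measurable
      have dd: "det A \<noteq> 0" "det B \<noteq> 0" using d by (auto simp: det_mul)
      have "ennreal \<bar>det (A ** B)\<bar> * (\<integral>\<^sup>+x. g ((A ** B) *v x) \<partial>lborel) =
        ennreal \<bar>det A\<bar> * (ennreal \<bar>det B\<bar> * (\<integral>\<^sup>+x. g (A *v (B *v x)) \<partial>lborel))"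
        by (simp add: det_mul abs_mult ennreal_mult mult.assoc matrix_vector_mul_assoc)
      also have "\<dots> = ennreal \<bar>det A\<bar> * (\<integral>\<^sup>+x. g (A *v x) \<partial>lborel)"
        using B[rule_format, OF dd(2) gA] by simp
      also have "\<dots> = (\<integral>\<^sup>+x. g x \<partial>lborel)" using A dd(1) g by simp
      finally show "ennreal \<bar>det (A ** B)\<bar> * (\<integral>\<^sup>+x. g ((A ** B) *v x) \<partial>lborel) = (\<integral>\<^sup>+x. g x \<partial>lborel)" .
    qed
  next
    fix A :: "real^'n^'n" and i assume "row i A = 0"
    then have "det A = 0" by (rule det_zero_row)
    then show "?P A" by simp
  next
    fix A :: "real^'n^'n" assume diag: "\<And>i j. i \<noteq> j \<Longrightarrow> A $ i $ j = 0"
    then have det: "det A = (\<Prod>i\<in>UNIV. A $ i $ i)" by (rule det_diagonal)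
    have inj: "inj (\<lambda>i::'n. axis i (1::real))" by (auto intro!: injI simp: axis_eq_axis)
    have Basis: "(Basis :: (real^'n) set) = range (\<lambda>i. axis i 1)" by (auto simp: Basis_vec_def)
    show "?P A"
    proof (intro impI ballI)
      assume d: "det A \<noteq> 0"
      fix g :: "real^'n \<Rightarrow> ennreal" assume g [measurable]: "g \<in> borel_measurable borel"
      define c :: "real^'n \<Rightarrow> real" where "c b = (A *v b) \<bullet> b" for b
      have c: "c (axis i 1) = A $ i $ i" for i
        by (simp add: c_def inner_axis matrix_vector_mult_basis column_def)
      have Ax: "(\<Sum>b\<in>Basis. (c b * (x \<bullet> b)) *\<^sub>R b) = A *v x" for x
      proof -
        have "(A *v x) $ i = A $ i $ i * x $ i" for i
        proof -
          have "(A *v x) $ i = (\<Sum>j\<in>UNIV. A $ i $ j * x $ j)" by (simp add: matrix_vector_mult_def)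
          also have "\<dots> = (\<Sum>j\<in>{i}. A $ i $ j * x $ j)"
            by (rule sum.mono_neutral_right) (use diag in auto)
          finally show ?thesis by simp
        qed
        moreover have "(\<Sum>b\<in>Basis. (c b * (x \<bullet> b)) *\<^sub>R b) $ i = A $ i $ i * x $ i" for i
        proof -
          have "(\<Sum>b\<in>Basis. (c b * (x \<bullet> b)) *\<^sub>R b) = (\<Sum>j\<in>UNIV. (A $ j $ j * x $ j) *\<^sub>R axis j 1)"
            unfolding Basis sum.reindex[OF inj] by (simp add: c inner_axis)
          then show ?thesis by (simp add: axis_def if_distrib[of "\<lambda>a. _ * a"] cong: if_cong)
        qed
        ultimately show ?thesis by (simp add: vec_eq_iff)
      qed
      have prod: "(\<Prod>b\<in>Basis. c b) = det A" unfolding Basis det by (simp add: prod.reindex[OF inj] c)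
      have ne: "c b \<noteq> 0" if "b \<in> Basis" for b
        using d prod that by (metis finite_Basis prod_zero_iff)
      have "(\<integral>\<^sup>+x. g x \<partial>lborel) = (\<integral>\<^sup>+x. g x \<partial>density (distr lborel borel (\<lambda>x. 0 + (\<Sum>b\<in>Basis. (c b * (x \<bullet> b)) *\<^sub>R b))) (\<lambda>_. ennreal \<bar>\<Prod>b\<in>Basis. c b\<bar>))"
      proof -
        have "lborel = density (distr lborel borel (\<lambda>x. 0 + (\<Sum>b\<in>Basis. (c b * (x \<bullet> b)) *\<^sub>R b))) (\<lambda>_. ennreal \<bar>\<Prod>b\<in>Basis. c b\<bar>)"
          unfolding abs_prod by (rule lborel_affine_euclidean) (rule ne)
        then show ?thesis by (rule arg_cong[where f = "\<lambda>M. integral\<^sup>N M g"])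
      qed
      also have "\<dots> = ennreal \<bar>det A\<bar> * (\<integral>\<^sup>+x. g (A *v x) \<partial>lborel)"
        unfolding Ax prod add_0 by (simp add: nn_integral_density nn_integral_distr nn_integral_cmult)
      finally show "ennreal \<bar>det A\<bar> * (\<integral>\<^sup>+x. g (A *v x) \<partial>lborel) = (\<integral>\<^sup>+x. g x \<partial>lborel)" by simp
    qed
  next
    fix m n :: 'n assume "m \<noteq> n"
    let ?p = "Transposition.transpose m n"
    let ?S = "(\<chi> i j. mat 1 $ i $ ?p j) :: real^'n^'n"
    have p: "?p permutes UNIV" by (rule permutes_swap_id) auto
    have "det ?S = of_int (sign ?p) * det (mat 1 :: real^'n^'n)" by (rule det_permute_columns[OF p])
    then have "\<bar>det ?S\<bar> = 1" by (simp add: abs_mult sign_def)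
    have Sx: "(?S *v x) $ i = x $ ?p i" for x i
    proof -
      have "(?S *v x) $ i = (\<Sum>j\<in>UNIV. (if i = ?p j then 1 else 0) * x $ j)"
        by (simp add: matrix_vector_mult_def mat_def)
      also have "\<dots> = (\<Sum>j\<in>UNIV. if j = ?p i then x $ j else 0)"
        by (intro sum.cong) (auto simp: transpose_eq_iff)
      finally show ?thesis by simp
    qed
    \<comment> \<open>Exchanging two coordinates is an isometry, so the invariance of Hausdorff
      measure settles this case.\<close>
    have "norm (?S *v x) = norm x" for x
    proof -
      have "(\<Sum>i\<in>UNIV. (x $ ?p i)\<^sup>2) = (\<Sum>i\<in>UNIV. (x $ i)\<^sup>2)"
        using sum.permute[OF p, of "\<lambda>i. (x $ i)\<^sup>2"] by (simp add: o_def)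
      then show ?thesis by (simp add: norm_vec_def L2_set_def Sx)
    qed
    then have iso: "dist (?S *v x) (?S *v y) = dist x y" for x y
      by (simp add: dist_norm flip: matrix_vector_mult_diff_distrib)
    have "?S *v (?S *v x) = x" for x by (simp add: vec_eq_iff Sx)
    then have "surj ((*v) ?S)" by (metis surjI)
    then have "distr lborel borel ((*v) ?S) = lborel" by (rule distr_lborel_isometry[OF iso])
    then have "(\<integral>\<^sup>+x. g (?S *v x) \<partial>lborel) = (\<integral>\<^sup>+x. g x \<partial>lborel)" if "g \<in> borel_measurable borel" for g
      using nn_integral_distr[of "(*v) ?S" lborel borel g] that by simp
    then show "?P ?S" using \<open>\<bar>det ?S\<bar> = 1\<close> by simp
  next
    fix m n :: 'n assume mn: "m \<noteq> n"
    let ?S = "(\<chi> i j. of_bool (i = m \<and> j = n \<or> i = j)) :: real^'n^'n"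
    have S: "?S = (\<chi> k. if k = m then row m (mat 1) + 1 *s row n (mat 1) else row k (mat 1))"
      using mn by (auto simp: vec_eq_iff row_def mat_def)
    have "det ?S = det (mat 1 :: real^'n^'n)" unfolding S by (rule det_row_operation[OF mn])
    then have det: "det ?S = 1" by simp
    have Sx: "?S *v x = x + (x $ n) *\<^sub>R axis m 1" for x
    proof -
      have "(?S *v x) $ i = (x + (x $ n) *\<^sub>R axis m 1) $ i" for i
      proof -
        have "(?S *v x) $ i = (\<Sum>j\<in>UNIV. (if j = i then x $ j else 0) + (if j = n then if i = m then x $ j else 0 else 0))"
          unfolding matrix_vector_mult_def using mn by (simp, intro sum.cong) auto
        also have "\<dots> = x $ i + (if i = m then x $ n else 0)" by (simp add: sum.distrib)
        finally show ?thesis by (simp add: axis_def)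
      qed
      then show ?thesis by (simp add: vec_eq_iff)
    qed
    show "?P ?S" unfolding det Sx by (simp add: nn_integral_shear[OF mn])
  qed
  then show ?thesis using assms by blast
qed

text \<open>With zero determinant all \<open>x i\<close> are orthogonal to some t \<noteq> 0 and the
  parallelotope lies in a hyperplane. Otherwise it is the preimage of the unit cube under the
  inverse \<open>A'\<close> of the matrix with columns \<open>x i\<close>, and the change of
  variables is applied to \<open>A'\<close>.\<close>

lemma emeasure_parallelotope:
  fixes x :: "'n \<Rightarrow> real^'n"
  shows "emeasure lborel (parallelotope UNIV x) = ennreal \<bar>det (\<chi> i. x i)\<bar>"
proof (cases "det (\<chi> i. x i) = 0")
  case True
  then have "\<not> invertible (\<chi> i. x i)" by (simp add: invertible_det_nz)
  then obtain t where t: "t \<noteq> 0" "(\<chi> i. x i) *v t = 0"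
    by (metis invertible_left_inverse matrix_left_invertible_ker)
  have "x i \<bullet> t = 0" for i
    using t(2) by (simp add: vec_eq_iff matrix_vector_mul_component)
  then have "parallelotope UNIV x \<subseteq> {z. t \<bullet> z = 0}"
    by (auto simp: parallelotope_def inner_sum_right inner_sum_left inner_commute[of t])
  moreover have "negligible {z. t \<bullet> z = 0}" using t(1) by (intro negligible_hyperplane) simp
  ultimately have "negligible (parallelotope UNIV x)" using negligible_subset by metis
  moreover have "compact (parallelotope UNIV x)" by (rule compact_parallelotope) simp
  ultimately show ?thesis using True
    by (simp add: negligible_iff_emeasure0 borel_compact emeasure_completion)
next
  case False
  let ?A = "transpose (\<chi> i. x i)"
  have "invertible ?A" using False by (simp add: invertible_det_nz det_transpose)
  then obtain A' where A': "?A ** A' = mat 1" "A' ** ?A = mat 1" by (auto simp: invertible_def)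
  then have dd: "det A' * det ?A = 1" using det_mul[of A' ?A] by simp
  then have d: "det A' \<noteq> 0" by auto
  have f: "(\<Sum>i\<in>UNIV. w $ i *\<^sub>R x i) = ?A *v w" for w
    by (simp add: vec_eq_iff matrix_vector_mult_def transpose_def mult.commute)
  have par: "z \<in> parallelotope UNIV x \<longleftrightarrow> A' *v z \<in> cbox 0 1" for z
  proof
    assume "z \<in> parallelotope UNIV x"
    then obtain w where "z = ?A *v w" "w \<in> cbox 0 1" by (auto simp: parallelotope_eq_image f)
    then show "A' *v z \<in> cbox 0 1" by (simp only: matrix_vector_mul_assoc A' matrix_vector_mul_lid)
  next
    assume "A' *v z \<in> cbox 0 1"
    moreover have "z = ?A *v (A' *v z)" by (simp only: matrix_vector_mul_assoc A' matrix_vector_mul_lid)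
    ultimately show "z \<in> parallelotope UNIV x" unfolding parallelotope_eq_image f by blast
  qed
  have c: "parallelotope UNIV x \<in> sets borel" by (intro borel_compact compact_parallelotope) simp
  have "emeasure lborel (parallelotope UNIV x) = (\<integral>\<^sup>+z. indicator (parallelotope UNIV x) z \<partial>lborel)" using c by simp
  also have "\<dots> = (\<integral>\<^sup>+z. indicator (cbox 0 1) (A' *v z) \<partial>lborel)"
    by (intro nn_integral_cong) (simp add: par indicator_def)
  finally have 1: "emeasure lborel (parallelotope UNIV x) = (\<integral>\<^sup>+z. indicator (cbox 0 1) (A' *v z) \<partial>lborel)" .
  have "(\<integral>\<^sup>+z. indicator (cbox 0 1) z \<partial>(lborel :: (real^'n) measure)) = 1"
  proof -
    have "((1 :: real^'n) - 0) \<bullet> b = 1" if "b \<in> Basis" for b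
      using that by (auto simp: Basis_vec_def inner_axis)
    then show ?thesis by (simp add: emeasure_lborel_cbox_eq prod.neutral)
  qed
  then have "ennreal \<bar>det A'\<bar> * emeasure lborel (parallelotope UNIV x) = 1"
    using nn_integral_matrix[OF d, of "indicator (cbox 0 1)"] 1 by simp
  then have "ennreal \<bar>det ?A\<bar> * (ennreal \<bar>det A'\<bar> * emeasure lborel (parallelotope UNIV x)) = ennreal \<bar>det ?A\<bar>" by simp
  moreover have "ennreal \<bar>det ?A\<bar> * ennreal \<bar>det A'\<bar> = 1"
    using dd by (simp add: mult.commute flip: ennreal_mult abs_mult)
  ultimately show ?thesis by (simp add: det_transpose flip: mult.assoc)
qed

lemma Delta_UNIV:
  fixes x :: "'n \<Rightarrow> real^'n"
  shows "Delta UNIV x = \<bar>det (\<chi> i. x i)\<bar>"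
proof -
  have "parallelotope UNIV x \<in> sets borel" by (intro borel_compact compact_parallelotope) simp
  then have "hausdorff (CARD('n)) (parallelotope UNIV x) = ennreal \<bar>det (\<chi> i. x i)\<bar>"
    using hausdorff_eq_lborel[of "parallelotope UNIV x"] emeasure_parallelotope[of x] by simp
  then show ?thesis by (simp add: Delta_def)
qed

lemma det_rows_eq_0:
  fixes r :: "'n \<Rightarrow> real^'n"
  assumes "\<And>j. r j \<bullet> t = 0" "t \<noteq> 0"
  shows "det (\<chi> j. r j) = 0"
proof (rule ccontr)
  assume "det (\<chi> j. r j) \<noteq> 0"
  then have "invertible (\<chi> j. r j)" by (simp add: invertible_det_nz)
  moreover have "(\<chi> j. r j) *v t = 0"
    using assms(1) by (simp add: vec_eq_iff matrix_vector_mul_component)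
  ultimately show False using assms(2)
    by (metis invertible_def matrix_left_invertible_ker)
qed

section \<open>Factorization of the determinant along the unit dependency\<close>

locale hyperplane_basis =
  fixes u :: "real^'n" and B :: "(real^'n) set"
  assumes n: "CARD('n) \<ge> 2" and u: "norm u = 1" and B: "orthonormal_basis B ({u}\<^sup>\<bottom>)"
begin

lemma B_perp: "b \<in> B \<Longrightarrow> b \<bullet> u = 0"
  using B span_superset[of B] by (auto simp: orthonormal_basis_def simp flip: mem_orthogonal_comp_singleton)

lemma u_notin_B: "u \<notin> B"
  using B_perp[of u] u by (auto simp: norm_eq_1)

lemma independent_B: "independent B"
  using B by (intro pairwise_orthogonal_independent) (auto simp: orthonormal_basis_def)

lemma finite_B: "finite B"
  using independent_B by (rule independent_imp_finite)

lemma card_B: "card B = CARD('n) - 1"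
proof -
  have "dim (span B) = card B" using independent_B by (rule dim_span_eq_card_independent)
  moreover have "span B = {x. u \<bullet> x = 0}"
    using B by (auto simp: orthonormal_basis_def mem_orthogonal_comp_singleton inner_commute)
  moreover have "u \<noteq> 0" using u by auto
  ultimately show ?thesis using dim_hyperplane[of u] by simp
qed

text \<open>The rows of \<open>y\<close> are indexed by \<open>B\<close> and the row of heights by
  \<open>u\<close>, but a determinant needs rows indexed by \<open>'n\<close>. The order is
  arbitrary; it affects determinants only in their sign.\<close>

definition e :: "'n \<Rightarrow> real^'n" where
  "e = (SOME e. bij_betw e UNIV (insert u B))"

lemma bij_e: "bij_betw e UNIV (insert u B)"
proof -
  have "card (insert u B) = CARD('n)" using u_notin_B finite_B card_B n by simp
  then have "\<exists>e. bij_betw e (UNIV :: 'n set) (insert u B)"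
    using finite_B by (intro finite_same_card_bij) auto
  then show ?thesis unfolding e_def by (rule someI_ex)
qed

lemma e_in: "e j \<in> insert u B" using bij_betwE[OF bij_e] by blast

lemma e_orthonormal: "e i \<bullet> e j = (if i = j then 1 else 0)"
proof (cases "i = j")
  case True
  then show ?thesis using e_in[of i] u B by (auto simp: orthonormal_basis_def norm_eq_1)
next
  case False
  then have "e i \<noteq> e j" using bij_betw_imp_inj_on[OF bij_e] by (auto dest: inj_onD)
  moreover have "pairwise orthogonal B" using B by (simp add: orthonormal_basis_def)
  ultimately have "e i \<bullet> e j = 0"
    using e_in[of i] e_in[of j] B_perp B_perp[unfolded inner_commute[of _ u]] by (auto simp: pairwise_def orthogonal_def)
  then show ?thesis using False by simp
qed

lemma abs_det_in_basis:
  "\<bar>det (\<chi> i. x i)\<bar> = \<bar>det (\<chi> j. \<chi> i. x i \<bullet> e j)\<bar>"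
proof -
  let ?Q = "\<chi> j. e j"
  have "orthogonal_matrix ?Q"
    unfolding orthogonal_matrix_orthonormal_rows
    using e_orthonormal by (simp add: row_def vec_nth_inverse orthogonal_def norm_eq_1)
  then have "\<bar>det ?Q\<bar> = 1" using det_orthogonal_matrix[of ?Q] by auto
  moreover have "(\<chi> j. \<chi> i. x i \<bullet> e j) = ?Q ** transpose (\<chi> i. x i)"
    by (simp add: matrix_matrix_mult_def transpose_def inner_vec_def vec_eq_iff mult.commute)
  ultimately show ?thesis by (simp add: det_mul abs_mult det_transpose)
qed

text \<open>For \<open>y\<close> in the hyperplane these are the rows of the coordinate matrix of
  the vectors y_i + s_i u in the orthonormal basis \<open>insert u B\<close>, one column for each
  index; the \<open>u\<close>-coordinates are the heights.\<close>

definition row_at :: "('n \<Rightarrow> real^'n) \<Rightarrow> real^'n \<Rightarrow> real^'n \<Rightarrow> real^'n" where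
  "row_at y s b = (if b = u then s else row_of y b)"

lemma abs_det_shift:
  assumes y: "\<And>i. y i \<in> {u}\<^sup>\<bottom>"
  shows "\<bar>det (\<chi> i. y i + s $ i *\<^sub>R u)\<bar> = \<bar>det (\<chi> j. row_at y s (e j))\<bar>"
proof -
  have "(y i + s $ i *\<^sub>R u) \<bullet> e j = row_at y s (e j) $ i" for i j
  proof (cases "e j = u")
    case True
    then show ?thesis using y[of i] u
      by (simp add: row_at_def inner_left_distrib norm_eq_1 mem_orthogonal_comp_singleton)
  next
    case False
    then have "u \<bullet> e j = 0" using e_in[of j] B_perp[of "e j"] by (simp add: inner_commute)
    then show ?thesis using False by (simp add: row_at_def row_of_def inner_left_distrib)
  qed
  then show ?thesis by (subst abs_det_in_basis) (simp add: vec_lambda_eta)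
qed

lemma row_of_orth:
  assumes "unit_dependency y t"
  shows "row_of y b \<bullet> t = 0"
proof -
  have "row_of y b \<bullet> t = (\<Sum>i\<in>UNIV. t $ i *\<^sub>R y i) \<bullet> b"
    unfolding inner_sum_left by (simp add: row_of_def inner_vec_def[of "\<chi> i. _ i"] mult.commute)
  then show ?thesis using assms by (simp add: unit_dependency_def)
qed

text \<open>The row \<open>s\<close> is split into its component along \<open>t\<close> and a
  remainder orthogonal to \<open>t\<close>. The remainder contributes a matrix all of whose rows are
  orthogonal to \<open>t\<close>, hence determinant 0.\<close>

lemma det_row_at:
  assumes t: "unit_dependency y t"
  shows "det (\<chi> j. row_at y s (e j)) = (s \<bullet> t) * det (\<chi> j. row_at y t (e j))"
proof -
  obtain k where k: "e k = u" using bij_betw_imp_surj_on[OF bij_e] by (metis insertI1 rangeE)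
  have ek: "e j = u \<longleftrightarrow> j = k" for j
    using k bij_betw_imp_inj_on[OF bij_e] by (metis UNIV_I inj_onD)
  have tt: "t \<bullet> t = 1" using t by (simp add: unit_dependency_def norm_eq_1)
  have R: "(\<chi> j. row_at y s (e j)) = (\<chi> j. if j = k then s else row_of y (e j))" for s
    unfolding row_at_def ek ..
  let ?s = "s - (s \<bullet> t) *\<^sub>R t"
  have ss: "(s \<bullet> t) *s t + ?s = s" by (simp add: scalar_mult_eq_scaleR)
  have "det (\<chi> j. row_at y s (e j)) = det (\<chi> j. if j = k then (s \<bullet> t) *s t + ?s else row_of y (e j))"
    unfolding R by (simp only: ss)
  also have "\<dots> = det (\<chi> j. if j = k then (s \<bullet> t) *s t else row_of y (e j)) + det (\<chi> j. if j = k then ?s else row_of y (e j))"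
    by (rule det_row_add)
  also have "det (\<chi> j. if j = k then ?s else row_of y (e j)) = 0"
  proof (rule det_rows_eq_0)
    show "(if j = k then ?s else row_of y (e j)) \<bullet> t = 0" for j
      using row_of_orth[OF t] by (simp add: inner_diff_left tt)
    show "t \<noteq> 0" using tt by auto
  qed
  also have "det (\<chi> j. if j = k then (s \<bullet> t) *s t else row_of y (e j)) = (s \<bullet> t) * det (\<chi> j. if j = k then t else row_of y (e j))"
    by (rule det_row_mul)
  finally show ?thesis unfolding R by simp
qed

text \<open>The parallelotope of the rows lies in the hyperplane orthogonal to \<open>t\<close>.
  Adding the unit vector \<open>t\<close> as a further edge gives a prism of height 1, whose
  n-dimensional volume equals the (n-1)-dimensional volume of the base and is a determinant.\<close>

lemma Delta_row_of:
  assumes t: "unit_dependency y t"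
  shows "Delta B (row_of y) = \<bar>det (\<chi> j. row_at y t (e j))\<bar>"
proof -
  have nt: "norm t = 1" using t by (simp add: unit_dependency_def)
  obtain L where "hyperplane_chart t L" using hyperplane_chart_exists[OF n nt] by blast
  then interpret hyperplane_chart t L .
  let ?P = "parallelotope B (row_of y)" and ?Q = "parallelotope (insert u B) (row_at y t)"
  have P: "?P \<in> sets borel" "?Q \<in> sets borel" using finite_B by (auto intro!: borel_compact compact_parallelotope)
  have Pt: "?P \<subseteq> {t}\<^sup>\<bottom>"
    by (auto simp: parallelotope_def mem_orthogonal_comp_singleton inner_sum_left row_of_orth[OF t])
  have PB: "parallelotope B (row_at y t) = ?P"
  proof -
    have "(\<Sum>b\<in>B. c b *\<^sub>R row_at y t b) = (\<Sum>b\<in>B. c b *\<^sub>R row_of y b)" for c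
      using u_notin_B by (intro sum.cong) (auto simp: row_at_def)
    then show ?thesis by (simp add: parallelotope_def)
  qed
  have Q: "L w + c *\<^sub>R t \<in> ?Q \<longleftrightarrow> L w \<in> ?P \<and> c \<in> {0..1}" for w c
  proof
    assume "L w + c *\<^sub>R t \<in> ?Q"
    then obtain d p where d: "0 \<le> d" "d \<le> 1" "p \<in> ?P" "L w + c *\<^sub>R t = p + d *\<^sub>R t"
      unfolding parallelotope_insert[OF finite_B u_notin_B] PB by (auto simp: row_at_def)
    have "(L w + c *\<^sub>R t) \<bullet> t = (p + d *\<^sub>R t) \<bullet> t" using d(4) by simp
    moreover have "p \<bullet> t = 0" using d(3) Pt mem_orthogonal_comp_singleton by blast
    moreover have "t \<bullet> t = 1" using nt by (simp add: norm_eq_1)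
    ultimately have "c = d" by (simp only: inner_left_distrib chart_orth inner_scaleR_left)
    then show "L w \<in> ?P \<and> c \<in> {0..1}" using d by simp
  next
    assume "L w \<in> ?P \<and> c \<in> {0..1}"
    then show "L w + c *\<^sub>R t \<in> ?Q"
      unfolding parallelotope_insert[OF finite_B u_notin_B] PB by (auto simp: row_at_def)
  qed
  have LP: "L -` ?P \<in> sets borel" using measurable_sets[OF measurable_chart P(1)] by simp
  have "ennreal \<bar>det (\<chi> j. row_at y t (e j))\<bar> = emeasure lborel (parallelotope UNIV (\<lambda>j. row_at y t (e j)))"
    by (rule emeasure_parallelotope[symmetric])
  also have "\<dots> = emeasure lborel ?Q" by (simp add: parallelotope_reindex[OF bij_e])
  also have "\<dots> = (\<integral>\<^sup>+x. indicator ?Q x \<partial>lborel)" using P by simp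
  also have "\<dots> = (\<integral>\<^sup>+w. \<integral>\<^sup>+c. indicator ?Q (L w + c *\<^sub>R t) \<partial>lborel \<partial>lborel)"
    using P by (intro nn_integral_lborel_chart(1)) simp
  also have "\<dots> = (\<integral>\<^sup>+w. indicator (L -` ?P) w \<partial>lborel)"
  proof (rule nn_integral_cong)
    fix w
    have "(\<integral>\<^sup>+c. indicator ?Q (L w + c *\<^sub>R t) \<partial>lborel) = (\<integral>\<^sup>+c. indicator (L -` ?P) w * indicator {0..1::real} c \<partial>lborel)"
      by (rule nn_integral_cong) (simp add: indicator_def Q)
    also have "\<dots> = indicator (L -` ?P) w" by (subst nn_integral_cmult) auto
    finally show "(\<integral>\<^sup>+c. indicator ?Q (L w + c *\<^sub>R t) \<partial>lborel) = indicator (L -` ?P) w" .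
  qed
  also have "\<dots> = emeasure lborel (L -` ?P)" using LP by simp
  also have "\<dots> = hausdorff (CARD('n) - 1) ?P"
    using hausdorff_Int_hyperplane[OF P(1)] Pt by (simp add: Int_absorb2)
  finally have "hausdorff (card B) ?P = ennreal \<bar>det (\<chi> j. row_at y t (e j))\<bar>" by (simp only: card_B)
  then show ?thesis by (simp add: Delta_def)
qed

theorem Delta_shift:
  assumes y: "\<And>i. y i \<in> {u}\<^sup>\<bottom>" and t: "unit_dependency y t"
  shows "Delta UNIV (\<lambda>i. y i + s $ i *\<^sub>R u) = Delta B (row_of y) * \<bar>s \<bullet> t\<bar>"
  by (simp add: Delta_UNIV abs_det_shift[OF y] det_row_at[OF t, of s] Delta_row_of[OF t] abs_mult)

text \<open>Applying the factorization to the heights \<open>t'\<close>, once with \<open>t\<close>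
  and once with \<open>t'\<close>, and cancelling the nonzero volume gives |t' \<bullet> t| = 1.
  This is the equality case of the Cauchy-Schwarz inequality for unit vectors.\<close>

lemma unit_dependency_unique:
  assumes y: "\<And>i. y i \<in> {u}\<^sup>\<bottom>" and t: "unit_dependency y t" "unit_dependency y t'"
    and D: "Delta B (row_of y) \<noteq> 0"
  shows "t' = t \<or> t' = - t"
proof -
  have n1: "t \<bullet> t = 1" "t' \<bullet> t' = 1" using t by (auto simp: unit_dependency_def norm_eq_1)
  have "\<bar>t' \<bullet> t\<bar> = \<bar>t' \<bullet> t'\<bar>"
    using Delta_shift[OF y t(1), of t'] Delta_shift[OF y t(2), of t'] D by simp
  then consider "t' \<bullet> t = 1" | "t' \<bullet> t = -1" using n1 by fastforce
  then show ?thesis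
  proof cases
    case 1
    then have "(t' - t) \<bullet> (t' - t) = 0" using n1 by (simp add: inner_diff_left inner_diff_right inner_commute)
    then show ?thesis by simp
  next
    case 2
    then have "(t' + t) \<bullet> (t' + t) = 0" using n1 by (simp add: inner_left_distrib inner_right_distrib inner_commute)
    then show ?thesis by (simp add: eq_neg_iff_add_eq_0)
  qed
qed

text \<open>Unlike the dependency \<open>t\<close>, the right-hand side is visibly measurable in \<open>y\<close>.\<close>

lemma Delta_row_of_eq_sqrt:
  assumes y: "\<And>i. y i \<in> {u}\<^sup>\<bottom>" and t: "unit_dependency y t"
  shows "Delta B (row_of y) = sqrt (\<Sum>k\<in>UNIV. (det (\<chi> i. y i + axis k 1 $ i *\<^sub>R u))\<^sup>2)"
proof -
  \<comment> \<open>Heights \<open>axis k 1\<close> turn the factorization into: the k-th minor is,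
    up to sign, the volume times t_k. The squares of the t_k add up to 1.\<close>
  have "(\<Sum>k\<in>UNIV. (det (\<chi> i. y i + axis k 1 $ i *\<^sub>R u))\<^sup>2) = (\<Sum>k\<in>UNIV. (Delta B (row_of y))\<^sup>2 * (t $ k)\<^sup>2)"
  proof (rule sum.cong)
    fix k
    have "(det (\<chi> i. y i + axis k 1 $ i *\<^sub>R u))\<^sup>2 = (Delta UNIV (\<lambda>i. y i + axis k 1 $ i *\<^sub>R u))\<^sup>2"
      by (simp only: Delta_UNIV power2_abs)
    also have "\<dots> = (Delta B (row_of y))\<^sup>2 * (t $ k)\<^sup>2"
      unfolding Delta_shift[OF y t] by (simp add: power_mult_distrib inner_axis' )
    finally show "(det (\<chi> i. y i + axis k 1 $ i *\<^sub>R u))\<^sup>2 = (Delta B (row_of y))\<^sup>2 * (t $ k)\<^sup>2" .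
  qed simp
  also have "\<dots> = (Delta B (row_of y))\<^sup>2 * (t \<bullet> t)"
    by (simp add: sum_distrib_left inner_vec_def power2_eq_square)
  also have "t \<bullet> t = 1" using t by (simp add: unit_dependency_def norm_eq_1)
  finally show ?thesis by (simp add: Delta_def)
qed

end

section \<open>Integrability of the inverse volume\<close>

text \<open>With the rows given by a function, replacing a row is a function update, and
  multilinearity becomes a pair of rewrite rules.\<close>

definition row_det :: "('n \<Rightarrow> real^'n) \<Rightarrow> real" where "row_det r = det (\<chi> i. r i)"

lemma row_det_add: "row_det (r(k := a + b)) = row_det (r(k := a)) + row_det (r(k := b))"
  using det_row_add[of k "\<lambda>_. a" "\<lambda>_. b" r] by (simp add: row_det_def fun_upd_def)

lemma row_det_scale: "row_det (r(k := c *\<^sub>R a)) = c * row_det (r(k := a))"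
  using det_row_mul[of k c "\<lambda>_. a" r] unfolding scalar_mult_eq_scaleR by (simp add: row_det_def fun_upd_def)

lemma row_det_eq_0: "i \<noteq> j \<Longrightarrow> r i = r j \<Longrightarrow> row_det r = 0"
  unfolding row_det_def by (rule det_identical_rows[of i j]) (auto simp: row_def vec_eq_iff)

lemma abs_row_det_swap:
  fixes r :: "'n \<Rightarrow> real^'n"
  assumes "i \<noteq> j"
  shows "\<bar>row_det (r(i := b, j := a))\<bar> = \<bar>row_det (r(i := a, j := b))\<bar>"
proof -
  let ?p = "Transposition.transpose i j" and ?A = "(\<chi> l. (r(i := a, j := b)) l) :: real^'n^'n"
  have "?p permutes UNIV" by (rule permutes_swap_id) auto
  then have "det (\<chi> l. ?A $ ?p l) = of_int (sign ?p) * det ?A" by (rule det_permute_rows)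
  moreover have "(\<chi> l. ?A $ ?p l) = (\<chi> l. (r(i := b, j := a)) l)"
    using assms by (auto simp: vec_eq_iff transpose_def)
  ultimately show ?thesis by (simp add: row_det_def abs_mult sign_def)
qed

lemma measurable_row_det:
  assumes [measurable]: "\<And>i. (\<lambda>x. r x i) \<in> borel_measurable N"
  shows "(\<lambda>x. row_det (r x)) \<in> borel_measurable N"
proof -
  have nth: "(\<lambda>v :: real^'n. v $ k) \<in> borel_measurable borel" for k
    by (intro borel_measurable_continuous_onI continuous_intros)
  have [measurable]: "(\<lambda>x. r x i $ k) \<in> borel_measurable N" for i k
    by (rule measurable_compose[OF assms nth])
  show ?thesis unfolding row_det_def det_def by simp
qed

section \<open>Integrals of inverse square roots\<close>

lemma ennreal_inverse_antimono:
  assumes "x \<le> y" shows "inverse y \<le> inverse (x :: ennreal)"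
proof (cases "x = 0 \<or> y = top")
  case False
  then obtain a b where ab: "x = ennreal a" "y = ennreal b" "0 < a" "0 \<le> b"
    using assms by (cases x; cases y) (auto simp: less_le top_unique)
  then have "a \<le> b" using assms by (simp add: ennreal_le_iff)
  then show ?thesis using ab by (simp add: inverse_ennreal le_imp_inverse_le ennreal_leI)
qed auto

text \<open>This is |x|^(-1/2) with value \<infinity> at 0. The real power is 0 there, which would
  spoil the use of this function as an upper bound.\<close>

definition inv_sqrt :: "real \<Rightarrow> ennreal" where
  "inv_sqrt x = inverse (ennreal (sqrt \<bar>x\<bar>))"

lemma borel_measurable_inv_sqrt [measurable]: "inv_sqrt \<in> borel_measurable borel"
  unfolding inv_sqrt_def by measurable

lemma inv_sqrt_0 [simp]: "inv_sqrt 0 = \<infinity>"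
  by (simp add: inv_sqrt_def)

lemma inv_sqrt_eq_powr: "x \<noteq> 0 \<Longrightarrow> inv_sqrt x = ennreal (\<bar>x\<bar> powr (- 1 / 2))"
  by (simp add: inv_sqrt_def inverse_ennreal powr_minus powr_half_sqrt)

lemma inv_sqrt_ne_0: "inv_sqrt x \<noteq> 0"
  by (simp add: inv_sqrt_def)

text \<open>This also holds at 0, since \<open>inv_sqrt\<close> never vanishes and the product 0
  times \<infinity> cannot arise.\<close>

lemma inv_sqrt_mult: "inv_sqrt (x * y) = inv_sqrt x * inv_sqrt y"
proof (cases "x = 0 \<or> y = 0")
  case True
  then show ?thesis using inv_sqrt_ne_0 by (auto simp: ennreal_top_mult ennreal_mult_top)
next
  case False
  then show ?thesis by (simp add: inv_sqrt_eq_powr abs_mult powr_mult ennreal_mult)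
qed

lemma inv_sqrt_square: "inv_sqrt x * inv_sqrt x = inverse (ennreal \<bar>x\<bar>)"
  by (simp add: inv_sqrt_mult[symmetric]) (simp add: inv_sqrt_def abs_mult)

text \<open>Here \<open>a\<close> and \<open>b\<close> will be two minors bounded by the volume
  \<open>D\<close>. Each receives the exponent -1/2, which is locally integrable on the line,
  whereas -1 is not.\<close>

lemma inverse_le_inv_sqrt_mult:
  assumes "\<bar>a\<bar> \<le> D" "\<bar>b\<bar> \<le> D"
  shows "inverse (ennreal D) \<le> inv_sqrt a * inv_sqrt b"
proof -
  have "D = \<bar>D\<bar>" using assms by simp
  then have "inverse (ennreal D) = inv_sqrt D * inv_sqrt D" using inv_sqrt_square[of D] by simp
  also have "\<dots> \<le> inv_sqrt a * inv_sqrt b"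
    using assms unfolding inv_sqrt_def by (intro mult_mono ennreal_inverse_antimono ennreal_leI real_sqrt_le_mono) auto
  finally show ?thesis .
qed

lemma nn_integral_abs_powr:
  assumes q: "-1 < q" and T: "0 \<le> T"
  shows "(\<integral>\<^sup>+x. ennreal (\<bar>x\<bar> powr q) * indicator {-T..T} x \<partial>lborel) = ennreal (2 * (T powr (q + 1) / (q + 1)))"
proof -
  have half: "(\<integral>\<^sup>+x. ennreal (\<bar>x\<bar> powr q) * indicator {0..T} x \<partial>lborel) = ennreal (T powr (q + 1) / (q + 1))"
  proof -
    have "((\<lambda>x. \<bar>x\<bar> powr q) has_integral (T powr (q + 1) / (q + 1))) {0..T}"
      by (rule has_integral_eq[OF _ has_integral_powr_from_0[OF q T]]) auto
    then show ?thesis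
      using q by (intro nn_integral_has_integral_lebesgue'[unfolded nn_integral_completion]) (auto simp: mult.commute)
  qed
  have half': "(\<integral>\<^sup>+x. ennreal (\<bar>x\<bar> powr q) * indicator {-T..0} x \<partial>lborel) = ennreal (T powr (q + 1) / (q + 1))"
  proof -
    have "(\<integral>\<^sup>+x. ennreal (\<bar>x\<bar> powr q) * indicator {-T..0} x \<partial>lborel) =
      (\<integral>\<^sup>+x. ennreal (\<bar>x\<bar> powr q) * indicator {-T..0} x \<partial>distr lborel borel uminus)"
      by (simp add: lborel_distr_uminus)
    also have "\<dots> = (\<integral>\<^sup>+x. ennreal (\<bar>x\<bar> powr q) * indicator {0..T} x \<partial>lborel)"
      by (subst nn_integral_distr) (auto intro!: nn_integral_cong simp: indicator_def)
    finally show ?thesis using half by simp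
  qed
  have "(\<integral>\<^sup>+x. ennreal (\<bar>x\<bar> powr q) * indicator {-T..T} x \<partial>lborel) =
    (\<integral>\<^sup>+x. ennreal (\<bar>x\<bar> powr q) * indicator {-T..0} x + ennreal (\<bar>x\<bar> powr q) * indicator {0..T} x \<partial>lborel)"
    using AE_lborel_singleton[of "0::real"] T
    by (intro nn_integral_cong_AE) (auto elim!: eventually_mono simp: indicator_def)
  also have "\<dots> = ennreal (T powr (q + 1) / (q + 1)) + ennreal (T powr (q + 1) / (q + 1))"
    by (subst nn_integral_add) (auto simp: half half')
  also have "\<dots> = ennreal (2 * (T powr (q + 1) / (q + 1)))"
    using q by (subst ennreal_plus[symmetric]) auto
  finally show ?thesis .
qed

text \<open>Taking out \<open>d\<close> leaves a translate of \<open>inv_sqrt\<close>, which makes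
  the bound uniform in \<open>c\<close>. The constant is 5 = 1 + 4: outside [-1, 1] the function is
  at most 1, and its integral over [-1, 1] is 4.\<close>

lemma nn_integral_inv_sqrt_affine:
  assumes d: "d \<noteq> 0"
  shows "(\<integral>\<^sup>+t. inv_sqrt (c + t * d) * indicator {0..1} t \<partial>lborel) \<le> 5 * inv_sqrt d"
proof -
  have unit: "(\<integral>\<^sup>+x. inv_sqrt x * indicator {-1..1} x \<partial>lborel) = 4"
  proof -
    have "(\<integral>\<^sup>+x. inv_sqrt x * indicator {-1..1} x \<partial>lborel) = (\<integral>\<^sup>+x. ennreal (\<bar>x\<bar> powr (-1/2)) * indicator {-1..1} x \<partial>lborel)"
      using AE_lborel_singleton[of "0::real"]
      by (intro nn_integral_cong_AE) (auto elim!: eventually_mono simp: inv_sqrt_eq_powr)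
    also have "\<dots> = 4" by (subst nn_integral_abs_powr) auto
    finally show ?thesis .
  qed
  have "(\<integral>\<^sup>+t. inv_sqrt (c + t * d) * indicator {0..1} t \<partial>lborel) =
    (\<integral>\<^sup>+t. inv_sqrt d * (inv_sqrt (c / d + t) * indicator {0..1} t) \<partial>lborel)"
  proof (rule nn_integral_cong)
    fix t
    have "d * (c / d + t) = c + t * d" using d by (simp add: distrib_left mult.commute)
    then have "inv_sqrt (c + t * d) = inv_sqrt (d * (c / d + t))" by simp
    then show "inv_sqrt (c + t * d) * indicator {0..1} t = inv_sqrt d * (inv_sqrt (c / d + t) * indicator {0..1} t)"
      by (simp add: inv_sqrt_mult mult.assoc)
  qed
  also have "\<dots> = inv_sqrt d * (\<integral>\<^sup>+t. inv_sqrt (c / d + t) * indicator {0..1} t \<partial>lborel)"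
    by (rule nn_integral_cmult) measurable
  finally have 1: "(\<integral>\<^sup>+t. inv_sqrt (c + t * d) * indicator {0..1} t \<partial>lborel) =
    inv_sqrt d * (\<integral>\<^sup>+t. inv_sqrt (c / d + t) * indicator {0..1} t \<partial>lborel)" .
  have "(\<integral>\<^sup>+t. inv_sqrt (c / d + t) * indicator {0..1} t \<partial>lborel)
     \<le> (\<integral>\<^sup>+t. indicator {0..1} t + inv_sqrt (c / d + t) * indicator {-1..1} (c / d + t) \<partial>lborel)"
  proof (rule nn_integral_mono)
    fix t :: real
    have "inv_sqrt x \<le> 1 + inv_sqrt x * indicator {-1..1} x" for x
    proof (cases "x \<in> {-1..1}")
      case False
      then have "1 \<le> \<bar>x\<bar>" by auto
      then have "inv_sqrt x \<le> inv_sqrt 1"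
        unfolding inv_sqrt_def by (intro ennreal_inverse_antimono ennreal_leI real_sqrt_le_mono) auto
      then show ?thesis using False by (simp add: inv_sqrt_def)
    qed simp
    from mult_right_mono[OF this[of "c / d + t"], of "indicator {0..1} t"]
    show "inv_sqrt (c / d + t) * indicator {0..1} t \<le> indicator {0..1} t + inv_sqrt (c / d + t) * indicator {-1..1} (c / d + t)"
      by (auto simp: indicator_def)
  qed
  also have "\<dots> = 1 + (\<integral>\<^sup>+t. inv_sqrt (c / d + t) * indicator {-1..1} (c / d + t) \<partial>lborel)"
    by (subst nn_integral_add) auto
  also have "(\<integral>\<^sup>+t. inv_sqrt (c / d + t) * indicator {-1..1} (c / d + t) \<partial>lborel) = (\<integral>\<^sup>+x. inv_sqrt x * indicator {-1..1} x \<partial>distr lborel borel ((+) (c / d)))"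
    by (subst nn_integral_distr) auto
  also have "\<dots> = 4" using unit by (simp add: lborel_distr_plus)
  finally have "(\<integral>\<^sup>+t. inv_sqrt (c / d + t) * indicator {0..1} t \<partial>lborel) \<le> 5" by simp
  then show ?thesis unfolding 1 by (simp only: mult.commute[of 5] mult_left_mono zero_le)
qed

section \<open>Averaging over translations inside the hyperplane\<close>

context hyperplane_chart
begin

definition ball_volume :: "real \<Rightarrow> ennreal" where
  "ball_volume R = emeasure (perp_measure v) ({v}\<^sup>\<bottom> \<inter> cball 0 R)"

lemma nn_integral_perp_ball: "(\<integral>\<^sup>+z. indicator (cball 0 R) z \<partial>perp_measure v) = ball_volume R"
proof -
  have "(\<integral>\<^sup>+z. indicator (cball 0 R) z \<partial>perp_measure v) = (\<integral>\<^sup>+z. indicator ({v}\<^sup>\<bottom> \<inter> cball 0 R) z \<partial>perp_measure v)"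
    by (intro nn_integral_cong) (auto simp: space_perp_measure indicator_def)
  also have "\<dots> = ball_volume R" unfolding ball_volume_def
    by (rule nn_integral_indicator) (auto simp: sets_perp_measure sets_restrict_space_iff closed_hyperplane_perp)
  finally show ?thesis .
qed

lemma ball_volume_finite: "ball_volume R < \<infinity>"
proof -
  have "{v}\<^sup>\<bottom> \<inter> cball 0 R \<in> sets (perp_measure v)"
    by (auto simp: sets_perp_measure sets_restrict_space_iff closed_hyperplane_perp)
  moreover have "bounded (L -` ({v}\<^sup>\<bottom> \<inter> cball 0 R))" by (rule vimage_chart_bounded) (auto intro: bounded_subset)
  then have "emeasure lborel (L -` ({v}\<^sup>\<bottom> \<inter> cball 0 R)) < \<infinity>" by (rule emeasure_bounded_finite)
  ultimately show ?thesis by (simp add: ball_volume_def emeasure_perp)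
qed

text \<open>
  Translating \<open>z\<close> by \<open>s *\<^sub>R a + t *\<^sub>R b\<close> does not change the integral, so the integral may be
  averaged over \<open>s, t \<in> [0, 1]\<close>; this replaces an integration in coordinates adapted to \<open>a\<close> and \<open>b\<close>.
\<close>

lemma nn_integral_perp_average:
  assumes a: "a \<in> {v}\<^sup>\<bottom>" "norm a \<le> 1" and b: "b \<in> {v}\<^sup>\<bottom>" "norm b \<le> 1"
    and h [measurable]: "h \<in> borel_measurable borel"
    and K: "\<And>z. (\<integral>\<^sup>+s. (\<integral>\<^sup>+t. h (z + s *\<^sub>R a + t *\<^sub>R b) * indicator {0..1} t \<partial>lborel) * indicator {0..1} s \<partial>lborel) \<le> K"
  shows "(\<integral>\<^sup>+z. indicator (cball 0 R) z * h z \<partial>perp_measure v) \<le> ball_volume (R + 2) * K"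
proof -
  let ?M = "perp_measure v" and ?I = "indicator {0..1} :: real \<Rightarrow> ennreal"
  let ?g = "\<lambda>z. indicator (cball 0 R) z * h z"
  let ?X = "\<integral>\<^sup>+z. ?g z \<partial>?M"
  interpret ps: pair_sigma_finite "lborel :: (real \<times> real) measure" ?M ..
  have [measurable]: "fst \<in> borel_measurable (borel :: (real \<times> real) measure)"
    "snd \<in> borel_measurable (borel :: (real \<times> real) measure)"
    by (intro borel_measurable_continuous_onI continuous_intros)+
  have [measurable]: "cball 0 r \<in> sets (borel :: (real^'n) measure)" for r by simp
  have g [measurable]: "?g \<in> borel_measurable borel" by measurable
  have id [measurable]: "(\<lambda>x. x) \<in> borel_measurable ?M" by (rule measurable_perp) simp
  have snd [measurable]: "snd \<in> borel_measurable ((lborel :: (real \<times> real) measure) \<Otimes>\<^sub>M ?M)"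
    using measurable_compose[OF measurable_snd id] by simp
  have trans: "(\<integral>\<^sup>+z. ?g (z + (s *\<^sub>R a + t *\<^sub>R b)) \<partial>?M) = ?X" for s t
    by (rule nn_integral_perp_translate[OF _ g]) (use a b in \<open>auto simp: mem_orthogonal_comp_singleton inner_left_distrib\<close>)
  have one: "(\<integral>\<^sup>+p. ?I (fst p) * ?I (snd p) \<partial>(lborel :: (real \<times> real) measure)) = 1"
  proof -
    have "(\<integral>\<^sup>+p. ?I (fst p) * ?I (snd p) \<partial>(lborel :: (real \<times> real) measure)) = (\<integral>\<^sup>+s. \<integral>\<^sup>+t. ?I s * ?I t \<partial>lborel \<partial>lborel)"
      by (subst lborel_prod[symmetric], subst lborel.nn_integral_fst[symmetric]) auto
    also have "\<dots> = 1" by (simp add: nn_integral_cmult)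
    finally show ?thesis .
  qed
  have "?X = (\<integral>\<^sup>+p. ?I (fst p) * ?I (snd p) * ?X \<partial>(lborel :: (real \<times> real) measure))"
    by (subst nn_integral_multc) (auto simp: one)
  also have "\<dots> = (\<integral>\<^sup>+p. \<integral>\<^sup>+z. ?I (fst p) * ?I (snd p) * ?g (z + (fst p *\<^sub>R a + snd p *\<^sub>R b)) \<partial>?M \<partial>(lborel :: (real \<times> real) measure))"
  proof (rule nn_integral_cong)
    fix p :: "real \<times> real"
    have "(\<lambda>z. ?g (z + (fst p *\<^sub>R a + snd p *\<^sub>R b))) \<in> borel_measurable ?M"
      by (rule measurable_perp) measurable
    then show "?I (fst p) * ?I (snd p) * ?X = (\<integral>\<^sup>+z. ?I (fst p) * ?I (snd p) * ?g (z + (fst p *\<^sub>R a + snd p *\<^sub>R b)) \<partial>?M)"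
      by (subst nn_integral_cmult) (simp_all add: trans)
  qed
  also have "\<dots> \<le> (\<integral>\<^sup>+p. \<integral>\<^sup>+z. indicator (cball 0 (R + 2)) z * (?I (fst p) * ?I (snd p) * h (z + fst p *\<^sub>R a + snd p *\<^sub>R b)) \<partial>?M \<partial>(lborel :: (real \<times> real) measure))"
  proof (intro nn_integral_mono)
    fix p :: "real \<times> real" and z
    \<comment> \<open>The translation vector is a sum of two vectors of norm at most 1, whence the
      enlargement of the radius by 2.\<close>
    have "z \<in> cball 0 (R + 2)" if "fst p \<in> {0..1}" "snd p \<in> {0..1}" "z + (fst p *\<^sub>R a + snd p *\<^sub>R b) \<in> cball 0 R"
    proof -
      have "norm (fst p *\<^sub>R a) \<le> 1" "norm (snd p *\<^sub>R b) \<le> 1"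
        using that a b by (auto intro: mult_le_one)
      moreover have "z = (z + (fst p *\<^sub>R a + snd p *\<^sub>R b)) - fst p *\<^sub>R a - snd p *\<^sub>R b" by simp
      ultimately have "norm z \<le> norm (z + (fst p *\<^sub>R a + snd p *\<^sub>R b)) + 1 + 1"
        by (smt (verit) norm_triangle_ineq4)
      then show ?thesis using that(3) by simp
    qed
    then show "?I (fst p) * ?I (snd p) * ?g (z + (fst p *\<^sub>R a + snd p *\<^sub>R b)) \<le>
      indicator (cball 0 (R + 2)) z * (?I (fst p) * ?I (snd p) * h (z + fst p *\<^sub>R a + snd p *\<^sub>R b))"
      by (auto simp: indicator_def add.assoc split: if_splits)
  qed
  also have "\<dots> = (\<integral>\<^sup>+z. \<integral>\<^sup>+p. indicator (cball 0 (R + 2)) z * (?I (fst p) * ?I (snd p) * h (z + fst p *\<^sub>R a + snd p *\<^sub>R b)) \<partial>(lborel :: (real \<times> real) measure) \<partial>?M)"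
    by (rule ps.Fubini'[symmetric]) (simp add: case_prod_beta)
  also have "\<dots> \<le> (\<integral>\<^sup>+z. indicator (cball 0 (R + 2)) z * K \<partial>?M)"
  proof (rule nn_integral_mono)
    fix z
    have "(\<integral>\<^sup>+p. ?I (fst p) * ?I (snd p) * h (z + fst p *\<^sub>R a + snd p *\<^sub>R b) \<partial>(lborel :: (real \<times> real) measure)) =
      (\<integral>\<^sup>+s. \<integral>\<^sup>+t. ?I s * ?I t * h (z + s *\<^sub>R a + t *\<^sub>R b) \<partial>lborel \<partial>lborel)"
      by (subst lborel_prod[symmetric], subst lborel.nn_integral_fst[symmetric]) auto
    also have "\<dots> = (\<integral>\<^sup>+s. (\<integral>\<^sup>+t. h (z + s *\<^sub>R a + t *\<^sub>R b) * ?I t \<partial>lborel) * ?I s \<partial>lborel)"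
      by (subst nn_integral_multc[symmetric]) (auto simp: mult_ac)
    also have "\<dots> \<le> K" by (rule K)
    finally show "(\<integral>\<^sup>+p. indicator (cball 0 (R + 2)) z * (?I (fst p) * ?I (snd p) * h (z + fst p *\<^sub>R a + snd p *\<^sub>R b)) \<partial>(lborel :: (real \<times> real) measure)) \<le> indicator (cball 0 (R + 2)) z * K"
      by (subst nn_integral_cmult) (auto intro: mult_left_mono)
  qed
  also have "\<dots> = ball_volume (R + 2) * K"
    by (subst nn_integral_multc) (auto simp: nn_integral_perp_ball intro: measurable_perp)
  finally show ?thesis .
qed

end

section \<open>Integrating out one vector while at least three are free\<close>

locale charted_basis = hyperplane_chart u L + hyperplane_basis u B
  for u :: "real^'n" and L B
begin

text \<open>Candidates for completing the vectors y_j with j \<in> J to a square matrix by basis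
  vectors. Repetitions are allowed: such a filling may only contribute a zero determinant, and the
  set stays closed under changing a single value.\<close>

definition fillings :: "('n \<Rightarrow> real^'n) set" where
  "fillings = Pi\<^sub>E UNIV (\<lambda>_. insert u B)"

lemma finite_fillings: "finite fillings"
  unfolding fillings_def using finite_B by (intro finite_PiE) auto

lemma fillings_iff: "f \<in> fillings \<longleftrightarrow> (\<forall>i. f i \<in> insert u B)"
  by (simp add: fillings_def PiE_iff)

lemma e_filling: "e \<in> fillings"
  using e_in by (simp add: fillings_iff)

text \<open>Up to constants, the volume of the parallelotope spanned by \<open>u\<close> and the \<open>y j\<close> with \<open>j \<in> J\<close>.\<close>

definition partial_volume :: "'n set \<Rightarrow> ('n \<Rightarrow> real^'n) \<Rightarrow> real" where
  "partial_volume J y = (\<Sum>f\<in>fillings. \<bar>row_det (\<lambda>i. if i \<in> J then y i else f i)\<bar>)"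

lemma le_partial_volume: "f \<in> fillings \<Longrightarrow> \<bar>row_det (\<lambda>i. if i \<in> J then y i else f i)\<bar> \<le> partial_volume J y"
  unfolding partial_volume_def by (rule member_le_sum) (auto simp: finite_fillings)

lemma partial_volume_empty_ge_1: "1 \<le> partial_volume {} y"
proof -
  have "orthogonal_matrix (\<chi> i. e i)"
    unfolding orthogonal_matrix_orthonormal_rows
    using e_orthonormal by (simp add: row_def vec_nth_inverse orthogonal_def norm_eq_1)
  then have "\<bar>row_det e\<bar> = 1" using det_orthogonal_matrix[of "\<chi> i. e i"] by (auto simp: row_det_def)
  then show ?thesis using le_partial_volume[OF e_filling, of "{}" y] by simp
qed

lemma exists_large_filling:
  assumes "0 < partial_volume J y"
  obtains f where "f \<in> fillings" "0 < \<bar>row_det (\<lambda>i. if i \<in> J then y i else f i)\<bar>"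
    "partial_volume J y \<le> real (card fillings) * \<bar>row_det (\<lambda>i. if i \<in> J then y i else f i)\<bar>"
proof -
  let ?g = "\<lambda>f. \<bar>row_det (\<lambda>i. if i \<in> J then y i else f i)\<bar>"
  have fin: "finite (?g ` fillings)" "?g ` fillings \<noteq> {}" using finite_fillings e_filling by auto
  have "Max (?g ` fillings) \<in> ?g ` fillings" by (rule Max_in[OF fin])
  then obtain f where f: "f \<in> fillings" "Max (?g ` fillings) = ?g f" by (rule imageE)
  have le: "partial_volume J y \<le> real (card fillings) * ?g f"
    unfolding partial_volume_def
  proof (rule sum_bounded_above)
    fix h assume "h \<in> fillings"
    then have "?g h \<le> Max (?g ` fillings)" by (intro Max_ge fin imageI)
    then show "?g h \<le> ?g f" by (simp only: f(2))
  qed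
  have "0 < ?g f"
  proof (rule ccontr)
    assume "\<not> 0 < ?g f"
    then have "?g f = 0" by simp
    then show False using le assms by simp
  qed
  then show ?thesis using le by (rule that[OF f(1)])
qed

lemma measurable_partial_volume:
  assumes "\<And>i. i \<in> J \<Longrightarrow> (\<lambda>x. y x i) \<in> borel_measurable N"
  shows "(\<lambda>x. partial_volume J (y x)) \<in> borel_measurable N"
proof -
  have "(\<lambda>x. if i \<in> J then y x i else f i) \<in> borel_measurable N" for i and f :: "'n \<Rightarrow> real^'n"
    using assms by (cases "i \<in> J") auto
  then have [measurable]: "(\<lambda>x. row_det (\<lambda>i. if i \<in> J then y x i else f i)) \<in> borel_measurable N" for f
    by (intro measurable_row_det) auto
  show ?thesis unfolding partial_volume_def by measurable
qed

lemma B_in_perp: "b \<in> B \<Longrightarrow> b \<in> {u}\<^sup>\<bottom>" "b \<in> B \<Longrightarrow> norm b \<le> 1"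
  using B_perp B by (auto simp: mem_orthogonal_comp_singleton orthonormal_basis_def)

text \<open>Only vectors of \<open>B\<close> are admissible directions of translation in the
  hyperplane. In a filling with nonzero determinant \<open>u\<close> occurs at most once outside
  \<open>J\<close>. If it sits at \<open>j\<close>, it is exchanged with another free place; a third
  free place guarantees that besides \<open>j\<close> some place \<open>k\<close> carries a vector
  of \<open>B\<close>.\<close>

lemma exists_good_filling:
  assumes V: "0 < partial_volume J y" and j: "j \<notin> J" and c: "3 \<le> card (- J)"
  obtains f k where "f \<in> fillings" "0 < \<bar>row_det (\<lambda>i. if i \<in> J then y i else f i)\<bar>"
    "partial_volume J y \<le> real (card fillings) * \<bar>row_det (\<lambda>i. if i \<in> J then y i else f i)\<bar>"
    "k \<notin> J" "k \<noteq> j" "f j \<in> B" "f k \<in> B"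
proof -
  let ?r = "\<lambda>f i. if i \<in> J then y i else f i"
  obtain f where f: "f \<in> fillings" "0 < \<bar>row_det (?r f)\<bar>" "partial_volume J y \<le> real (card fillings) * \<bar>row_det (?r f)\<bar>"
    by (rule exists_large_filling[OF V])
  have uniq: "\<not> (g i = u \<and> g l = u)" if "i \<notin> J" "l \<notin> J" "i \<noteq> l" "0 < \<bar>row_det (?r g)\<bar>" for g i l
    using row_det_eq_0[of i l "?r g"] that by auto
  have "\<not> - J \<subseteq> {j, l}" for l
  proof
    assume "- J \<subseteq> {j, l}"
    then have "card (- J) \<le> card {j, l}" by (intro card_mono) auto
    also have "\<dots> \<le> 2" by (cases "j = l") auto
    finally show False using c by simp
  qed
  then have third: "\<exists>k. k \<notin> J \<and> k \<noteq> j \<and> k \<noteq> l" for l by blast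
  define p where "p = (SOME k. k \<notin> J \<and> k \<noteq> j)"
  have p: "p \<notin> J" "p \<noteq> j" using someI_ex[of "\<lambda>k. k \<notin> J \<and> k \<noteq> j"] third[of j] by (auto simp: p_def)
  define g where "g = (if f j = u then f(j := f p, p := f j) else f)"
  have "?r (f(j := f p, p := f j)) = (?r f)(j := f p, p := f j)" "(?r f)(j := f j, p := f p) = ?r f"
    using j p by (auto simp: fun_eq_iff)
  then have row_det_g: "\<bar>row_det (?r g)\<bar> = \<bar>row_det (?r f)\<bar>"
    using abs_row_det_swap[of j p "?r f" "f p" "f j"] p unfolding g_def by auto
  have gF: "g \<in> fillings" using f(1) by (auto simp: g_def fillings_iff)
  have "g j \<noteq> u" using uniq[of j p f] p j f(2) by (auto simp: g_def)
  then have gj: "g j \<in> B" using gF by (auto simp: fillings_iff)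
  obtain k where k: "k \<notin> J" "k \<noteq> j" "g k \<noteq> u"
  proof (cases "g p = u")
    case True
    obtain l where l: "l \<notin> J" "l \<noteq> j" "l \<noteq> p" using third[of p] by blast
    have "g l \<noteq> u" using uniq[of l p g] l p True row_det_g f(2) by auto
    then show ?thesis using that[of l] l by simp
  next
    case False
    then show ?thesis using that[of p] p by simp
  qed
  then have "g k \<in> B" using gF by (auto simp: fillings_iff)
  then show ?thesis using that[OF gF _ _ k(1,2) gj] row_det_g f by simp
qed

lemma inverse_le_of_large:
  assumes "V \<le> N * A" "0 < A" "0 < V" "0 \<le> N"
  shows "inverse (ennreal A) \<le> ennreal N * inverse (ennreal V)"
proof -
  have "inverse A \<le> N * inverse V" using assms by (simp add: field_simps)
  then show ?thesis
    using assms by (simp add: inverse_ennreal ennreal_leI flip: ennreal_mult)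
qed

text \<open>The summand \<open>1\<close> makes the bounds below hold also when their right-hand side is infinite.\<close>

definition peel_const :: "real \<Rightarrow> ennreal" where
  "peel_const R = ball_volume (R + 2) * (25 * ennreal (real (card fillings))) + 1"

lemma peel_const_finite: "peel_const R < \<infinity>"
  using ball_volume_finite[of "R + 2"] by (simp add: peel_const_def ennreal_mult_less_top ennreal_add_less_top)

lemma peel_const_ge: "ball_volume (R + 2) * (25 * (ennreal (real (card fillings)) * x)) \<le> peel_const R * x"
  by (simp add: peel_const_def distrib_right mult.assoc)

lemma peel_const_top: "peel_const R * top = top"
  by (simp add: peel_const_def distrib_right)

text \<open>Let \<open>a\<close> and \<open>b\<close> be the vectors of the filling at
  \<open>j\<close> and \<open>k\<close>. \<open>G\<close> puts \<open>z\<close> in place of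
  \<open>a\<close>: it is constant in direction \<open>b\<close>, which would be repeated, and has
  slope \<open>row_det r\<close> in direction \<open>a\<close>. \<open>H\<close> also moves
  \<open>a\<close> to \<open>k\<close>: it is constant in direction \<open>a\<close> and has the
  same slope, up to sign, in direction \<open>b\<close>. The average over translations is thus a
  product of two one-dimensional integrals, each with constant 5, which explains the 25.\<close>

lemma nn_integral_peel:
  assumes j: "j \<notin> J" and c: "3 \<le> card (- J)"
  shows "(\<integral>\<^sup>+z. indicator (cball 0 R) z * inverse (ennreal (partial_volume (insert j J) (y(j := z)))) \<partial>perp_measure u)
    \<le> peel_const R * inverse (ennreal (partial_volume J y))"
proof (cases "0 < partial_volume J y")
  case True
  let ?r = "\<lambda>f i. if i \<in> J then y i else f i"
  obtain f k where f: "f \<in> fillings" "0 < \<bar>row_det (?r f)\<bar>" "partial_volume J y \<le> real (card fillings) * \<bar>row_det (?r f)\<bar>"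
    and k: "k \<notin> J" "k \<noteq> j" "f j \<in> B" "f k \<in> B"
    by (rule exists_good_filling[OF True j c])
  define a where "a = f j"
  define b where "b = f k"
  define r where "r = ?r f"
  define G where "G z = row_det (r(j := z))" for z
  define H where "H z = row_det (r(k := a, j := z))" for z
  have rj: "r(j := a) = r" "r k = b" using j k by (auto simp: r_def a_def b_def)
  have V1: "\<bar>G z\<bar> \<le> partial_volume (insert j J) (y(j := z))" for z
  proof -
    have "(\<lambda>i. if i \<in> insert j J then (y(j := z)) i else f i) = r(j := z)" by (auto simp: r_def fun_eq_iff)
    then show ?thesis using le_partial_volume[OF f(1), of "insert j J" "y(j := z)"] by (simp add: G_def)
  qed
  have V2: "\<bar>H z\<bar> \<le> partial_volume (insert j J) (y(j := z))" for z
  proof -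
    have F: "f(k := a) \<in> fillings" using f(1) k by (auto simp: fillings_iff a_def)
    have "(\<lambda>i. if i \<in> insert j J then (y(j := z)) i else (f(k := a)) i) = r(k := a, j := z)"
      using k by (auto simp: r_def fun_eq_iff)
    then show ?thesis using le_partial_volume[OF F, of "insert j J" "y(j := z)"] by (simp add: H_def)
  qed
  have G: "G (z + s *\<^sub>R a + t *\<^sub>R b) = G z + s * row_det r" for z s t
  proof -
    have "row_det (r(j := b)) = 0" using row_det_eq_0[of j k "r(j := b)"] k rj by simp
    then show ?thesis by (simp add: G_def row_det_add row_det_scale rj)
  qed
  define d where "d = row_det (r(k := a, j := b))"
  have d: "\<bar>d\<bar> = \<bar>row_det r\<bar>"
    using abs_row_det_swap[of j k r b a] k rj unfolding d_def by (simp add: fun_upd_twist fun_upd_idem)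
  have H: "H (z + s *\<^sub>R a + t *\<^sub>R b) = H z + t * d" for z s t
  proof -
    have "row_det (r(k := a, j := a)) = 0" using row_det_eq_0[of j k "r(k := a, j := a)"] k by simp
    then show ?thesis by (simp add: H_def row_det_add row_det_scale d_def)
  qed
  have ne: "row_det r \<noteq> 0" "d \<noteq> 0" using f(2) d by (auto simp: r_def)
  have GH [measurable]: "G \<in> borel_measurable borel" "H \<in> borel_measurable borel"
    unfolding G_def H_def by (intro measurable_row_det; auto)+
  have "(\<integral>\<^sup>+z. indicator (cball 0 R) z * inverse (ennreal (partial_volume (insert j J) (y(j := z)))) \<partial>perp_measure u)
    \<le> (\<integral>\<^sup>+z. indicator (cball 0 R) z * (inv_sqrt (G z) * inv_sqrt (H z)) \<partial>perp_measure u)"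
    by (intro nn_integral_mono mult_left_mono inverse_le_inv_sqrt_mult V1 V2) simp
  also have "\<dots> \<le> ball_volume (R + 2) * (25 * inverse (ennreal \<bar>row_det r\<bar>))"
  proof (rule nn_integral_perp_average)
    show "a \<in> {u}\<^sup>\<bottom>" "norm a \<le> 1" "b \<in> {u}\<^sup>\<bottom>" "norm b \<le> 1"
      using B_in_perp k by (auto simp: a_def b_def)
    fix z
    have "(\<integral>\<^sup>+s. (\<integral>\<^sup>+t. inv_sqrt (G (z + s *\<^sub>R a + t *\<^sub>R b)) * inv_sqrt (H (z + s *\<^sub>R a + t *\<^sub>R b)) * indicator {0..1} t \<partial>lborel) * indicator {0..1} s \<partial>lborel)
      = (\<integral>\<^sup>+s. inv_sqrt (G z + s * row_det r) * indicator {0..1} s * (\<integral>\<^sup>+t. inv_sqrt (H z + t * d) * indicator {0..1} t \<partial>lborel) \<partial>lborel)"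
      unfolding G H by (intro nn_integral_cong) (simp add: mult.assoc nn_integral_cmult, simp add: mult_ac)
    also have "\<dots> = (\<integral>\<^sup>+s. inv_sqrt (G z + s * row_det r) * indicator {0..1} s \<partial>lborel) * (\<integral>\<^sup>+t. inv_sqrt (H z + t * d) * indicator {0..1} t \<partial>lborel)"
      by (rule nn_integral_multc) measurable
    also have "\<dots> \<le> (5 * inv_sqrt (row_det r)) * (5 * inv_sqrt d)"
      by (intro mult_mono nn_integral_inv_sqrt_affine ne) auto
    also have "\<dots> = 25 * (inv_sqrt (row_det r) * inv_sqrt (row_det r))"
    proof -
      have "inv_sqrt d = inv_sqrt (row_det r)" using d by (simp add: inv_sqrt_def)
      moreover have "(5 * x) * (5 * x) = 25 * (x * x)" for x :: ennreal
      proof -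
        have "(5 * x) * (5 * x) = (5 * 5) * (x * x)" by (simp only: mult_ac)
        then show ?thesis by simp
      qed
      ultimately show ?thesis by simp
    qed
    also have "\<dots> = 25 * inverse (ennreal \<bar>row_det r\<bar>)" by (simp add: inv_sqrt_square)
    finally show "(\<integral>\<^sup>+s. (\<integral>\<^sup>+t. inv_sqrt (G (z + s *\<^sub>R a + t *\<^sub>R b)) * inv_sqrt (H (z + s *\<^sub>R a + t *\<^sub>R b)) * indicator {0..1} t \<partial>lborel) * indicator {0..1} s \<partial>lborel)
      \<le> 25 * inverse (ennreal \<bar>row_det r\<bar>)" .
  qed measurable
  also have "\<dots> \<le> ball_volume (R + 2) * (25 * (real (card fillings) * inverse (ennreal (partial_volume J y))))"
    using f True by (intro mult_left_mono inverse_le_of_large) (auto simp: r_def)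
  also have "\<dots> \<le> peel_const R * inverse (ennreal (partial_volume J y))" by (rule peel_const_ge)
  finally show ?thesis .
next
  case False
  then have "ennreal (partial_volume J y) = 0" by (simp add: ennreal_neg)
  then show ?thesis by (simp add: peel_const_top)
qed

end

section \<open>Integrating out all vectors, the last two jointly\<close>

context charted_basis
begin

text \<open>The measurable version of \<open>Delta B (row_of y)\<close>; \<open>row_det (y(k := u))\<close> is a maximal minor of the rows, up to sign.\<close>

definition minor_norm :: "('n \<Rightarrow> real^'n) \<Rightarrow> real" where
  "minor_norm y = sqrt (\<Sum>k\<in>UNIV. (row_det (y(k := u)))\<^sup>2)"

lemma abs_minor_le: "\<bar>row_det (y(k := u))\<bar> \<le> minor_norm y"
proof -
  have "(row_det (y(k := u)))\<^sup>2 \<le> (\<Sum>k\<in>UNIV. (row_det (y(k := u)))\<^sup>2)"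
    by (rule member_le_sum) auto
  then have "sqrt ((row_det (y(k := u)))\<^sup>2) \<le> minor_norm y"
    unfolding minor_norm_def by (rule real_sqrt_le_mono)
  then show ?thesis by simp
qed

lemma minor_norm_nonneg: "0 \<le> minor_norm y"
  by (simp add: minor_norm_def sum_nonneg)

lemma row_det_perp_eq_0: "(\<And>i. y i \<in> {u}\<^sup>\<bottom>) \<Longrightarrow> row_det y = 0"
  unfolding row_det_def using u by (intro det_rows_eq_0[of y u]) (auto simp: mem_orthogonal_comp_singleton)

lemma Delta_row_of_eq_minor_norm:
  assumes y: "\<And>i. y i \<in> {u}\<^sup>\<bottom>" and t: "unit_dependency y t"
  shows "Delta B (row_of y) = minor_norm y"
proof -
  have "det (\<chi> i. y i + axis k 1 $ i *\<^sub>R u) = row_det (y(k := u))" for k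
  proof -
    have "(\<lambda>i. y i + axis k 1 $ i *\<^sub>R u) = y(k := y k + u)" by (auto simp: axis_def)
    then have "det (\<chi> i. y i + axis k 1 $ i *\<^sub>R u) = row_det (y(k := y k + u))" by (simp only: row_det_def)
    also have "\<dots> = row_det (y(k := y k)) + row_det (y(k := u))" by (rule row_det_add)
    finally show ?thesis using row_det_perp_eq_0[OF y] by simp
  qed
  then show ?thesis unfolding Delta_row_of_eq_sqrt[OF y t] minor_norm_def by simp
qed

lemma measurable_minor_norm:
  assumes "\<And>i. (\<lambda>x. y x i) \<in> borel_measurable N"
  shows "(\<lambda>x. minor_norm (y x)) \<in> borel_measurable N"
proof -
  have "(\<lambda>x. ((y x)(k := u)) i) \<in> borel_measurable N" for i k
    using assms by (cases "i = k") auto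
  then have [measurable]: "(\<lambda>x. row_det ((y x)(k := u))) \<in> borel_measurable N" for k
    by (rule measurable_row_det)
  show ?thesis unfolding minor_norm_def by measurable
qed

text \<open>The product form lets one factor be split off together with each integrated
  vector.\<close>

definition ball_weight :: "real \<Rightarrow> 'n set \<Rightarrow> ('n \<Rightarrow> real^'n) \<Rightarrow> ennreal" where
  "ball_weight R J y = (\<Prod>i\<in>J. indicator (cball 0 R) (y i))"

lemma measurable_PiM_perp_component':
  assumes "i \<in> J"
  shows "(\<lambda>y. y i) \<in> borel_measurable (\<Pi>\<^sub>M i\<in>J. perp_measure u)"
proof (rule measurable_compose)
  show "(\<lambda>y. y i) \<in> measurable (\<Pi>\<^sub>M i\<in>J. perp_measure u) (perp_measure u)"
    using measurable_component_singleton[OF assms, of "\<lambda>_. perp_measure u"] by simp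
  show "(\<lambda>x. x) \<in> borel_measurable (perp_measure u)" by (rule measurable_perp) simp
qed

lemma measurable_ball_weight [measurable]: "ball_weight R J \<in> borel_measurable (\<Pi>\<^sub>M i\<in>J. perp_measure u)"
proof -
  have "(\<lambda>y. indicator (cball 0 R) (y i) :: ennreal) \<in> borel_measurable (\<Pi>\<^sub>M i\<in>J. perp_measure u)" if "i \<in> J" for i
    by (rule measurable_compose[OF measurable_PiM_perp_component'[OF that]])
      (rule borel_measurable_indicator, simp)
  then show ?thesis unfolding ball_weight_def by (intro borel_measurable_prod_ennreal)
qed

lemma ball_weight_eq_indicator:
  assumes "finite J" shows "ball_weight R J y = indicator {y. \<forall>i\<in>J. y i \<in> cball 0 R} y"
proof (cases "\<forall>i\<in>J. y i \<in> cball 0 R")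
  case True
  then have "ball_weight R J y = 1" unfolding ball_weight_def by (intro prod.neutral) simp
  then show ?thesis using True by simp
next
  case False
  then obtain i where "i \<in> J" "y i \<notin> cball 0 R" by blast
  then have "ball_weight R J y = 0" unfolding ball_weight_def using assms by (intro prod_zero bexI[of _ i]) auto
  then show ?thesis using False by (simp only: indicator_simps mem_Collect_eq not_False_eq_True)
qed

lemma ball_weight_insert: "finite J \<Longrightarrow> j \<notin> J \<Longrightarrow> ball_weight R (insert j J) (y(j := z)) = ball_weight R J y * indicator (cball 0 R) z"
proof -
  assume J: "finite J" "j \<notin> J"
  have "(\<Prod>i\<in>J. indicator (cball 0 R) ((y(j := z)) i)) = (\<Prod>i\<in>J. indicator (cball 0 R) (y i) :: ennreal)"
    using J by (intro prod.cong) auto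
  then show ?thesis unfolding ball_weight_def prod.insert[OF J] fun_upd_same by (simp only: mult.commute)
qed

lemma partial_volume_measurable_PiM [measurable]:
  "(\<lambda>y. inverse (ennreal (partial_volume J y))) \<in> borel_measurable (\<Pi>\<^sub>M i\<in>J. perp_measure u)"
proof -
  have [measurable]: "(\<lambda>y. partial_volume J y) \<in> borel_measurable (\<Pi>\<^sub>M i\<in>J. perp_measure u)"
    by (rule measurable_partial_volume) (rule measurable_PiM_perp_component')
  show ?thesis by measurable
qed

text \<open>Induction on \<open>J\<close>, removing one vector by \<open>nn_integral_peel\<close>.
  Two places free after the insertion mean three free before it, as peeling requires; at the empty
  set the integrand is at most 1, since the filling \<open>e\<close> has determinant 1 or
  -1.\<close>

lemma nn_integral_inverse_partial_volume:
  assumes "finite J" "2 \<le> card (- J)"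
  shows "(\<integral>\<^sup>+y. ball_weight R J y * inverse (ennreal (partial_volume J y)) \<partial>(\<Pi>\<^sub>M i\<in>J. perp_measure u)) < \<infinity>"
  using assms
proof (induction J)
  case empty
  have "ball_weight R {} y * inverse (ennreal (partial_volume {} y)) \<le> 1" for y
    using ennreal_inverse_antimono[of 1 "ennreal (partial_volume {} y)"] partial_volume_empty_ge_1[of y]
    by (simp add: ball_weight_def ennreal_ge_1)
  then have "(\<integral>\<^sup>+y. ball_weight R {} y * inverse (ennreal (partial_volume {} y)) \<partial>(\<Pi>\<^sub>M i\<in>{}. perp_measure u))
    \<le> (\<integral>\<^sup>+y. 1 \<partial>(\<Pi>\<^sub>M i\<in>({} :: 'n set). perp_measure u))"
    by (intro nn_integral_mono)
  also have "\<dots> < \<infinity>" by (simp add: PiM_empty emeasure_count_space)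
  finally show ?case .
next
  case (insert j J)
  have c: "3 \<le> card (- J)"
  proof -
    have "- J = insert j (- insert j J)" using insert.hyps by auto
    then have "card (- J) = Suc (card (- insert j J))" by (metis Compl_iff card_insert_disjoint finite insertI1)
    then show ?thesis using insert.prems by simp
  qed
  have "(\<integral>\<^sup>+y. ball_weight R (insert j J) y * inverse (ennreal (partial_volume (insert j J) y)) \<partial>(\<Pi>\<^sub>M i\<in>insert j J. perp_measure u))
    = (\<integral>\<^sup>+x. \<integral>\<^sup>+z. ball_weight R (insert j J) (x(j := z)) * inverse (ennreal (partial_volume (insert j J) (x(j := z)))) \<partial>perp_measure u \<partial>(\<Pi>\<^sub>M i\<in>J. perp_measure u))"
    using insert.hyps by (intro perps.product_nn_integral_insert) measurable
  also have "\<dots> \<le> (\<integral>\<^sup>+x. peel_const R * (ball_weight R J x * inverse (ennreal (partial_volume J x))) \<partial>(\<Pi>\<^sub>M i\<in>J. perp_measure u))"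
  proof (rule nn_integral_mono)
    fix x
    have m: "(\<lambda>z. indicator (cball 0 R) z * inverse (ennreal (partial_volume (insert j J) (x(j := z))))) \<in> borel_measurable (perp_measure u)"
    proof (rule measurable_perp)
      have "(\<lambda>z. (x(j := z)) i) \<in> borel_measurable borel" for i by (cases "i = j") auto
      then have [measurable]: "(\<lambda>z. partial_volume (insert j J) (x(j := z))) \<in> borel_measurable borel"
        by (rule measurable_partial_volume)
      have [measurable]: "cball 0 R \<in> sets (borel :: (real^'n) measure)" by simp
      show "(\<lambda>z. indicator (cball 0 R) z * inverse (ennreal (partial_volume (insert j J) (x(j := z))))) \<in> borel_measurable borel"
        by measurable
    qed
    have "(\<integral>\<^sup>+z. ball_weight R (insert j J) (x(j := z)) * inverse (ennreal (partial_volume (insert j J) (x(j := z)))) \<partial>perp_measure u)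
      = ball_weight R J x * (\<integral>\<^sup>+z. indicator (cball 0 R) z * inverse (ennreal (partial_volume (insert j J) (x(j := z)))) \<partial>perp_measure u)"
      using m by (subst nn_integral_cmult[symmetric]) (auto simp: ball_weight_insert insert.hyps mult.assoc)
    also have "\<dots> \<le> ball_weight R J x * (peel_const R * inverse (ennreal (partial_volume J x)))"
      by (intro mult_left_mono nn_integral_peel insert.hyps c) simp
    finally show "(\<integral>\<^sup>+z. ball_weight R (insert j J) (x(j := z)) * inverse (ennreal (partial_volume (insert j J) (x(j := z)))) \<partial>perp_measure u)
      \<le> peel_const R * (ball_weight R J x * inverse (ennreal (partial_volume J x)))"
      by (simp only: mult_ac)
  qed
  also have "\<dots> = peel_const R * (\<integral>\<^sup>+x. ball_weight R J x * inverse (ennreal (partial_volume J x)) \<partial>(\<Pi>\<^sub>M i\<in>J. perp_measure u))"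
    by (rule nn_integral_cmult) measurable
  also have "\<dots> < \<infinity>"
    using insert.IH c peel_const_finite[of R] by (simp add: ennreal_mult_less_top)
  finally show ?case .
qed

text \<open>One square root needs only one direction of averaging, so the second translation vector
  is taken to be 0.\<close>

lemma nn_integral_inv_sqrt_row_det:
  assumes a: "a \<in> B" and ne: "row_det (r(k := a)) \<noteq> 0"
  shows "(\<integral>\<^sup>+z. indicator (cball 0 R) z * inv_sqrt (row_det (r(k := z))) \<partial>perp_measure u)
    \<le> ball_volume (R + 2) * (5 * inv_sqrt (row_det (r(k := a))))"
proof (rule nn_integral_perp_average[of a 0])
  show "a \<in> {u}\<^sup>\<bottom>" "norm a \<le> 1" using B_in_perp a by auto
  show "(0 :: real^'n) \<in> {u}\<^sup>\<bottom>" "norm (0 :: real^'n) \<le> 1" by (auto simp: mem_orthogonal_comp_singleton)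
  have [measurable]: "(\<lambda>z. row_det (r(k := z))) \<in> borel_measurable borel"
    by (intro measurable_row_det; auto)
  show "(\<lambda>z. inv_sqrt (row_det (r(k := z)))) \<in> borel_measurable borel" by measurable
  fix z
  have "(\<integral>\<^sup>+s. (\<integral>\<^sup>+t. inv_sqrt (row_det (r(k := z + s *\<^sub>R a + t *\<^sub>R 0))) * indicator {0..1} t \<partial>(lborel :: real measure)) * indicator {0..1} s \<partial>(lborel :: real measure))
    = (\<integral>\<^sup>+s. inv_sqrt (row_det (r(k := z)) + s * row_det (r(k := a))) * indicator {0..1} s \<partial>lborel)"
    by (simp add: row_det_add row_det_scale nn_integral_cmult)
  also have "\<dots> \<le> 5 * inv_sqrt (row_det (r(k := a)))" by (rule nn_integral_inv_sqrt_affine[OF ne])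
  finally show "(\<integral>\<^sup>+s. (\<integral>\<^sup>+t. inv_sqrt (row_det (r(k := z + s *\<^sub>R a + t *\<^sub>R 0))) * indicator {0..1} t \<partial>(lborel :: real measure)) * indicator {0..1} s \<partial>(lborel :: real measure))
    \<le> 5 * inv_sqrt (row_det (r(k := a)))" .
qed

definition peel_const2 :: "real \<Rightarrow> ennreal" where
  "peel_const2 R = (ball_volume (R + 2) * 5) * (ball_volume (R + 2) * 5) * ennreal (real (card fillings)) + 1"

lemma peel_const2_finite: "peel_const2 R < \<infinity>"
  using ball_volume_finite[of "R + 2"] by (simp add: peel_const2_def ennreal_mult_less_top ennreal_add_less_top)

text \<open>
  The last two vectors are peeled off together: once the others are fixed, the minors omitting
  \<open>y j\<close> and \<open>y k\<close> depend on one of the two vectors each.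
\<close>

lemma nn_integral_peel_last:
  assumes jk: "j \<noteq> k" and J: "J = UNIV - {j, k}" and y: "\<And>i. i \<in> J \<Longrightarrow> y i \<in> {u}\<^sup>\<bottom>"
  shows "(\<integral>\<^sup>+z'. \<integral>\<^sup>+z. (indicator (cball 0 R) z' * indicator (cball 0 R) z) * inverse (ennreal (minor_norm (y(k := z', j := z)))) \<partial>perp_measure u \<partial>perp_measure u)
    \<le> peel_const2 R * inverse (ennreal (partial_volume J y))"
proof (cases "0 < partial_volume J y")
  case True
  let ?r = "\<lambda>f i. if i \<in> J then y i else f i"
  let ?G = "\<lambda>z. row_det (y(k := u, j := z))" and ?H = "\<lambda>z'. row_det (y(j := u, k := z'))"
  obtain f where f: "f \<in> fillings" "0 < \<bar>row_det (?r f)\<bar>" "partial_volume J y \<le> real (card fillings) * \<bar>row_det (?r f)\<bar>"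
    by (rule exists_large_filling[OF True])
  have rf: "?r f = y(j := f j, k := f k)" using J by (auto simp: fun_eq_iff)
  \<comment> \<open>Exactly one of \<open>f j\<close> and \<open>f k\<close> is \<open>u\<close>:
    twice \<open>u\<close> would repeat a row, and without \<open>u\<close> all rows would lie in
    the hyperplane; both make the determinant 0. The other one is the direction \<open>a\<close>,
    valid for both minors because exchanging two rows changes only the sign.\<close>
  have "\<exists>a\<in>B. \<bar>row_det (y(k := u, j := a))\<bar> = \<bar>row_det (?r f)\<bar> \<and> \<bar>row_det (y(j := u, k := a))\<bar> = \<bar>row_det (?r f)\<bar>"
  proof -
    have "\<not> (f j = u \<and> f k = u)" using row_det_eq_0[OF jk, of "?r f"] f(2) J by auto
    moreover have "f j = u \<or> f k = u"
    proof (rule ccontr)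
      assume "\<not> ?thesis"
      then have "f j \<in> B" "f k \<in> B" using f(1) by (auto simp: fillings_iff)
      then have "?r f i \<in> {u}\<^sup>\<bottom>" for i using y B_in_perp J by auto
      then have "row_det (?r f) = 0" by (rule row_det_perp_eq_0)
      then show False using f(2) by simp
    qed
    ultimately consider "f j = u" "f k \<in> B" | "f k = u" "f j \<in> B" using f(1) by (auto simp: fillings_iff)
    then show ?thesis
    proof cases
      case 1
      then show ?thesis
        using abs_row_det_swap[OF jk, of y "f k" u] rf fun_upd_twist[OF jk, of y "f k" u] by (intro bexI[of _ "f k"]) auto
    next
      case 2
      then show ?thesis
        using abs_row_det_swap[OF jk, of y u "f j"] rf fun_upd_twist[OF jk, of y "f j" u] by (intro bexI[of _ "f j"]) auto
    qed
  qed
  then obtain a where a: "a \<in> B" "\<bar>?G a\<bar> = \<bar>row_det (?r f)\<bar>" "\<bar>?H a\<bar> = \<bar>row_det (?r f)\<bar>" by blast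
  then have ne: "?G a \<noteq> 0" "?H a \<noteq> 0" using f(2) by auto
  have GH [measurable]: "?G \<in> borel_measurable borel" "?H \<in> borel_measurable borel"
    by (intro measurable_row_det; auto)+
  have [measurable]: "cball 0 R \<in> sets (borel :: (real^'n) measure)" by simp
  have mG: "(\<lambda>z. indicator (cball 0 R) z * inv_sqrt (?G z)) \<in> borel_measurable (perp_measure u)"
    "(\<lambda>z. indicator (cball 0 R) z * inv_sqrt (?H z)) \<in> borel_measurable (perp_measure u)"
  proof -
    have "(\<lambda>z. indicator (cball 0 R) z * inv_sqrt (?G z)) \<in> borel_measurable borel"
      "(\<lambda>z. indicator (cball 0 R) z * inv_sqrt (?H z)) \<in> borel_measurable borel"
      by measurable
    then show "(\<lambda>z. indicator (cball 0 R) z * inv_sqrt (?G z)) \<in> borel_measurable (perp_measure u)"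
      "(\<lambda>z. indicator (cball 0 R) z * inv_sqrt (?H z)) \<in> borel_measurable (perp_measure u)"
      by (auto intro: measurable_perp)
  qed
  have le: "inverse (ennreal (minor_norm (y(k := z', j := z)))) \<le> inv_sqrt (?H z') * inv_sqrt (?G z)" for z z'
  proof (rule inverse_le_inv_sqrt_mult)
    have "y(k := z', j := z, j := u) = y(j := u, k := z')" "y(k := z', j := z, k := u) = y(k := u, j := z)"
      using jk by (auto simp: fun_eq_iff)
    then show "\<bar>?H z'\<bar> \<le> minor_norm (y(k := z', j := z))" "\<bar>?G z\<bar> \<le> minor_norm (y(k := z', j := z))"
      using abs_minor_le[of "y(k := z', j := z)" j] abs_minor_le[of "y(k := z', j := z)" k] by auto
  qed
  have "(\<integral>\<^sup>+z'. \<integral>\<^sup>+z. (indicator (cball 0 R) z' * indicator (cball 0 R) z) * inverse (ennreal (minor_norm (y(k := z', j := z)))) \<partial>perp_measure u \<partial>perp_measure u)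
    \<le> (\<integral>\<^sup>+z'. \<integral>\<^sup>+z. (indicator (cball 0 R) z' * inv_sqrt (?H z')) * (indicator (cball 0 R) z * inv_sqrt (?G z)) \<partial>perp_measure u \<partial>perp_measure u)"
  proof (intro nn_integral_mono)
    fix z' z
    have "(indicator (cball 0 R) z' * inv_sqrt (?H z')) * (indicator (cball 0 R) z * inv_sqrt (?G z)) =
      (indicator (cball 0 R) z' * indicator (cball 0 R) z) * (inv_sqrt (?H z') * inv_sqrt (?G z))"
      by (simp only: mult_ac)
    then show "(indicator (cball 0 R) z' * indicator (cball 0 R) z) * inverse (ennreal (minor_norm (y(k := z', j := z))))
      \<le> (indicator (cball 0 R) z' * inv_sqrt (?H z')) * (indicator (cball 0 R) z * inv_sqrt (?G z))"
      using mult_left_mono[OF le] by (simp only: zero_le)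
  qed
  also have "\<dots> = (\<integral>\<^sup>+z'. indicator (cball 0 R) z' * inv_sqrt (?H z') \<partial>perp_measure u) * (\<integral>\<^sup>+z. indicator (cball 0 R) z * inv_sqrt (?G z) \<partial>perp_measure u)"
    unfolding nn_integral_cmult[OF mG(1)] by (rule nn_integral_multc[OF mG(2)])
  also have "\<dots> \<le> (ball_volume (R + 2) * (5 * inv_sqrt (?H a))) * (ball_volume (R + 2) * (5 * inv_sqrt (?G a)))"
    by (intro mult_mono nn_integral_inv_sqrt_row_det a ne) auto
  also have "\<dots> = (ball_volume (R + 2) * 5) * (ball_volume (R + 2) * 5) * inverse (ennreal \<bar>row_det (?r f)\<bar>)"
  proof -
    have "inv_sqrt (?H a) = inv_sqrt (row_det (?r f))" "inv_sqrt (?G a) = inv_sqrt (row_det (?r f))"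
      using a unfolding inv_sqrt_def by simp_all
    then show ?thesis by (simp only: inv_sqrt_square[symmetric] mult_ac)
  qed
  also have "\<dots> \<le> (ball_volume (R + 2) * 5) * (ball_volume (R + 2) * 5) * (ennreal (real (card fillings)) * inverse (ennreal (partial_volume J y)))"
    using f True by (intro mult_left_mono inverse_le_of_large) auto
  also have "\<dots> \<le> peel_const2 R * inverse (ennreal (partial_volume J y))"
    by (simp add: peel_const2_def distrib_right mult.assoc)
  finally show ?thesis .
next
  case False
  then have "ennreal (partial_volume J y) = 0" by (simp add: ennreal_neg)
  then show ?thesis by (simp add: peel_const2_def distrib_right)
qed

theorem nn_integral_inverse_minor_norm:
  "(\<integral>\<^sup>+y. ball_weight R UNIV y * inverse (ennreal (minor_norm y)) \<partial>(\<Pi>\<^sub>M i\<in>UNIV. perp_measure u)) < \<infinity>"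
proof -
  obtain j k :: 'n where jk: "j \<noteq> k"
    using n by (metis card_2_iff' ex_card obtain_subset_with_card_n UNIV_I)
  define J where "J = UNIV - {j, k}"
  have fin: "finite J" "k \<notin> J" "j \<notin> insert k J" using jk by (auto simp: J_def)
  have U: "UNIV = insert j (insert k J)" by (auto simp: J_def)
  have "- J = {j, k}" by (auto simp: J_def)
  then have cJ: "2 \<le> card (- J)" using jk by simp
  let ?F = "\<lambda>y. ball_weight R UNIV y * inverse (ennreal (minor_norm y))"
  have [measurable]: "(\<lambda>y. minor_norm y) \<in> borel_measurable (\<Pi>\<^sub>M i\<in>UNIV. perp_measure u)"
    by (rule measurable_minor_norm) measurable
  have F: "?F \<in> borel_measurable (\<Pi>\<^sub>M i\<in>UNIV. perp_measure u)" by measurable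
  then have F': "?F \<in> borel_measurable (\<Pi>\<^sub>M i\<in>insert j (insert k J). perp_measure u)" using U by simp
  have F2: "(\<lambda>x. \<integral>\<^sup>+z. ?F (x(j := z)) \<partial>perp_measure u) \<in> borel_measurable (\<Pi>\<^sub>M i\<in>insert k J. perp_measure u)"
  proof (rule perp.borel_measurable_nn_integral)
    show "(\<lambda>(x, z). ?F (x(j := z))) \<in> borel_measurable ((\<Pi>\<^sub>M i\<in>insert k J. perp_measure u) \<Otimes>\<^sub>M perp_measure u)"
      using measurable_compose[OF measurable_add_dim[of j "insert k J" "\<lambda>_. perp_measure u"] F'] by (simp add: case_prod_beta)
  qed
  have "(\<integral>\<^sup>+y. ?F y \<partial>(\<Pi>\<^sub>M i\<in>UNIV. perp_measure u)) = (\<integral>\<^sup>+x. \<integral>\<^sup>+z. ?F (x(j := z)) \<partial>perp_measure u \<partial>(\<Pi>\<^sub>M i\<in>insert k J. perp_measure u))"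
    using perps.product_nn_integral_insert[OF _ fin(3) F'] fin(1) U by simp
  also have "\<dots> = (\<integral>\<^sup>+x. \<integral>\<^sup>+z'. \<integral>\<^sup>+z. ?F (x(k := z', j := z)) \<partial>perp_measure u \<partial>perp_measure u \<partial>(\<Pi>\<^sub>M i\<in>J. perp_measure u))"
    by (rule perps.product_nn_integral_insert[OF fin(1,2) F2])
  also have "\<dots> \<le> (\<integral>\<^sup>+x. peel_const2 R * (ball_weight R J x * inverse (ennreal (partial_volume J x))) \<partial>(\<Pi>\<^sub>M i\<in>J. perp_measure u))"
  proof (rule nn_integral_mono)
    fix x assume "x \<in> space (\<Pi>\<^sub>M i\<in>J. perp_measure u)"
    then have x: "x i \<in> {u}\<^sup>\<bottom>" if "i \<in> J" for i
      using that space_perp_measure by (auto simp: space_PiM PiE_iff)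
    have w: "?F (x(k := z', j := z)) = ball_weight R J x * ((indicator (cball 0 R) z' * indicator (cball 0 R) z) * inverse (ennreal (minor_norm (x(k := z', j := z)))))" for z z'
      unfolding U using fin by (simp add: ball_weight_insert mult.assoc)
    have "(\<integral>\<^sup>+z'. \<integral>\<^sup>+z. ?F (x(k := z', j := z)) \<partial>perp_measure u \<partial>perp_measure u) \<le>
      ball_weight R J x * (\<integral>\<^sup>+z'. \<integral>\<^sup>+z. (indicator (cball 0 R) z' * indicator (cball 0 R) z) * inverse (ennreal (minor_norm (x(k := z', j := z)))) \<partial>perp_measure u \<partial>perp_measure u)"
    proof -
      \<comment> \<open>Since the weight is 0 or 1, it leaves the double integral without any
        measurability argument for the inner integrands.\<close>
      have "ball_weight R J x = 0 \<or> ball_weight R J x = 1"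
        unfolding ball_weight_eq_indicator[OF fin(1)] by (simp add: indicator_def, blast)
      then show ?thesis unfolding w by auto
    qed
    also have "\<dots> \<le> ball_weight R J x * (peel_const2 R * inverse (ennreal (partial_volume J x)))"
      by (intro mult_left_mono nn_integral_peel_last jk J_def x) auto
    finally show "(\<integral>\<^sup>+z'. \<integral>\<^sup>+z. ?F (x(k := z', j := z)) \<partial>perp_measure u \<partial>perp_measure u) \<le> peel_const2 R * (ball_weight R J x * inverse (ennreal (partial_volume J x)))"
      by (simp only: mult_ac)
  qed
  also have "\<dots> = peel_const2 R * (\<integral>\<^sup>+x. ball_weight R J x * inverse (ennreal (partial_volume J x)) \<partial>(\<Pi>\<^sub>M i\<in>J. perp_measure u))"
    by (rule nn_integral_cmult) measurable
  also have "\<dots> < \<infinity>"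
    using nn_integral_inverse_partial_volume[OF fin(1) cJ, of R] peel_const2_finite[of R] by (simp add: ennreal_mult_less_top)
  finally show ?thesis .
qed

lemma measurable_minor_norm_PiM [measurable]: "minor_norm \<in> borel_measurable (\<Pi>\<^sub>M i\<in>UNIV. perp_measure u)"
  by (rule measurable_minor_norm) measurable

text \<open>A function with finite integral is finite almost everywhere, and the inverse of 0 is
  \<infinity>. Every \<open>y\<close> lies in some ball of natural radius, so countably many radii
  suffice.\<close>

lemma AE_minor_norm_pos: "AE y in (\<Pi>\<^sub>M i\<in>UNIV. perp_measure u). 0 < minor_norm y"
proof -
  have "AE y in (\<Pi>\<^sub>M i\<in>UNIV. perp_measure u). \<forall>R::nat. ball_weight R UNIV y * inverse (ennreal (minor_norm y)) \<noteq> \<infinity>"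
    unfolding AE_all_countable using nn_integral_inverse_minor_norm
    by (intro allI nn_integral_PInf_AE) (auto simp: less_top)
  then show ?thesis
  proof eventually_elim
    case (elim y)
    obtain R :: nat where R: "Max (range (\<lambda>i. norm (y i))) \<le> real R" using real_arch_simple by blast
    have "norm (y i) \<le> real R" for i using R by (intro order_trans[OF Max_ge R]) auto
    then have "ball_weight R UNIV y = 1" by (simp add: ball_weight_def)
    then have "ennreal (minor_norm y) \<noteq> 0" using spec[OF elim, of R] by auto
    then show ?case using minor_norm_nonneg[of y] by (simp add: less_le)
  qed
qed

end

section \<open>The limit\<close>

lemma epowr_pos: "0 < x \<Longrightarrow> epowr x p = ennreal (x powr p)"
  by (simp add: epowr_def)

lemma borel_measurable_epowr [measurable]: "(\<lambda>x. epowr x p) \<in> borel_measurable borel"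
  unfolding epowr_def by measurable

text \<open>The kernel (p + 1) / 2 |t|^p has mass d^(p + 1) on [-d, d], which tends to 1 for each
  fixed \<open>d\<close>. Away from 0 the factor p + 1 makes the contribution vanish, because
  \<open>f\<close> is bounded with bounded support. Continuity at 0 handles the values on
  [-d, d].\<close>

lemma nn_integral_powr_concentrates:
  fixes f :: "real \<Rightarrow> real"
  assumes f [measurable]: "f \<in> borel_measurable borel" and C: "\<And>t. 0 \<le> f t" "\<And>t. f t \<le> C"
    and T: "1 \<le> T" "\<And>t. T < \<bar>t\<bar> \<Longrightarrow> f t = 0" and cont: "isCont f 0"
    and p: "\<And>k. -1 < p k" "\<And>k. p k < 0" "p \<longlonglongrightarrow> -1"
  shows "(\<lambda>k. ennreal ((p k + 1) / 2) * (\<integral>\<^sup>+t. ennreal (\<bar>t\<bar> powr p k) * ennreal (f t) \<partial>lborel)) \<longlonglongrightarrow> ennreal (f 0)"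
proof -
  define I where "I k = ennreal ((p k + 1) / 2) * (\<integral>\<^sup>+t. ennreal (\<bar>t\<bar> powr p k) * ennreal (f t) \<partial>lborel)" for k
  have C0: "0 \<le> C" using C order_trans by blast
  have mean: "ennreal ((p k + 1) / 2) * (\<integral>\<^sup>+t. ennreal (\<bar>t\<bar> powr p k) * indicator {-d..d} t \<partial>lborel) = ennreal (d powr (p k + 1))"
    if "0 \<le> d" for d k
  proof -
    have "p k + 1 \<noteq> 0" using p(1)[of k] by simp
    then show ?thesis using p(1)[of k] that
      by (simp add: nn_integral_abs_powr ennreal_mult[symmetric] del: ennreal_half)
  qed
  \<comment> \<open>The last summand is (p + 1) / 2 times C / d times 2T, from the region d < |t|
    \<le> T. There |t|^p \<le> d^p \<le> 1 / d, where d \<le> 1 and -1 < p < 0 are used.\<close>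
  have upper: "I k \<le> ennreal ((f 0 + e) * d powr (p k + 1) + (p k + 1) * (C * T / d))"
    if d: "0 < d" "d \<le> 1" and e: "0 < e" and fd: "\<And>t. \<bar>t\<bar> \<le> d \<Longrightarrow> \<bar>f t - f 0\<bar> \<le> e" for d e k
  proof -
    have "ennreal (\<bar>t\<bar> powr p k) * ennreal (f t) \<le>
      ennreal (f 0 + e) * (ennreal (\<bar>t\<bar> powr p k) * indicator {-d..d} t) + ennreal (C / d) * indicator {-T..T} t" for t
    proof (cases "\<bar>t\<bar> \<le> d")
      case True
      from fd[OF this] have "f t \<le> f 0 + e" by linarith
      then have "ennreal (\<bar>t\<bar> powr p k) * ennreal (f t) \<le> ennreal (f 0 + e) * ennreal (\<bar>t\<bar> powr p k)"
        by (subst mult.commute) (intro mult_right_mono ennreal_leI, auto)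
      moreover have "t \<in> {-d..d}" using True by auto
      ultimately show ?thesis by (simp add: add_increasing2)
    next
      case False
      show ?thesis
      proof (cases "\<bar>t\<bar> \<le> T")
        case True
        have "\<bar>t\<bar> powr p k \<le> d powr p k" using False d p(2)[of k] by (intro powr_mono2') auto
        also have "\<dots> \<le> d powr (-1)" using d p(1)[of k] by (intro powr_mono') auto
        finally have "\<bar>t\<bar> powr p k * f t \<le> (1 / d) * C"
          using C(1)[of t] C(2)[of t] d by (intro mult_mono) (auto simp: powr_minus_divide)
        then have "ennreal (\<bar>t\<bar> powr p k) * ennreal (f t) \<le> ennreal (C / d)"
          using C by (subst ennreal_mult[symmetric]) (auto intro: ennreal_leI)
        moreover have "t \<in> {-T..T}" using True by auto
        ultimately show ?thesis by (simp add: add_increasing)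
      qed (simp add: T(2))
    qed
    then have "(\<integral>\<^sup>+t. ennreal (\<bar>t\<bar> powr p k) * ennreal (f t) \<partial>lborel) \<le>
      (\<integral>\<^sup>+t. ennreal (f 0 + e) * (ennreal (\<bar>t\<bar> powr p k) * indicator {-d..d} t) + ennreal (C / d) * indicator {-T..T} t \<partial>lborel)"
      by (intro nn_integral_mono)
    also have "\<dots> = ennreal (f 0 + e) * (\<integral>\<^sup>+t. ennreal (\<bar>t\<bar> powr p k) * indicator {-d..d} t \<partial>lborel) + ennreal (C / d) * ennreal (2 * T)"
      using T(1) by (subst nn_integral_add) (auto simp: nn_integral_cmult)
    finally have "I k \<le> ennreal ((p k + 1) / 2) * (ennreal (f 0 + e) * (\<integral>\<^sup>+t. ennreal (\<bar>t\<bar> powr p k) * indicator {-d..d} t \<partial>lborel) + ennreal (C / d) * ennreal (2 * T))"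
      unfolding I_def by (rule mult_left_mono) simp
    also have "\<dots> = ennreal (f 0 + e) * (ennreal ((p k + 1) / 2) * (\<integral>\<^sup>+t. ennreal (\<bar>t\<bar> powr p k) * indicator {-d..d} t \<partial>lborel)) + ennreal ((p k + 1) / 2) * (ennreal (C / d) * ennreal (2 * T))"
      by (simp only: distrib_left mult_ac)
    also have "\<dots> = ennreal (f 0 + e) * ennreal (d powr (p k + 1)) + ennreal ((p k + 1) / 2) * (ennreal (C / d) * ennreal (2 * T))"
      using d by (subst mean) auto
    also have "\<dots> = ennreal ((f 0 + e) * d powr (p k + 1) + (p k + 1) / 2 * (C / d * (2 * T)))"
    proof -
      have "ennreal A * ennreal X + ennreal c * (ennreal q * ennreal w) = ennreal (A * X + c * (q * w))"
        if "0 \<le> A" "0 \<le> X" "0 \<le> c" "0 \<le> q" "0 \<le> w" for A X c q w :: real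
        using that by (simp add: ennreal_mult ennreal_plus)
      note sum = this
      show ?thesis by (rule sum) (use C(1)[of 0] C0 d e p(1)[of k] T(1) in auto)
    qed
    also have "(f 0 + e) * d powr (p k + 1) + (p k + 1) / 2 * (C / d * (2 * T)) = (f 0 + e) * d powr (p k + 1) + (p k + 1) * (C * T / d)"
      using d by (simp add: field_simps)
    finally show ?thesis .
  qed
  have lower: "ennreal ((f 0 - e) * d powr (p k + 1)) \<le> I k"
    if d: "0 < d" and e: "0 < e" and fd: "\<And>t. \<bar>t\<bar> \<le> d \<Longrightarrow> \<bar>f t - f 0\<bar> \<le> e" for d e k
  proof (cases "0 \<le> f 0 - e")
    case True
    have "ennreal ((f 0 - e) * d powr (p k + 1)) = ennreal (f 0 - e) * (ennreal ((p k + 1) / 2) * (\<integral>\<^sup>+t. ennreal (\<bar>t\<bar> powr p k) * indicator {-d..d} t \<partial>lborel))"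
      using True d by (subst mean) (auto simp: ennreal_mult)
    also have "\<dots> = ennreal ((p k + 1) / 2) * (\<integral>\<^sup>+t. ennreal (f 0 - e) * (ennreal (\<bar>t\<bar> powr p k) * indicator {-d..d} t) \<partial>lborel)"
      by (subst nn_integral_cmult) (auto simp: mult_ac)
    also have "\<dots> \<le> I k" unfolding I_def
    proof (intro mult_left_mono nn_integral_mono)
      fix t
      show "ennreal (f 0 - e) * (ennreal (\<bar>t\<bar> powr p k) * indicator {-d..d} t) \<le> ennreal (\<bar>t\<bar> powr p k) * ennreal (f t)"
      proof (cases "t \<in> {-d..d}")
        case True
        then have "\<bar>t\<bar> \<le> d" by (simp add: abs_le_iff)
        from fd[OF this] have "f 0 - e \<le> f t" by linarith
        then show ?thesis using True by (simp add: mult.commute mult_right_mono ennreal_leI)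
      qed simp
    qed simp
    finally show ?thesis .
  next
    case False
    then have "(f 0 - e) * d powr (p k + 1) \<le> 0" by (intro mult_nonpos_nonneg) auto
    then show ?thesis by (simp add: ennreal_neg)
  qed
  have delta: "\<exists>d. 0 < d \<and> d \<le> 1 \<and> (\<forall>t. \<bar>t\<bar> \<le> d \<longrightarrow> \<bar>f t - f 0\<bar> \<le> e)" if e: "0 < e" for e
  proof -
    obtain s where s: "0 < s" "\<And>t. dist t 0 < s \<Longrightarrow> dist (f t) (f 0) < e"
      using cont e unfolding continuous_at_eps_delta by blast
    have "\<bar>f t - f 0\<bar> \<le> e" if "\<bar>t\<bar> \<le> min 1 (s / 2)" for t
      using s(2)[of t] s(1) that by (simp add: dist_real_def)
    then show ?thesis using s(1) by (intro exI[of _ "min 1 (s / 2)"]) auto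
  qed
  have fin: "I k < \<infinity>" for k
    using delta[of 1] upper[of _ 1 k] by (metis zero_less_one ennreal_less_top infinity_ennreal_def order_le_less_trans)
  define r where "r k = enn2real (I k)" for k
  have r: "I k = ennreal (r k)" for k using fin[of k] by (simp add: r_def)
  have "r \<longlonglongrightarrow> f 0"
  proof (rule LIMSEQ_I)
    fix e :: real assume e: "0 < e"
    then obtain d where d: "0 < d" "d \<le> 1" "\<And>t. \<bar>t\<bar> \<le> d \<Longrightarrow> \<bar>f t - f 0\<bar> \<le> e / 2" using delta[of "e / 2"] by auto
    have p1: "(\<lambda>k. p k + 1) \<longlonglongrightarrow> 0" using tendsto_add[OF p(3) tendsto_const[of 1]] by simp
    then have dp: "(\<lambda>k. d powr (p k + 1)) \<longlonglongrightarrow> 1"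
      using tendsto_powr[OF tendsto_const[of d] p1] d by simp
    have "(\<lambda>k. (f 0 + e / 2) * d powr (p k + 1) + (p k + 1) * (C * T / d)) \<longlonglongrightarrow> (f 0 + e / 2) * 1 + 0 * (C * T / d)"
      by (intro tendsto_intros dp p1)
    then have "\<forall>\<^sub>F k in sequentially. (f 0 + e / 2) * d powr (p k + 1) + (p k + 1) * (C * T / d) < f 0 + e"
      by (rule order_tendstoD) (use e in auto)
    moreover have "(\<lambda>k. (f 0 - e / 2) * d powr (p k + 1)) \<longlonglongrightarrow> (f 0 - e / 2) * 1"
      by (intro tendsto_intros dp)
    then have "\<forall>\<^sub>F k in sequentially. f 0 - e < (f 0 - e / 2) * d powr (p k + 1)"
      by (rule order_tendstoD) (use e in auto)
    ultimately have "\<forall>\<^sub>F k in sequentially. norm (r k - f 0) < e"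
    proof eventually_elim
      case (elim k)
      let ?U = "(f 0 + e / 2) * d powr (p k + 1) + (p k + 1) * (C * T / d)"
      have "0 \<le> p k + 1" using p(1)[of k] by simp
      moreover have "0 \<le> C * T / d" using C0 d T(1) by simp
      moreover have "0 \<le> (f 0 + e / 2) * d powr (p k + 1)" using C(1)[of 0] e by simp
      ultimately have "0 \<le> ?U" by (meson add_nonneg_nonneg mult_nonneg_nonneg)
      then have "r k \<le> ?U" using upper[OF d(1,2) _ d(3), of k] e unfolding r by (simp add: r_def)
      moreover have "(f 0 - e / 2) * d powr (p k + 1) \<le> r k"
        using lower[OF d(1) _ d(3), of k] e unfolding r by (simp add: ennreal_le_iff r_def)
      ultimately show ?case using elim by simp
    qed
    then show "\<exists>no. \<forall>k\<ge>no. norm (r k - f 0) < e" by (simp add: eventually_sequentially)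
  qed
  then have "(\<lambda>k. ennreal (r k)) \<longlonglongrightarrow> ennreal (f 0)" by (rule tendsto_ennrealI)
  then show ?thesis by (simp add: r[symmetric] I_def)
qed

section \<open>Exceptional heights and continuity of hyperplane slices\<close>

lemma mem_closed_segment_line:
  fixes u y :: "'a::real_vector"
  assumes "u \<noteq> 0" "a \<le> b"
  shows "y + r *\<^sub>R u \<in> closed_segment (y + a *\<^sub>R u) (y + b *\<^sub>R u) \<longleftrightarrow> r \<in> {a..b}"
proof -
  have "closed_segment (y + a *\<^sub>R u) (y + b *\<^sub>R u) = (\<lambda>r. y + r *\<^sub>R u) ` closed_segment a b"
  proof -
    have "closed_segment (a *\<^sub>R u) (b *\<^sub>R u) = (\<lambda>r. r *\<^sub>R u) ` closed_segment a b"
      by (rule closed_segment_linear_image) (simp add: linear_iff scaleR_left_distrib)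
    then have "(+) y ` closed_segment (a *\<^sub>R u) (b *\<^sub>R u) = (\<lambda>r. y + r *\<^sub>R u) ` closed_segment a b"
      by (simp add: image_image)
    then show ?thesis by (simp only: closed_segment_translation)
  qed
  then show ?thesis using assms by (auto simp: closed_segment_eq_real_ivl)
qed

text \<open>The exceptional points are the endpoints of the segments. Any other point is interior to
  one of the finitely many intervals or lies in the open complement of their union. Local constancy
  of membership is the form that carries over to products of such sets.\<close>

lemma finite_exceptional_points:
  fixes u y :: "real^'n" and K :: "(real^'n) set"
  assumes u: "u \<noteq> 0" and F: "finite F" "\<forall>J\<in>F. \<exists>a b. a < b \<and> J = closed_segment (y + a *\<^sub>R u) (y + b *\<^sub>R u)"
    and K: "K \<inter> range (\<lambda>s. y + s *\<^sub>R u) = \<Union>F"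
  shows "\<exists>E. finite E \<and> (\<forall>r. r \<notin> E \<longrightarrow> (\<forall>\<^sub>F s in nhds r. y + s *\<^sub>R u \<in> K \<longleftrightarrow> y + r *\<^sub>R u \<in> K))"
proof -
  obtain a b where ab: "\<And>J. J \<in> F \<Longrightarrow> a J < b J \<and> J = closed_segment (y + a J *\<^sub>R u) (y + b J *\<^sub>R u)"
    using F(2) by metis
  have S: "y + r *\<^sub>R u \<in> K \<longleftrightarrow> r \<in> (\<Union>J\<in>F. {a J..b J})" for r
  proof -
    have "y + r *\<^sub>R u \<in> K \<longleftrightarrow> (\<exists>J\<in>F. y + r *\<^sub>R u \<in> J)" using K by blast
    also have "\<dots> \<longleftrightarrow> (\<exists>J\<in>F. r \<in> {a J..b J})"
      using ab mem_closed_segment_line[OF u] by (metis less_imp_le)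
    finally show ?thesis by simp
  qed
  have "\<forall>\<^sub>F s in nhds r. s \<in> (\<Union>J\<in>F. {a J..b J}) \<longleftrightarrow> r \<in> (\<Union>J\<in>F. {a J..b J})" if r: "r \<notin> a ` F \<union> b ` F" for r
  proof (cases "r \<in> (\<Union>J\<in>F. {a J..b J})")
    case True
    then obtain J where J: "J \<in> F" "r \<in> {a J..b J}" by blast
    then have "r \<in> {a J<..<b J}" using r by (auto simp: less_le)
    then have "\<forall>\<^sub>F s in nhds r. s \<in> {a J<..<b J}" by (intro eventually_nhds_in_open) auto
    then show ?thesis
    proof (rule eventually_mono)
      fix s assume "s \<in> {a J<..<b J}"
      then have "s \<in> (\<Union>J\<in>F. {a J..b J})" using J(1) by force
      then show "s \<in> (\<Union>J\<in>F. {a J..b J}) \<longleftrightarrow> r \<in> (\<Union>J\<in>F. {a J..b J})" using True by blast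
    qed
  next
    case False
    have "open (- (\<Union>J\<in>F. {a J..b J}))" using F(1) by (intro open_Compl closed_UN) auto
    then have "\<forall>\<^sub>F s in nhds r. s \<in> - (\<Union>J\<in>F. {a J..b J})" using False by (intro eventually_nhds_in_open) auto
    then show ?thesis using False by (auto elim!: eventually_mono)
  qed
  then show ?thesis unfolding S using F(1) by (intro exI[of _ "a ` F \<union> b ` F"]) blast
qed

context hyperplane_chart
begin

text \<open>This is the volume of the section of \<open>S\<close> at height \<open>c\<close> over
  the hyperplane. All sections are parametrised by the same space, so that continuity in
  \<open>c\<close> becomes a convergence statement for integrands.\<close>

definition slice :: "(real^'n) set \<Rightarrow> real \<Rightarrow> ennreal" where
  "slice S c = (\<integral>\<^sup>+w. indicator S (L w + c *\<^sub>R v) \<partial>lborel)"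

lemma slice_0: "S \<in> sets borel \<Longrightarrow> slice S 0 = hausdorff (CARD('n) - 1) (S \<inter> {v}\<^sup>\<bottom>)"
proof -
  assume S: "S \<in> sets borel"
  have "slice S 0 = (\<integral>\<^sup>+w. indicator (L -` S) w \<partial>lborel)"
    by (simp add: slice_def indicator_def)
  also have "\<dots> = emeasure lborel (L -` S)"
    using measurable_sets[OF measurable_chart S] by (intro nn_integral_indicator) simp
  finally show ?thesis using hausdorff_Int_hyperplane[OF S] by simp
qed

lemma inner_chart_v [simp]: "(L w + c *\<^sub>R v) \<bullet> v = c"
  using v by (simp add: inner_left_distrib norm_eq_1)

lemma measurable_slice [measurable]:
  assumes [measurable]: "S \<in> sets borel"
  shows "slice S \<in> borel_measurable borel"
  unfolding slice_def by measurable

lemma nn_integral_slice: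
  assumes [measurable]: "S \<in> sets borel" "g \<in> borel_measurable borel"
  shows "(\<integral>\<^sup>+s. g (s \<bullet> v) * indicator S s \<partial>lborel) = (\<integral>\<^sup>+c. g c * slice S c \<partial>lborel)"
proof -
  have "(\<integral>\<^sup>+s. g (s \<bullet> v) * indicator S s \<partial>lborel) = (\<integral>\<^sup>+c. \<integral>\<^sup>+w. g ((L w + c *\<^sub>R v) \<bullet> v) * indicator S (L w + c *\<^sub>R v) \<partial>lborel \<partial>lborel)"
    by (rule nn_integral_lborel_chart(2)) measurable
  also have "\<dots> = (\<integral>\<^sup>+c. g c * slice S c \<partial>lborel)"
    unfolding slice_def inner_chart_v by (intro nn_integral_cong nn_integral_cmult) measurable
  finally show ?thesis .
qed

lemma norm_chart_add_ge: "norm w \<le> norm (L w + c *\<^sub>R v)" "\<bar>c\<bar> \<le> norm (L w + c *\<^sub>R v)"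
proof -
  have "orthogonal (L w) (c *\<^sub>R v)" by (simp add: orthogonal_def)
  then have "(norm (L w + c *\<^sub>R v))\<^sup>2 = (norm w)\<^sup>2 + c\<^sup>2" using v by (simp add: norm_add_Pythagorean)
  then have "(norm w)\<^sup>2 \<le> (norm (L w + c *\<^sub>R v))\<^sup>2" "\<bar>c\<bar>\<^sup>2 \<le> (norm (L w + c *\<^sub>R v))\<^sup>2" by simp_all
  then show "norm w \<le> norm (L w + c *\<^sub>R v)" "\<bar>c\<bar> \<le> norm (L w + c *\<^sub>R v)"
    using power2_le_imp_le norm_ge_zero by metis+
qed

lemma slice_bounds:
  assumes S: "S \<subseteq> cball 0 T"
  shows "slice S c \<le> emeasure lborel (cball (0 :: real^'n codim1) T)" "T < \<bar>c\<bar> \<Longrightarrow> slice S c = 0"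
proof -
  have "indicator S (L w + c *\<^sub>R v) \<le> (indicator (cball 0 T) w :: ennreal)" for w
    using S norm_chart_add_ge(1)[of w c] by (auto simp: indicator_def intro: order_trans)
  then have "slice S c \<le> (\<integral>\<^sup>+w. indicator (cball 0 T) w \<partial>(lborel :: (real^'n codim1) measure))" unfolding slice_def by (rule nn_integral_mono)
  then show "slice S c \<le> emeasure lborel (cball (0 :: real^'n codim1) T)" by simp
  assume "T < \<bar>c\<bar>"
  then have "L w + c *\<^sub>R v \<notin> S" for w using S norm_chart_add_ge(2)[of c w] by auto
  then show "slice S c = 0" by (simp add: slice_def)
qed

text \<open>The i-th coordinate is a linear functional on the hyperplane, and its level sets are
  null unless it vanishes identically. At the projection of \<open>axis i 1\<close> to the
  hyperplane its value is 1 - v_i^2, which the assumption keeps away from 0.\<close>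

lemma negligible_chart_component:
  assumes vi: "v $ i * v $ i \<noteq> 1"
  shows "{w. L w $ i = r} \<in> null_sets lborel"
proof -
  define a where "a = adjoint L (axis i 1)"
  have La: "L w $ i = a \<bullet> w" for w
    using adjoint_works[OF linear_chart, of w "axis i 1"] by (simp add: a_def inner_axis inner_commute)
  have "a \<noteq> 0"
  proof
    assume a: "a = 0"
    have vv: "v \<bullet> v = 1" using v by (simp add: norm_eq_1)
    have "axis i 1 - (v $ i) *\<^sub>R v \<in> {v}\<^sup>\<bottom>"
      by (simp add: mem_orthogonal_comp_singleton inner_diff_left vv inner_axis')
    then obtain w where w: "L w = axis i 1 - (v $ i) *\<^sub>R v" using range_chart by (metis rangeE)
    then have "L w $ i = 1 - v $ i * v $ i" by simp
    then show False using La[of w] a vi by simp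
  qed
  then have "negligible {w. a \<bullet> w = r}" by (intro negligible_hyperplane) simp
  moreover have "closed {w. a \<bullet> w = r}" by (rule closed_hyperplane)
  ultimately have "{w. a \<bullet> w = r} \<in> null_sets lborel"
    by (simp add: negligible_iff_null_sets null_sets_completion_iff borel_closed)
  then show ?thesis unfolding La .
qed

text \<open>Dominated convergence over the hyperplane: the indicators converge at every
  \<open>w\<close> for which no coordinate of \<open>L w\<close> is exceptional, and the remaining
  \<open>w\<close> lie in finitely many null level sets.\<close>

lemma slice_continuous_at_0:
  assumes S: "closed S" "S \<subseteq> cball 0 T"
    and E: "\<And>i. finite (E i)" "\<And>s. (\<And>i. s $ i \<notin> E i) \<Longrightarrow> \<forall>\<^sub>F s' in nhds s. s' \<in> S \<longleftrightarrow> s \<in> S"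
    and vi: "\<And>i. v $ i * v $ i \<noteq> 1" and c: "c \<longlonglongrightarrow> 0"
  shows "(\<lambda>k. slice S (c k)) \<longlonglongrightarrow> slice S 0"
  unfolding slice_def
proof (rule nn_integral_dominated_convergence[where w = "indicator (cball 0 T)"])
  have [measurable]: "S \<in> sets borel" using S(1) by (rule borel_closed)
  show "(\<lambda>w. indicator S (L w + c k *\<^sub>R v)) \<in> borel_measurable lborel" for k by measurable
  show "(\<lambda>w. indicator S (L w + 0 *\<^sub>R v)) \<in> borel_measurable lborel" by measurable
  show "indicator (cball 0 T) \<in> borel_measurable (lborel :: (real^'n codim1) measure)" by (rule borel_measurable_indicator) simp
  have "indicator S (L w + c k *\<^sub>R v) \<le> (indicator (cball 0 T) w :: ennreal)" for w k
    using S norm_chart_add_ge(1)[of w "c k"] by (auto simp: indicator_def intro: order_trans)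
  then show "AE w in lborel. indicator S (L w + c k *\<^sub>R v) \<le> (indicator (cball 0 T) w :: ennreal)" for k by simp
  show "(\<integral>\<^sup>+w. indicator (cball 0 T) w \<partial>(lborel :: (real^'n codim1) measure)) < \<infinity>"
    using emeasure_bounded_finite[OF bounded_cball, of "0 :: real^'n codim1" T] by simp
  have "(\<Union>i. \<Union>r\<in>E i. {w. L w $ i = r}) \<in> null_sets lborel"
    by (intro null_sets_UN' negligible_chart_component vi countable_finite E(1)) simp
  then have "AE w in lborel. w \<notin> (\<Union>i. \<Union>r\<in>E i. {w. L w $ i = r})" by (rule AE_not_in)
  then show "AE w in lborel. (\<lambda>k. indicator S (L w + c k *\<^sub>R v)) \<longlonglongrightarrow> (indicator S (L w + 0 *\<^sub>R v) :: ennreal)"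
  proof eventually_elim
    case (elim w)
    then have ev: "\<forall>\<^sub>F s' in nhds (L w). s' \<in> S \<longleftrightarrow> L w \<in> S" by (intro E(2)) auto
    have "(\<lambda>k. L w + c k *\<^sub>R v) \<longlonglongrightarrow> L w + 0 *\<^sub>R v" by (intro tendsto_intros c)
    then have lim: "(\<lambda>k. L w + c k *\<^sub>R v) \<longlonglongrightarrow> L w" by simp
    have "\<forall>\<^sub>F k in sequentially. L w + c k *\<^sub>R v \<in> S \<longleftrightarrow> L w \<in> S"
      by (rule eventually_compose_filterlim[OF ev lim])
    then show ?case by (intro tendsto_eventually) (auto elim!: eventually_mono simp: indicator_def)
  qed
qed

end

section \<open>The integral over a single fibre\<close>

context hyperplane_basis
begin

lemma fibre_bounded:
  assumes K: "\<And>x. x \<in> K \<Longrightarrow> norm x \<le> R" and y: "\<And>i. y i \<in> {u}\<^sup>\<bottom>" and s: "s \<in> fibre u K y"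
  shows "norm s \<le> real CARD('n) * R" "norm (y i) \<le> R"
proof -
  have uu: "u \<bullet> u = 1" using u by (simp add: norm_eq_1)
  have yu: "y i \<bullet> u = 0" for i using y by (simp add: mem_orthogonal_comp_singleton)
  have k: "norm (y i + s $ i *\<^sub>R u) \<le> R" for i using s K by (simp add: fibre_def)
  have py: "(norm (y i + s $ i *\<^sub>R u))\<^sup>2 = (norm (y i))\<^sup>2 + (s $ i)\<^sup>2" for i
    using norm_add_Pythagorean[of "y i" "s $ i *\<^sub>R u"] u yu by (simp add: orthogonal_def)
  have "\<bar>s $ i\<bar> \<le> norm (y i + s $ i *\<^sub>R u)" for i
  proof (rule power2_le_imp_le)
    show "\<bar>s $ i\<bar>\<^sup>2 \<le> (norm (y i + s $ i *\<^sub>R u))\<^sup>2" using py[of i] by simp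
  qed simp
  then have si: "\<bar>s $ i\<bar> \<le> R" for i using k order_trans by blast
  have "norm s \<le> (\<Sum>i\<in>UNIV. \<bar>s $ i\<bar>)" by (rule norm_le_l1_cart)
  also have "\<dots> \<le> real CARD('n) * R" using sum_bounded_above[of UNIV "\<lambda>i. \<bar>s $ i\<bar>" R] si by simp
  finally show "norm s \<le> real CARD('n) * R" .
  have "norm (y i) \<le> norm (y i + s $ i *\<^sub>R u)"
  proof (rule power2_le_imp_le)
    show "(norm (y i))\<^sup>2 \<le> (norm (y i + s $ i *\<^sub>R u))\<^sup>2" using py[of i] by simp
  qed simp
  then show "norm (y i) \<le> R" using k[of i] by simp
qed

lemma closed_fibre: "compact K \<Longrightarrow> closed (fibre u K y)"
proof -
  assume "compact K"
  then have "closed {s. y i + s $ i *\<^sub>R u \<in> K}" for i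
    using continuous_closed_vimage[of K "\<lambda>s :: real^'n. y i + s $ i *\<^sub>R u"]
    by (simp add: vimage_def compact_imp_closed continuous_intros)
  moreover have "fibre u K y = (\<Inter>i. {s. y i + s $ i *\<^sub>R u \<in> K})" by (auto simp: fibre_def)
  ultimately show ?thesis by auto
qed

text \<open>The inner integral of \<^const>\<open>moment\<close> over \<open>s\<close>, normalised so that it converges to the integrand of \<^const>\<open>I_dir\<close>.\<close>

definition fibre_moment :: "(real^'n) set \<Rightarrow> real \<Rightarrow> ('n \<Rightarrow> real^'n) \<Rightarrow> ennreal" where
  "fibre_moment K p y = ennreal ((p + 1) / 2) *
    (\<integral>\<^sup>+s. epowr (Delta UNIV (\<lambda>i. y i + s $ i *\<^sub>R u)) p * indicator (fibre u K y) s \<partial>(lborel :: (real^'n) measure))"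

text \<open>On the fibre the volume depends on \<open>s\<close> only through c = s \<bullet> t, so
  integration over slices applies. The equation of integrands fails at c = 0, where
  \<open>epowr\<close> is \<infinity> but the real power is 0; this is one point and hence
  null.\<close>

lemma fibre_moment_eq:
  assumes K: "compact K" and y: "\<And>i. y i \<in> {u}\<^sup>\<bottom>" and t: "unit_dependency y t"
    and D: "0 < Delta B (row_of y)" and p: "-1 < p" and chart: "hyperplane_chart t L"
  shows "fibre_moment K p y = ennreal (Delta B (row_of y) powr p) *
    (ennreal ((p + 1) / 2) * (\<integral>\<^sup>+c. ennreal (\<bar>c\<bar> powr p) * hyperplane_chart.slice t L (fibre u K y) c \<partial>lborel))"
proof -
  interpret t: hyperplane_chart t L by (rule chart)
  have S [measurable]: "fibre u K y \<in> sets borel" using closed_fibre[OF K] by (rule borel_closed)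
  have "(\<integral>\<^sup>+s. epowr (Delta UNIV (\<lambda>i. y i + s $ i *\<^sub>R u)) p * indicator (fibre u K y) s \<partial>(lborel :: (real^'n) measure)) =
    (\<integral>\<^sup>+s. epowr (Delta B (row_of y) * \<bar>s \<bullet> t\<bar>) p * indicator (fibre u K y) s \<partial>lborel)"
    by (simp add: Delta_shift[OF y t])
  also have "\<dots> = (\<integral>\<^sup>+c. epowr (Delta B (row_of y) * \<bar>c\<bar>) p * t.slice (fibre u K y) c \<partial>lborel)"
    by (rule t.nn_integral_slice) measurable
  also have "\<dots> = (\<integral>\<^sup>+c. ennreal (Delta B (row_of y) powr p) * (ennreal (\<bar>c\<bar> powr p) * t.slice (fibre u K y) c) \<partial>lborel)"
    using AE_lborel_singleton[of "0::real"]
  proof (intro nn_integral_cong_AE, eventually_elim)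
    case (elim c)
    then have "epowr (Delta B (row_of y) * \<bar>c\<bar>) p = ennreal (Delta B (row_of y) powr p) * ennreal (\<bar>c\<bar> powr p)"
      using D by (simp add: epowr_pos powr_mult ennreal_mult)
    then show ?case by (simp add: mult.assoc)
  qed
  also have "\<dots> = ennreal (Delta B (row_of y) powr p) * (\<integral>\<^sup>+c. ennreal (\<bar>c\<bar> powr p) * t.slice (fibre u K y) c \<partial>lborel)"
    by (rule nn_integral_cmult) measurable
  finally show ?thesis by (simp only: fibre_moment_def mult_ac)
qed

text \<open>The power of the volume tends to its inverse, and the normalised integral over
  \<open>c\<close> tends to the slice at 0. The radius \<open>T\<close> comes from the bound for the
  fibre over a point of the hyperplane product.\<close>

lemma fibre_moment_tendsto:
  assumes K: "compact K" and R: "\<And>x. x \<in> K \<Longrightarrow> norm x \<le> R" "1 \<le> R"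
    and y: "\<And>i. y i \<in> {u}\<^sup>\<bottom>" "\<And>i. y i \<noteq> 0" and t: "unit_dependency y t" and D: "0 < Delta B (row_of y)"
    and F: "\<And>i. \<exists>F. finite F \<and> disjoint F \<and>
            (\<forall>J\<in>F. \<exists>a b. a < b \<and> J = closed_segment (y i + a *\<^sub>R u) (y i + b *\<^sub>R u)) \<and>
            K \<inter> range (\<lambda>s. y i + s *\<^sub>R u) = \<Union>F"
    and p: "\<And>k. -1 < p k" "\<And>k. p k < 0" "p \<longlonglongrightarrow> -1"
  shows "(\<lambda>k. fibre_moment K (p k) y) \<longlonglongrightarrow>
      epowr (Delta B (row_of y)) (-1) * hausdorff (CARD('n) - 1) (fibre u K y \<inter> {t}\<^sup>\<bottom>)"
proof -
  have nt: "norm t = 1" using t by (simp add: unit_dependency_def)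
  obtain L where chart: "hyperplane_chart t L" using hyperplane_chart_exists[OF n nt] by blast
  interpret t: hyperplane_chart t L by (rule chart)
  let ?S = "fibre u K y" and ?D = "Delta B (row_of y)"
  define T where "T = real CARD('n) * R"
  have T: "1 \<le> T" unfolding T_def using mult_mono[of 1 "real CARD('n)" 1 R] R(2) n by simp
  have S: "closed ?S" "?S \<subseteq> cball 0 T" "?S \<in> sets borel"
    using closed_fibre[OF K] fibre_bounded(1)[OF R(1) y(1)] by (auto simp: T_def borel_closed)
  note [measurable] = S(3)
  have u0: "u \<noteq> 0" using u by auto
  have "\<exists>E. finite E \<and> (\<forall>r. r \<notin> E \<longrightarrow> (\<forall>\<^sub>F s in nhds r. y i + s *\<^sub>R u \<in> K \<longleftrightarrow> y i + r *\<^sub>R u \<in> K))" for i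
  proof -
    obtain G where G: "finite G" "\<forall>J\<in>G. \<exists>a b. a < b \<and> J = closed_segment (y i + a *\<^sub>R u) (y i + b *\<^sub>R u)"
      "K \<inter> range (\<lambda>s. y i + s *\<^sub>R u) = \<Union>G"
      using F[of i] by auto
    show ?thesis by (rule finite_exceptional_points[OF u0 G])
  qed
  then have "\<exists>E. \<forall>i. finite (E i) \<and> (\<forall>r. r \<notin> E i \<longrightarrow> (\<forall>\<^sub>F s in nhds r. y i + s *\<^sub>R u \<in> K \<longleftrightarrow> y i + r *\<^sub>R u \<in> K))"
    by (intro choice allI)
  then obtain E where E: "\<And>i. finite (E i)"
    "\<And>i r. r \<notin> E i \<Longrightarrow> \<forall>\<^sub>F s in nhds r. y i + s *\<^sub>R u \<in> K \<longleftrightarrow> y i + r *\<^sub>R u \<in> K"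
    by auto
  have E2: "\<forall>\<^sub>F s' in nhds s. s' \<in> ?S \<longleftrightarrow> s \<in> ?S" if s: "\<And>i. s $ i \<notin> E i" for s
  proof -
    have "\<forall>\<^sub>F s' in nhds s. y i + s' $ i *\<^sub>R u \<in> K \<longleftrightarrow> y i + s $ i *\<^sub>R u \<in> K" for i
    proof -
      have "filterlim (\<lambda>s'. s' $ i) (nhds (s $ i)) (nhds s)"
        by (rule tendsto_vec_nth[OF filterlim_ident])
      then show ?thesis by (rule eventually_compose_filterlim[OF E(2)[OF s]])
    qed
    then have "\<forall>\<^sub>F s' in nhds s. \<forall>i. y i + s' $ i *\<^sub>R u \<in> K \<longleftrightarrow> y i + s $ i *\<^sub>R u \<in> K"
      by (intro eventually_all_finite)
    then show ?thesis by (rule eventually_mono) (simp add: fibre_def)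
  qed
  \<comment> \<open>If t were a coordinate vector up to sign, the dependency would reduce to y_i =
    0. This excludes slices parallel to a face of the boxes.\<close>
  have ti: "t $ i * t $ i \<noteq> 1" for i
  proof
    assume i: "t $ i * t $ i = 1"
    have "(\<Sum>j\<in>UNIV. t $ j * t $ j) = 1" using nt by (simp add: norm_eq_1 inner_vec_def)
    then have "(\<Sum>j\<in>UNIV - {i}. t $ j * t $ j) = 0" using i by (simp add: sum.remove[of UNIV i])
    then have "t $ j = 0" if "j \<noteq> i" for j using that by (simp add: sum_nonneg_eq_0_iff)
    then have "(\<Sum>j\<in>UNIV. t $ j *\<^sub>R y j) = t $ i *\<^sub>R y i" by (simp add: sum.remove[of UNIV i])
    then show False using t i y(2) by (auto simp: unit_dependency_def)
  qed
  define C where "C = measure lborel (cball (0 :: real^'n codim1) T)"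
  have em: "emeasure lborel (cball (0 :: real^'n codim1) T) = ennreal C"
    unfolding C_def by (rule emeasure_eq_ennreal_measure) (use emeasure_bounded_finite[OF bounded_cball, of "0 :: real^'n codim1" T] in simp)
  define f where "f c = enn2real (t.slice ?S c)" for c
  have "t.slice ?S c < \<infinity>" for c using t.slice_bounds(1)[OF S(2), of c] em by (auto intro: order_le_less_trans)
  then have f: "t.slice ?S c = ennreal (f c)" for c by (simp add: f_def)
  have fC: "f c \<le> C" for c
    using t.slice_bounds(1)[OF S(2), of c] unfolding em f by (simp add: ennreal_le_iff C_def)
  have "isCont f 0"
  proof -
    have "(\<lambda>k. f (c k)) \<longlonglongrightarrow> f 0" if "c \<longlonglongrightarrow> 0" for c
    proof -
      have "(\<lambda>k. ennreal (f (c k))) \<longlonglongrightarrow> ennreal (f 0)"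
        using t.slice_continuous_at_0[OF S(1,2) E(1) E2 ti that] unfolding f .
      then show ?thesis by (rule tendsto_ennrealD) (simp_all add: f_def)
    qed
    then show "isCont f 0" by (simp add: continuous_at_sequentially o_def)
  qed
  then have "(\<lambda>k. ennreal ((p k + 1) / 2) * (\<integral>\<^sup>+c. ennreal (\<bar>c\<bar> powr p k) * ennreal (f c) \<partial>lborel)) \<longlonglongrightarrow> ennreal (f 0)"
  proof (intro nn_integral_powr_concentrates[where C = C and T = T])
    show "f \<in> borel_measurable borel" unfolding f_def by measurable
    show "f c = 0" if "T < \<bar>c\<bar>" for c using t.slice_bounds(2)[OF S(2) that] by (simp add: f_def)
    show "0 \<le> f c" for c by (simp add: f_def)
  qed (use p T fC in auto)
  moreover have "(\<lambda>k. ennreal (?D powr p k)) \<longlonglongrightarrow> ennreal (?D powr (-1))"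
    using D by (intro tendsto_ennrealI tendsto_powr tendsto_const p) auto
  ultimately have "(\<lambda>k. ennreal (?D powr p k) * (ennreal ((p k + 1) / 2) * (\<integral>\<^sup>+c. ennreal (\<bar>c\<bar> powr p k) * ennreal (f c) \<partial>lborel)))
      \<longlonglongrightarrow> ennreal (?D powr (-1)) * ennreal (f 0)"
    by (intro tendsto_mult_ennreal) auto
  then show ?thesis
    using fibre_moment_eq[OF K y(1) t D p(1) chart] t.slice_0[OF S(3)] D by (simp add: f epowr_pos)
qed

text \<open>The bound must not depend on \<open>p\<close>: the normalised integral of |c|^p over
  [-T, T] is T^(p + 1) \<le> T, since T \<ge> 1, and D^p \<le> 1 + 1 / D, by the cases D \<ge> 1 and
  D < 1. The indicator appears because the fibre is empty unless every y_i has norm at most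
  \<open>R\<close>.\<close>

lemma fibre_moment_le:
  assumes K: "compact K" and R: "\<And>x. x \<in> K \<Longrightarrow> norm x \<le> R" "1 \<le> R"
    and y: "\<And>i. y i \<in> {u}\<^sup>\<bottom>" and t: "unit_dependency y t" and D: "0 < Delta B (row_of y)"
    and p: "-1 < p" "p < 0"
  shows "fibre_moment K p y \<le> ennreal (real CARD('n) * R) * emeasure lborel (cball (0 :: real^'n codim1) (real CARD('n) * R)) *
      (indicator {y. \<forall>i. y i \<in> cball 0 R} y * (1 + inverse (ennreal (Delta B (row_of y)))))"
proof (cases "fibre u K y = {}")
  case True
  then show ?thesis by (simp add: fibre_moment_def)
next
  case False
  have nt: "norm t = 1" using t by (simp add: unit_dependency_def)
  obtain L where chart: "hyperplane_chart t L" using hyperplane_chart_exists[OF n nt] by blast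
  interpret t: hyperplane_chart t L by (rule chart)
  let ?S = "fibre u K y" and ?D = "Delta B (row_of y)" and ?T = "real CARD('n) * R"
  let ?C = "emeasure lborel (cball (0 :: real^'n codim1) ?T)"
  have T: "1 \<le> ?T" using mult_mono[of 1 "real CARD('n)" 1 R] R(2) n by simp
  have S: "?S \<subseteq> cball 0 ?T" using fibre_bounded(1)[OF R(1) y] by auto
  have ind: "indicator {y. \<forall>i. y i \<in> cball 0 R} y = (1 :: ennreal)"
  proof -
    obtain s where s: "s \<in> fibre u K y" using False by blast
    have "norm (y i) \<le> R" for i by (rule fibre_bounded(2)[OF R(1) y s])
    then show ?thesis by simp
  qed
  have "ennreal (\<bar>c\<bar> powr p) * t.slice ?S c \<le> ?C * (ennreal (\<bar>c\<bar> powr p) * indicator {-?T..?T} c)" for c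
  proof (cases "\<bar>c\<bar> \<le> ?T")
    case True
    then have "c \<in> {-?T..?T}" by auto
    then show ?thesis using t.slice_bounds(1)[OF S, of c] by (simp add: mult.commute mult_left_mono)
  qed (use t.slice_bounds(2)[OF S] in auto)
  then have "(\<integral>\<^sup>+c. ennreal (\<bar>c\<bar> powr p) * t.slice ?S c \<partial>lborel) \<le> (\<integral>\<^sup>+c. ?C * (ennreal (\<bar>c\<bar> powr p) * indicator {-?T..?T} c) \<partial>lborel)"
    by (rule nn_integral_mono)
  also have "\<dots> = ?C * (\<integral>\<^sup>+c. ennreal (\<bar>c\<bar> powr p) * indicator {-?T..?T} c \<partial>lborel)"
    by (rule nn_integral_cmult) measurable
  also have "\<dots> = ?C * ennreal (2 * (?T powr (p + 1) / (p + 1)))"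
    using p T by (subst nn_integral_abs_powr) auto
  finally have "ennreal ((p + 1) / 2) * (\<integral>\<^sup>+c. ennreal (\<bar>c\<bar> powr p) * t.slice ?S c \<partial>lborel) \<le> ennreal ((p + 1) / 2) * (?C * ennreal (2 * (?T powr (p + 1) / (p + 1))))"
    by (rule mult_left_mono) simp
  also have "\<dots> = ?C * (ennreal ((p + 1) / 2) * ennreal (2 * (?T powr (p + 1) / (p + 1))))" by (simp only: mult_ac)
  also have "ennreal ((p + 1) / 2) * ennreal (2 * (?T powr (p + 1) / (p + 1))) = ennreal (?T powr (p + 1))"
  proof -
    have "(p + 1) / 2 * (2 * (X / (p + 1))) = X" for X using p by simp
    then show ?thesis using p by (subst ennreal_mult[symmetric]) (simp_all only:, auto)
  qed
  also have "?C * ennreal (?T powr (p + 1)) \<le> ?C * ennreal ?T"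
    using T p powr_mono[of "p + 1" 1 ?T] by (intro mult_left_mono ennreal_leI) auto
  finally have 1: "ennreal ((p + 1) / 2) * (\<integral>\<^sup>+c. ennreal (\<bar>c\<bar> powr p) * t.slice ?S c \<partial>lborel) \<le> ennreal ?T * ?C"
    by (simp only: mult.commute)
  have "?D powr p \<le> 1 + inverse ?D"
  proof (cases "1 \<le> ?D")
    case True
    then have "?D powr p \<le> 1" using p powr_mono[of p 0 ?D] by simp
    then show ?thesis using D by (simp add: add_increasing2)
  next
    case False
    then have "?D powr p \<le> ?D powr (-1)" using D p by (intro powr_mono') auto
    then show ?thesis using D by (simp add: powr_minus_divide inverse_eq_divide add_increasing)
  qed
  then have "ennreal (?D powr p) \<le> ennreal (1 + inverse ?D)" by (rule ennreal_leI)
  also have "\<dots> = 1 + inverse (ennreal ?D)" using D by (simp add: ennreal_plus inverse_ennreal flip: ennreal_1)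
  finally have 2: "ennreal (?D powr p) \<le> 1 + inverse (ennreal ?D)" .
  show ?thesis
    unfolding fibre_moment_eq[OF K y t D p(1) chart] ind mult_1
    using mult_mono[OF 2 1] by (simp add: mult.commute)
qed

end

section \<open>Dominated convergence over the hyperplane components\<close>

context charted_basis
begin

lemma moment_eq_fibre_moment:
  assumes K: "compact K" and p: "-1 < p"
  shows "moment K p = ennreal (2 / CARD('n)) * (\<integral>\<^sup>+y. fibre_moment K p y \<partial>(\<Pi>\<^sub>M i\<in>(UNIV :: 'n set). perp_measure u))"
    and "fibre_moment K p \<in> borel_measurable (\<Pi>\<^sub>M i\<in>(UNIV :: 'n set). perp_measure u)"
proof -
  let ?F = "\<lambda>x :: 'n \<Rightarrow> real^'n. epowr (Delta UNIV x) p * indicator (UNIV \<rightarrow> K) x"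
  let ?G = "\<lambda>y. \<integral>\<^sup>+s. ?F (\<lambda>i. y i + s $ i *\<^sub>R u) \<partial>(lborel :: (real^'n) measure)"
  have "(\<lambda>x :: 'n \<Rightarrow> real^'n. x i) \<in> borel_measurable (\<Pi>\<^sub>M i\<in>UNIV. lborel)" for i
    using measurable_component_singleton[of i UNIV "\<lambda>_. lborel :: (real^'n) measure"] by simp
  then have [measurable]: "row_det \<in> borel_measurable (\<Pi>\<^sub>M i\<in>(UNIV :: 'n set). (lborel :: (real^'n) measure))"
    by (rule measurable_row_det)
  have [measurable]: "(UNIV \<rightarrow> K) \<in> sets (\<Pi>\<^sub>M i\<in>(UNIV :: 'n set). lborel)"
    using sets_PiM_I_finite[of "UNIV :: 'n set" "\<lambda>_. K" "\<lambda>_. lborel"] K by (simp add: PiE_UNIV_domain borel_compact)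
  have F: "?F \<in> borel_measurable (\<Pi>\<^sub>M i\<in>(UNIV :: 'n set). lborel)"
    unfolding Delta_UNIV row_det_def[symmetric] by measurable
  have G: "?G \<in> borel_measurable (\<Pi>\<^sub>M i\<in>(UNIV :: 'n set). perp_measure u)"
    by (rule nn_integral_PiM_lborel(2)[OF F])
  have fm: "fibre_moment K p = (\<lambda>y. ennreal ((p + 1) / 2) * ?G y)"
    unfolding fibre_moment_def by (intro ext arg_cong2[where f = "(*)"] nn_integral_cong) (auto simp: indicator_def fibre_def)
  show "fibre_moment K p \<in> borel_measurable (\<Pi>\<^sub>M i\<in>(UNIV :: 'n set). perp_measure u)"
    unfolding fm by (rule borel_measurable_times_ennreal[OF borel_measurable_const G])
  have "moment K p = ennreal ((p + 1) / CARD('n)) * (\<integral>\<^sup>+y. ?G y \<partial>(\<Pi>\<^sub>M i\<in>(UNIV :: 'n set). perp_measure u))"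
    unfolding moment_def nn_integral_PiM_lborel(1)[OF F] ..
  also have "ennreal ((p + 1) / CARD('n)) = ennreal (2 / CARD('n)) * ennreal ((p + 1) / 2)"
  proof -
    have "a / m = 2 / m * (a / 2)" for a m :: real by simp
    then have "ennreal ((p + 1) / CARD('n)) = ennreal (2 / CARD('n) * ((p + 1) / 2))" by (rule arg_cong)
    also have "\<dots> = ennreal (2 / CARD('n)) * ennreal ((p + 1) / 2)"
      using p by (intro ennreal_mult) auto
    finally show ?thesis .
  qed
  finally show "moment K p = ennreal (2 / CARD('n)) * (\<integral>\<^sup>+y. fibre_moment K p y \<partial>(\<Pi>\<^sub>M i\<in>(UNIV :: 'n set). perp_measure u))"
    unfolding fm nn_integral_cmult[OF G] by (simp only: mult.assoc)
qed

lemma nn_integral_ball_weight_finite: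
  "(\<integral>\<^sup>+y. ball_weight R UNIV y \<partial>(\<Pi>\<^sub>M i\<in>UNIV. perp_measure u)) < \<infinity>"
proof -
  have "indicator (cball 0 R) \<in> borel_measurable (perp_measure u)"
    by (intro measurable_perp borel_measurable_indicator) simp
  then have "(\<integral>\<^sup>+y. ball_weight R UNIV y \<partial>(\<Pi>\<^sub>M i\<in>UNIV. perp_measure u)) = (\<Prod>i\<in>(UNIV :: 'n set). ball_volume R)"
    unfolding ball_weight_def by (subst perps.product_nn_integral_prod) (simp_all only: nn_integral_perp_ball finite)
  also have "\<dots> < \<infinity>" using ball_volume_finite[of R] by (simp add: less_top[symmetric] power_eq_top_ennreal)
  finally show ?thesis .
qed

end

theorem theorem1p12:
  fixes u :: "real^'n" and K :: "(real^'n) set"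
    and B :: "(real^'n) set" and \<theta> :: "('n \<Rightarrow> real^'n) \<Rightarrow> real^'n"
  assumes "CARD('n) \<ge> 2"
    and "norm u = 1"
    and "compact K"
    and "u_finite u K"
    and "orthonormal_basis B ({u}\<^sup>\<bottom>)"
    and "\<And>y. (\<forall>i. y i \<in> {u}\<^sup>\<bottom>) \<Longrightarrow> unit_dependency y (\<theta> y)"
  shows "(moment K \<longlongrightarrow> I_zero K) (at_right (-1)) \<and>
         I_zero K < \<infinity> \<and>
         I_zero K = I_dir B \<theta> u K \<and>
         (AE y in (\<Pi>\<^sub>M i\<in>UNIV. perp_measure u).
            \<forall>t. unit_dependency y t \<longrightarrow> t = \<theta> y \<or> t = - \<theta> y)"
proof -
  obtain L where "hyperplane_chart u L" using hyperplane_chart_exists[OF assms(1,2)] by blast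
  moreover have "hyperplane_basis u B" using assms(1,2,5) by (rule hyperplane_basis.intro)
  ultimately interpret charted_basis u L B by (rule charted_basis.intro)
  let ?M = "\<Pi>\<^sub>M i\<in>(UNIV :: 'n set). perp_measure u"
  obtain b where b: "\<And>x. x \<in> K \<Longrightarrow> norm x \<le> b"
    using compact_imp_bounded[OF assms(3)] unfolding bounded_iff by blast
  \<comment> \<open>The maximum with 1 serves the dominating function: the slices are then supported
    in [-T, T] with T \<ge> 1.\<close>
  define R where "R = max 1 b"
  have R: "\<And>x. x \<in> K \<Longrightarrow> norm x \<le> R" "1 \<le> R" using b by (force simp: R_def)+
  define P where "P z \<longleftrightarrow> (\<exists>F. finite F \<and> disjoint F \<and>
            (\<forall>J\<in>F. \<exists>a b. a < b \<and> J = closed_segment (z + a *\<^sub>R u) (z + b *\<^sub>R u)) \<and>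
            K \<inter> range (\<lambda>s. z + s *\<^sub>R u) = \<Union>F)" for z
  define good where "good y \<longleftrightarrow> (\<forall>i. y i \<in> {u}\<^sup>\<bottom>) \<and> (\<forall>i. y i \<noteq> 0) \<and> (\<forall>i. P (y i)) \<and> 0 < Delta B (row_of y)" for y
  have AE_perp: "AE y in ?M. \<forall>i. y i \<in> {u}\<^sup>\<bottom>"
    by (rule AE_I2) (simp add: space_PiM PiE_iff space_perp_measure)
  have "AE z in perp_measure u. P z" using assms(4) unfolding u_finite_def P_def .
  from AE_PiM_perp_component[OF this] have AE_good: "AE y in ?M. good y"
    using AE_perp AE_PiM_perp_component[OF AE_perp_nonzero] AE_minor_norm_pos
  proof eventually_elim
    case (elim y)
    then have "Delta B (row_of y) = minor_norm y"
      using Delta_row_of_eq_minor_norm assms(6) by blast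
    then show ?case using elim by (simp add: good_def)
  qed
  define h where "h y = epowr (Delta B (row_of y)) (-1) * hausdorff (CARD('n) - 1) (fibre u K y \<inter> {\<theta> y}\<^sup>\<bottom>)" for y
  have conv: "(\<lambda>k. fibre_moment K (p k) y) \<longlonglongrightarrow> h y"
    if "good y" and p: "\<And>k. -1 < p k" "\<And>k. p k < 0" "p \<longlonglongrightarrow> -1" for p :: "nat \<Rightarrow> real" and y
    unfolding h_def
    by (rule fibre_moment_tendsto[OF assms(3) R _ _ assms(6)]) (use that in \<open>auto simp: good_def P_def\<close>)
  define c where "c = ennreal (real CARD('n) * R) * emeasure lborel (cball (0 :: real^'n codim1) (real CARD('n) * R))"
  define w where "w y = c * (ball_weight R UNIV y * (1 + inverse (ennreal (minor_norm y))))" for y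
  have bound: "AE y in ?M. fibre_moment K p y \<le> w y" if p: "-1 < p" "p < 0" for p
    using AE_good
  proof eventually_elim
    case (elim y)
    then have y: "\<And>i. y i \<in> {u}\<^sup>\<bottom>" and D: "0 < Delta B (row_of y)" by (auto simp: good_def)
    have t: "unit_dependency y (\<theta> y)" using assms(6) y by blast
    show ?case
      using fibre_moment_le[OF assms(3) R y t D p]
      by (simp add: w_def c_def ball_weight_eq_indicator Delta_row_of_eq_minor_norm[OF y t])
  qed
  have w [measurable]: "w \<in> borel_measurable ?M" unfolding w_def by measurable
  have w_fin: "(\<integral>\<^sup>+y. w y \<partial>?M) < \<infinity>"
  proof -
    have "c < \<infinity>"
      using emeasure_bounded_finite[OF bounded_cball, of "0 :: real^'n codim1" "real CARD('n) * R"]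
      by (simp add: c_def ennreal_mult_less_top)
    moreover have "(\<integral>\<^sup>+y. w y \<partial>?M) = c * ((\<integral>\<^sup>+y. ball_weight R UNIV y \<partial>?M) + (\<integral>\<^sup>+y. ball_weight R UNIV y * inverse (ennreal (minor_norm y)) \<partial>?M))"
    proof -
      have "(\<integral>\<^sup>+y. w y \<partial>?M) = c * (\<integral>\<^sup>+y. ball_weight R UNIV y * (1 + inverse (ennreal (minor_norm y))) \<partial>?M)"
        unfolding w_def by (rule nn_integral_cmult) measurable
      also have "(\<integral>\<^sup>+y. ball_weight R UNIV y * (1 + inverse (ennreal (minor_norm y))) \<partial>?M) =
        (\<integral>\<^sup>+y. ball_weight R UNIV y \<partial>?M) + (\<integral>\<^sup>+y. ball_weight R UNIV y * inverse (ennreal (minor_norm y)) \<partial>?M)"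
        unfolding distrib_left mult_1_right by (rule nn_integral_add) measurable
      finally show ?thesis .
    qed
    ultimately show ?thesis
      using nn_integral_ball_weight_finite[of R] nn_integral_inverse_minor_norm[of R]
      by (simp add: ennreal_mult_less_top)
  qed
  text \<open>\<open>h\<close> need not be measurable, as \<open>\<theta>\<close> is arbitrary; \<open>g\<close> is a measurable function that agrees with it almost everywhere.\<close>
  define q where "q k = -1 + 1 / (real k + 2)" for k :: nat
  have q: "-1 < q k" "q k < 0" for k by (auto simp: q_def field_simps)
  have "(\<lambda>k. 1 / (real k + 2)) \<longlonglongrightarrow> 0"
    using LIMSEQ_ignore_initial_segment[OF lim_1_over_n, of 2] by (simp add: add.commute)
  then have q_lim: "q \<longlonglongrightarrow> -1" unfolding q_def using tendsto_add[OF tendsto_const[of "-1"]] by fastforce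
  define g where "g y = liminf (\<lambda>k. fibre_moment K (q k) y)" for y
  have g [measurable]: "g \<in> borel_measurable ?M"
    unfolding g_def by (intro borel_measurable_liminf moment_eq_fibre_moment(2) assms(3) q(1))
  have gh: "g y = h y" if "good y" for y
    unfolding g_def using lim_imp_Liminf[OF _ conv[OF that q(1,2) q_lim]] by simp
  have lim: "(\<lambda>k. \<integral>\<^sup>+y. fibre_moment K (p k) y \<partial>?M) \<longlonglongrightarrow> (\<integral>\<^sup>+y. g y \<partial>?M)"
    if p: "\<And>k. -1 < p k" "\<And>k. p k < 0" "p \<longlonglongrightarrow> -1" for p :: "nat \<Rightarrow> real"
  proof (rule nn_integral_dominated_convergence[where w = w])
    show "AE y in ?M. (\<lambda>k. fibre_moment K (p k) y) \<longlonglongrightarrow> g y"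
      using AE_good by eventually_elim (simp add: gh conv p)
    show "(\<integral>\<^sup>+y. w y \<partial>?M) < \<infinity>" by (rule w_fin)
  qed (use p in \<open>auto intro!: moment_eq_fibre_moment(2) assms(3) bound g w\<close>)
  define I where "I = ennreal (2 / CARD('n)) * (\<integral>\<^sup>+y. g y \<partial>?M)"
  have tends: "(moment K \<longlongrightarrow> I) (at_right (-1))"
  \<comment> \<open>A right-sided limit may be tested on sequences, and the bound 0 restricts them
    to (-1, 0), where the dominating function is valid.\<close>
  proof (rule tendsto_at_right_sequentially[of "-1" 0])
    fix p :: "nat \<Rightarrow> real"
    assume p: "\<And>k. -1 < p k" "\<And>k. p k < 0" "p \<longlonglongrightarrow> -1"
    show "(\<lambda>k. moment K (p k)) \<longlonglongrightarrow> I"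
      unfolding I_def moment_eq_fibre_moment(1)[OF assms(3) p(1)]
      by (intro ennreal_tendsto_cmult lim p) simp
  qed simp
  then have I0: "I_zero K = I" unfolding I_zero_def by (intro tendsto_Lim) auto
  have "(\<integral>\<^sup>+y. g y \<partial>?M) \<le> (\<integral>\<^sup>+y. w y \<partial>?M)"
    by (rule LIMSEQ_le_const2[OF lim[OF q q_lim]]) (auto intro!: nn_integral_mono_AE bound q)
  then have "(\<integral>\<^sup>+y. g y \<partial>?M) < \<infinity>" using w_fin by (rule order_le_less_trans)
  then have fin: "I < \<infinity>" by (simp add: I_def ennreal_mult_less_top)
  have "(\<integral>\<^sup>+y\<in>(UNIV \<rightarrow> perp_proj u ` K). h y \<partial>?M) = (\<integral>\<^sup>+y. g y \<partial>?M)"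
  \<comment> \<open>Outside the product of the projections the fibre is empty, so \<open>h\<close>
    vanishes there and the restriction of the domain changes nothing. An almost everywhere
    comparison of integrands asks for no measurability of \<open>h\<close>.\<close>
  proof (rule nn_integral_cong_AE)
    show "AE y in ?M. h y * indicator (UNIV \<rightarrow> perp_proj u ` K) y = g y"
      using AE_good
    proof eventually_elim
      case (elim y)
      show ?case
      proof (cases "y \<in> UNIV \<rightarrow> perp_proj u ` K")
        case False
        have "s \<notin> fibre u K y" for s
        proof
          assume s: "s \<in> fibre u K y"
          have "y i = perp_proj u (y i + s $ i *\<^sub>R u)" for i
          proof -
            have "y i \<bullet> u = 0" using elim by (simp add: good_def mem_orthogonal_comp_singleton)
            moreover have "u \<bullet> u = 1" using assms(2) by (simp add: norm_eq_1)
            ultimately show ?thesis by (simp add: perp_proj_def inner_left_distrib)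
          qed
          then have "y i \<in> perp_proj u ` K" for i using s unfolding fibre_def by blast
          then show False using False by blast
        qed
        then have "fibre u K y = {}" by blast
        then show ?thesis using False gh[OF elim] by (simp add: h_def)
      qed (simp add: gh[OF elim])
    qed
  qed
  then have Id: "I_dir B \<theta> u K = I" unfolding I_dir_def I_def h_def by simp
  have "AE y in ?M. \<forall>t. unit_dependency y t \<longrightarrow> t = \<theta> y \<or> t = - \<theta> y"
    using AE_good
  proof eventually_elim
    case (elim y)
    then have y: "\<And>i. y i \<in> {u}\<^sup>\<bottom>" and D: "Delta B (row_of y) \<noteq> 0" by (auto simp: good_def)
    have t: "unit_dependency y (\<theta> y)" using assms(6) y by blast
    show ?case using unit_dependency_unique[OF y t _ D] by blast
  qed
  then show ?thesis using tends fin I0 Id by simp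
qed

end
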